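(* Let $G$ be one of the connected and simply connected real Lie groups $G_2, G_3, G_4^{00}, G_9, G_{10}^{\lambda}$ ($\lambda\in\mathbb{R}$), with Lie algebra $\mathcal{G}$. For $F\in\mathcal{G}^*$ let $(\alpha_1,\dots,\alpha_5,\alpha,\beta)$ be the coordinates of $F$ in the dual basis $(X_1^*,\dots,X_5^*,X^*,Y^* )$, and let $\Omega_F$ be the coadjoint orbit of $G$ through $F$. Write $(x_1^*,\dots,x_5^*,x^*,y^* )$ for the coordinates of a general point of $\mathcal{G}^*\equiv\mathbb{R}^7$ in the same dual basis. Then the maximal dimension of the coadjoint orbits of $G$ is exactly $6$, and the $6$-dimensional orbits are as follows. 1. For $G=G_2$: $\dim\Omega_F=6$ if and only if $\alpha_4\neq 0$ and $\alpha_3^2+\alpha_5^2\neq 0$. Moreover: (i) If $\alpha_3\alpha_4\neq 0=\alpha_5$ (and $\alpha_1,\alpha_2,\alpha,\beta\in\mathbb{R}$ arbitrary), then $\Omega_F$ is the following part of the hyperplane $\{x_5^*=0\}$: $\Omega_F=\{x_5^*=0,\ \alpha_3x_3^*>0,\ \alpha_4x_4^*>0\}$. (ii) If $\alpha_4\alpha_5\neq 0$ (and $\alpha_1,\alpha_2,\alpha_3,\alpha,\beta\in\mathbb{R}$ arbitrary), then $\Omega_F$ is the following part of a hypersurface of degree two: $\Omega_F=\{x_2^*-\frac{x_3^*x_4^*}{x_5^*}=\frac{\alpha_2\alpha_5-\alpha_3\alpha_4}{\alpha_5},\ \alpha_4x_4^*>0,\ \alpha_5x_5^*>0\}$. 2.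 For $G=G_4^{00}$: $\dim\Omega_F=6$ if and only if $\alpha_5\neq 0$ and $\alpha_2^2+\alpha_4^2\neq 0$. Moreover: (i) If $\alpha_2\alpha_5\neq 0=\alpha_4$ (and $\alpha_1,\alpha_3,\alpha,\beta\in\mathbb{R}$ arbitrary), then $\Omega_F$ is the following part of the hyperplane $\{x_4^*=0\}$: $\Omega_F=\{x_4^*=0,\ \alpha_2x_2^*>0,\ \alpha_5x_5^*>0\}$. (ii) If $\alpha_4\alpha_5\neq 0$ (and $\alpha_1,\alpha_2,\alpha_3,\alpha,\beta\in\mathbb{R}$ arbitrary), then $\Omega_F$ is the following part of a hypersurface of degree two: $\Omega_F=\{x_3^*-\frac{x_2^*x_5^*}{x_4^*}=\frac{\alpha_3\alpha_4-\alpha_2\alpha_5}{\alpha_4},\ \alpha_4x_4^*>0,\ \alpha_5x_5^*>0\}$. 3. For $G\in\{G_3,G_9,G_{10}^{\lambda}\}$: $\dim\Omega_F=6$ if and only if either ($\alpha_4=0$ and $\alpha_2\alpha_5\neq 0$) or ($\alpha_4\neq 0$ and $\alpha_3^2+\alpha_5^2\neq 0$). Moreover: (i) If $\alpha_4=0\neq\alpha_2\alpha_5$ (and $\alpha_1,\alpha_3,\alpha,\beta\in\mathbb{R}$ arbitrary), then $\Omega_F$ is the following part of the hyperplane $\{x_4^*=0\}$: $\Omega_F=\{x_4^*=0,\ \alpha_2x_2^*>0,\ \alpha_5x_5^*>0\}$. (ii) If $\alpha_5=0\neq\alpha_3\alpha_4$ (and $\alpha_1,\alpha_2,\alpha,\beta\in\mathbb{R}$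 arbitrary), then $\Omega_F$ is the following part of the hyperplane $\{x_5^*=0\}$: $\Omega_F=\{x_5^*=0,\ \alpha_3x_3^*>0,\ \alpha_4x_4^*>0\}$. (iii) If $\alpha_4\alpha_5\neq 0$ (and $\alpha_1,\alpha_2,\alpha_3,\alpha,\beta\in\mathbb{R}$ arbitrary), then: - for $G=G_3$, $\Omega_F$ is the following part of an algebraic hypersurface of degree two: $\Omega_F=\{\frac{x_2^*}{x_4^*}-\frac{x_3^*}{x_5^*}=\frac{\alpha_2}{\alpha_4}-\frac{\alpha_3}{\alpha_5},\ \alpha_4x_4^*>0,\ \alpha_5x_5^*>0\}$; - for $G=G_9$, $\Omega_F$ is the following part of a transcendental hypersurface: $\Omega_F=\{\frac{x_2^*}{x_4^*}-\frac{x_3^*}{x_5^*}+\ln|x_4^*|=\frac{\alpha_2}{\alpha_4}-\frac{\alpha_3}{\alpha_5}+\ln|\alpha_4|,\ \alpha_4x_4^*>0,\ \alpha_5x_5^*>0\}$; - for $G=G_{10}^{\lambda}$, $\Omega_F$ is the following part of a transcendental hypersurface: $\Omega_F=\{\frac{x_2^*}{x_4^*}-\frac{x_3^*}{x_5^*}+\ln\frac{|x_5^*|}{|x_4^*|^{\lambda}}=\frac{\alpha_2}{\alpha_4}-\frac{\alpha_3}{\alpha_5}+\ln\frac{|\alpha_5|}{|\alpha_4|^{\lambda}},\ \alpha_4x_4^*>0,\ \alpha_5x_5^*>0\}$. Here each set in braces denotes the set of all points $(x_1^*,\dots,x_5^*,x^*,y^* )\in\mathcal{G}^*$ satisfying the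 listed conditions (coordinates not mentioned are free in $\mathbb{R}$).
   Context: Each Lie algebra below is a $7$-dimensional real Lie algebra with basis $(X_1,X_2,X_3,X_4,X_5,X,Y)$. In all of them $[X_1,X_2]=X_4$, $[X_1,X_3]=X_5$, $[X,Y]=0$. The remaining non-zero brackets (up to antisymmetry) are: - $\mathcal{G}_2$: $[X,X_1]=X_1,\ [X,X_4]=X_4,\ [X,X_5]=X_5,\ [Y,X_3]=X_3,\ [Y,X_5]=X_5$. - $\mathcal{G}_3$: $[X,X_2]=X_2,\ [X,X_4]=X_4,\ [Y,X_3]=X_3,\ [Y,X_5]=X_5$. - $\mathcal{G}_4^{00}$: $[X,X_1]=X_1,\ [X,X_4]=X_4,\ [X,X_5]=X_5,\ [Y,X_2]=X_2,\ [Y,X_4]=X_4$. - $\mathcal{G}_9$: $[X,X_3]=X_3,\ [X,X_5]=X_5,\ [Y,X_2]=X_2,\ [Y,X_4]=X_4,\ [Y,X_3]=X_5$. - $\mathcal{G}_{10}^{\lambda}$ ($\lambda\in\mathbb{R}$): $[X,X_2]=X_2,\ [X,X_3]=\lambda X_3,\ [X,X_4]=X_4,\ [X,X_5]=\lambda X_5,\ [Y,X_3]=X_3+X_5,\ [Y,X_5]=X_5$. $G_2,G_3,G_4^{00},G_9,G_{10}^{\lambda}$ denote the corresponding connected and simply connected real Lie groups. The coadjoint representation $K$ of $G$ on the dual space $\mathcal{G}^*$ is defined by $\langle K(g)F,Z\rangle=\langle F,\mathrm{Ad}(g^{-1})Z\rangle$ for $g\in G$, $F\in\mathcal{G}^*$,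 $Z\in\mathcal{G}$, and the coadjoint orbit (K-orbit) of $F$ is $\Omega_F=\{K(g)F: g\in G\}$. *)

theory Defs
  imports "HOL-Analysis.Analysis" "HOL-Algebra.Group"
begin

section \<open>Smooth maps and manifolds\<close>

text \<open>
  \<open>C_k k S f\<close>, for an open set \<open>S\<close>: \<open>f\<close> is \<open>k\<close> times continuously differentiable on \<open>S\<close>.
\<close>

primrec C_k :: "nat \<Rightarrow> 'a::euclidean_space set \<Rightarrow> ('a \<Rightarrow> 'b::real_normed_vector) \<Rightarrow> bool" where
  "C_k 0 S f \<longleftrightarrow> continuous_on S f"
| "C_k (Suc k) S f \<longleftrightarrow>
     (\<exists>f'. (\<forall>x\<in>S. (f has_derivative f' x) (at x)) \<and> (\<forall>b\<in>Basis. C_k k S (\<lambda>x. f' x b)))"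

definition smooth_on :: "'a::euclidean_space set \<Rightarrow> ('a \<Rightarrow> 'b::real_normed_vector) \<Rightarrow> bool" where
  "smooth_on S f \<longleftrightarrow> (\<forall>k. C_k k S f)"

text \<open>
  A chart is a pair \<open>(U, \<phi>)\<close> of its domain and its coordinate map; the values of \<open>\<phi>\<close> outside
  \<open>U\<close> are irrelevant. A manifold is a set \<open>M\<close>, with the subspace topology, and an atlas.
\<close>

type_synonym ('m, 'e) chart = "'m set \<times> ('m \<Rightarrow> 'e)"

definition smooth_atlas ::
    "'m::topological_space set \<Rightarrow> ('m, 'e::euclidean_space) chart set \<Rightarrow> bool" where
  "smooth_atlas M A \<longleftrightarrow>
     (\<Union>(U, \<phi>)\<in>A. U) = M \<and>
     (\<forall>(U, \<phi>)\<in>A. openin (top_of_set M) U \<and> open (\<phi> ` U) \<and>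
        homeomorphism U (\<phi> ` U) \<phi> (inv_into U \<phi>)) \<and>
     (\<forall>(U, \<phi>)\<in>A. \<forall>(V, \<psi>)\<in>A. smooth_on (\<phi> ` (U \<inter> V)) (\<psi> \<circ> inv_into U \<phi>))"

definition smooth_map ::
    "'m::topological_space set \<Rightarrow> ('m, 'e::euclidean_space) chart set \<Rightarrow>
     'n::topological_space set \<Rightarrow> ('n, 'f::euclidean_space) chart set \<Rightarrow> ('m \<Rightarrow> 'n) \<Rightarrow> bool" where
  "smooth_map M A N B f \<longleftrightarrow>
     continuous_on M f \<and> f ` M \<subseteq> N \<and>
     (\<forall>(U, \<phi>)\<in>A. \<forall>(V, \<psi>)\<in>B. smooth_on (\<phi> ` (U \<inter> f -` V)) (\<psi> \<circ> f \<circ> inv_into U \<phi>))"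

definition prod_atlas ::
    "('m, 'e) chart set \<Rightarrow> ('n, 'f) chart set \<Rightarrow> ('m \<times> 'n, 'e \<times> 'f) chart set" where
  "prod_atlas A B = {(U \<times> V, map_prod \<phi> \<psi>) |U \<phi> V \<psi>. (U, \<phi>) \<in> A \<and> (V, \<psi>) \<in> B}"


section \<open>Lie groups\<close>

record ('g, 'e) lie_group = "'g monoid" +
  atlas :: "('g, 'e) chart set"

definition is_lie_group ::
    "('g::{t2_space,second_countable_topology}, 'e::euclidean_space) lie_group \<Rightarrow> bool" where
  "is_lie_group G \<longleftrightarrow>
     group G \<and>
     smooth_atlas (carrier G) (atlas G) \<and>
     smooth_map (carrier G \<times> carrier G) (prod_atlas (atlas G) (atlas G)) (carrier G) (atlas G)
       (\<lambda>(g, h). g \<otimes>\<^bsub>G\<^esub> h) \<and>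
     smooth_map (carrier G) (atlas G) (carrier G) (atlas G) (\<lambda>g. inv\<^bsub>G\<^esub> g)"

text \<open>
  For a chart \<open>c = (U, \<phi>)\<close> around the identity, the differential of \<open>\<phi>\<close> identifies the tangent space
  at the identity, that is the Lie algebra, with the model space \<open>'e\<close>.
\<close>

definition chart_at_one :: "('g, 'e) lie_group \<Rightarrow> ('g, 'e) chart \<Rightarrow> bool" where
  "chart_at_one G c \<longleftrightarrow> c \<in> atlas G \<and> \<one>\<^bsub>G\<^esub> \<in> fst c"

text \<open>
  The left-invariant vector field with value \<open>v\<close> at the identity, read in the chart \<open>c\<close>: at the
  group element \<open>g\<close> with coordinates \<open>x\<close> it is the differential at the identity of left translation
  by \<open>g\<close>, applied to \<open>v\<close>.
\<close>

definition left_inv_field ::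
    "('g, 'e::euclidean_space) lie_group \<Rightarrow> ('g, 'e) chart \<Rightarrow> 'e \<Rightarrow> 'e \<Rightarrow> 'e" where
  "left_inv_field G c v x = (case c of (U, \<phi>) \<Rightarrow>
     frechet_derivative (\<lambda>y. \<phi> (inv_into U \<phi> x \<otimes>\<^bsub>G\<^esub> inv_into U \<phi> y)) (at (\<phi> \<one>\<^bsub>G\<^esub>)) v)"

definition field_commutator ::
    "('e::real_normed_vector \<Rightarrow> 'e) \<Rightarrow> ('e \<Rightarrow> 'e) \<Rightarrow> 'e \<Rightarrow> 'e" where
  "field_commutator V W x =
     frechet_derivative W (at x) (V x) - frechet_derivative V (at x) (W x)"

definition lie_bracket ::
    "('g, 'e::euclidean_space) lie_group \<Rightarrow> ('g, 'e) chart \<Rightarrow> 'e \<Rightarrow> 'e \<Rightarrow> 'e" where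
  "lie_bracket G c v w =
     field_commutator (left_inv_field G c v) (left_inv_field G c w) (snd c \<one>\<^bsub>G\<^esub>)"

definition Ad :: "('g, 'e::euclidean_space) lie_group \<Rightarrow> ('g, 'e) chart \<Rightarrow> 'g \<Rightarrow> 'e \<Rightarrow> 'e" where
  "Ad G c g = (case c of (U, \<phi>) \<Rightarrow>
     frechet_derivative (\<lambda>x. \<phi> (g \<otimes>\<^bsub>G\<^esub> inv_into U \<phi> x \<otimes>\<^bsub>G\<^esub> inv\<^bsub>G\<^esub> g)) (at (\<phi> \<one>\<^bsub>G\<^esub>)))"

definition coadjoint ::
    "('g, 'e::euclidean_space) lie_group \<Rightarrow> ('g, 'e) chart \<Rightarrow> 'g \<Rightarrow> ('e \<Rightarrow>\<^sub>L real) \<Rightarrow> ('e \<Rightarrow>\<^sub>L real)"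
  where "coadjoint G c g F = F o\<^sub>L Blinfun (Ad G c (inv\<^bsub>G\<^esub> g))"

definition coadjoint_orbit ::
    "('g, 'e::euclidean_space) lie_group \<Rightarrow> ('g, 'e) chart \<Rightarrow> ('e \<Rightarrow>\<^sub>L real) \<Rightarrow> ('e \<Rightarrow>\<^sub>L real) set" where
  "coadjoint_orbit G c F = (\<lambda>g. coadjoint G c g F) ` carrier G"

text \<open>
  The velocities at \<open>p\<close> of the smooth curves in \<open>S\<close> through \<open>p\<close>. An orbit of a smooth Lie group
  action is an initial submanifold of the ambient space: smooth curves of the ambient space which
  stay in the orbit are smooth curves of the orbit. So for an orbit this set is its tangent space
  at \<open>p\<close>; by homogeneity its dimension does not depend on \<open>p\<close>.
\<close>

definition tangent_vectors :: "'v::real_normed_vector set \<Rightarrow> 'v \<Rightarrow> 'v set" where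
  "tangent_vectors S p =
     {v. \<exists>c::real \<Rightarrow> 'v. smooth_on UNIV c \<and> range c \<subseteq> S \<and> c 0 = p \<and>
           (c has_vector_derivative v) (at 0)}"

definition orbit_dim ::
    "('g, 'e::euclidean_space) lie_group \<Rightarrow> ('g, 'e) chart \<Rightarrow> ('e \<Rightarrow>\<^sub>L real) \<Rightarrow> nat" where
  "orbit_dim G c F = dim (tangent_vectors (coadjoint_orbit G c F) F)"


section \<open>The Lie algebras\<close>

text \<open>
  \<open>DX\<close> and \<open>DY\<close> list the values of \<open>[X, _]\<close> and \<open>[Y, _]\<close> on \<open>X1, X2, X3, X4, X5\<close>. The remaining
  brackets follow by antisymmetry.
\<close>

definition seven_dim_algebra ::
    "('e::real_vector \<Rightarrow> 'e \<Rightarrow> 'e) \<Rightarrow> 'e \<Rightarrow> 'e \<Rightarrow> 'e \<Rightarrow> 'e \<Rightarrow> 'e \<Rightarrow> 'e \<Rightarrow> 'e \<Rightarrow>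
     'e list \<Rightarrow> 'e list \<Rightarrow> bool" where
  "seven_dim_algebra br X1 X2 X3 X4 X5 X Y DX DY \<longleftrightarrow>
     distinct [X1, X2, X3, X4, X5, X, Y] \<and>
     independent {X1, X2, X3, X4, X5, X, Y} \<and>
     span {X1, X2, X3, X4, X5, X, Y} = UNIV \<and>
     map (br X1) [X2, X3, X4, X5] = [X4, X5, 0, 0] \<and>
     map (br X2) [X3, X4, X5] = [0, 0, 0] \<and>
     map (br X3) [X4, X5] = [0, 0] \<and>
     br X4 X5 = 0 \<and>
     br X Y = 0 \<and>
     map (br X) [X1, X2, X3, X4, X5] = DX \<and>
     map (br Y) [X1, X2, X3, X4, X5] = DY"

definition is_G2 where
  "is_G2 br X1 X2 X3 X4 X5 X Y \<longleftrightarrow>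
     seven_dim_algebra br X1 X2 X3 X4 X5 X Y
       [X1, 0, 0, X4, X5]
       [0, 0, X3, 0, X5]"

definition is_G3 where
  "is_G3 br X1 X2 X3 X4 X5 X Y \<longleftrightarrow>
     seven_dim_algebra br X1 X2 X3 X4 X5 X Y
       [0, X2, 0, X4, 0]
       [0, 0, X3, 0, X5]"

definition is_G4_00 where
  "is_G4_00 br X1 X2 X3 X4 X5 X Y \<longleftrightarrow>
     seven_dim_algebra br X1 X2 X3 X4 X5 X Y
       [X1, 0, 0, X4, X5]
       [0, X2, 0, X4, 0]"

definition is_G9 where
  "is_G9 br X1 X2 X3 X4 X5 X Y \<longleftrightarrow>
     seven_dim_algebra br X1 X2 X3 X4 X5 X Y
       [0, 0, X3, 0, X5]
       [0, X2, X5, X4, 0]"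

definition is_G10 where
  "is_G10 l br X1 X2 X3 X4 X5 X Y \<longleftrightarrow>
     seven_dim_algebra br X1 X2 X3 X4 X5 X Y
       [0, X2, l *\<^sub>R X3, X4, l *\<^sub>R X5]
       [0, 0, X3 + X5, 0, X5]"

end

theory Submission
  imports Defs
begin

text \<open>
  The orbits are found without closed formulas for the groups, by comparing the group with its bracket
  through differential equations.

  The differential of Ad at the identity is the bracket (Ad_derivative_at_one). In a chart this
  follows from the identity x y = (x y x^{-1}) x: differentiated in y it says that the left-invariant
  field of w at x is the right translate of Ad(x) w, and a further derivative in x turns it into
  d(Ad w)(v) = D L_w (v) - D L_v (w), because second derivatives are symmetric. As Ad is
  multiplicative, the functional P(t) = F o Ad(g(t)) along a curve g(t) satisfies the linear equation
  P' = P o ad(\<xi>(t)), where \<xi> is the logarithmic derivative of g. Three consequences carry the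
  whole proof.

   \<^item> A set of functionals which is preserved by all these equations contains the orbit of each of its
   points, because a connected group is generated by any neighbourhood of the identity
   (orbit_subset_flow_invariant).
   \<^item> If such a set S is embedded by a linear map \<pi> onto a connected set, and the velocities P o ad(v)
   are mapped by \<pi> onto the whole space for every P in S, then S is one orbit: by the open mapping
   theorem all orbits in S are open (orbit_eq_if_locally_transitive).
   \<^item> The velocities F o ad(v) are tangent to the orbit (ad_star_tangent), and the equations of
   the orbit, differentiated, bound its tangent space from above (orbit_dim_bounds).

  The five algebras are members of one family, in which ad X and ad Y scale X1 and act on the span of
  X2, X3, X4, X5 by triangular matrices. In the coordinates x_i = P(X_i) the quantities x4 and x5 then
  solve scalar linear equations, so they vanish identically or keep their signs; the quotient
  W = x2/x4 - x3/x5 does not feel X1, ..., X5 at all and changes under X and Y only by a scaling and a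
  shift, which a power of x4 and the logarithms of |x4| and |x5| compensate. This gives the
  function casimir, whose level sets are the generic orbits. On x5 = 0 the variable x3
  solves a scalar equation as well, so that its sign describes the orbit; the case x4 = 0 is the mirror
  image under the exchange of X2, X4 with X3, X5, and the same exchange carries the fourth
  algebra to the second. In all remaining cases two coordinates are constant on the orbit, whose
  dimension is therefore at most 5.
\<close>

section \<open>Calculus of continuously differentiable maps\<close>

lemma C_k_subset: "C_k k S f \<Longrightarrow> T \<subseteq> S \<Longrightarrow> C_k k T f"
proof (induction k arbitrary: f)
  case (Suc k)
  from Suc.prems(1) obtain f' where "\<forall>x\<in>S. (f has_derivative f' x) (at x)"
    "\<forall>b\<in>Basis. C_k k S (\<lambda>x. f' x b)" by auto
  with Suc.IH Suc.prems(2) show ?case by (auto intro!: exI[of _ f'])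
qed (auto intro: continuous_on_subset)

lemma C_k_cong:
  assumes "open S" "C_k k S f" "\<And>x. x \<in> S \<Longrightarrow> f x = g x"
  shows "C_k k S g"
proof (cases k)
  case 0
  with assms show ?thesis by (simp cong: continuous_on_cong)
next
  case (Suc j)
  with assms(2) obtain f' where "\<forall>x\<in>S. (f has_derivative f' x) (at x)"
    "\<forall>b\<in>Basis. C_k j S (\<lambda>x. f' x b)" by auto
  moreover have "(g has_derivative f' x) (at x)" if "x \<in> S" for x
    using has_derivative_transform_within_open[of f "f' x" x UNIV S g] calculation(1) assms that
    by auto
  ultimately show ?thesis using Suc by (auto intro!: exI[of _ f'])
qed

lemma C_k_SucD: "C_k (Suc k) S f \<Longrightarrow> C_k k S f"
proof (induction k arbitrary: f)
  case 0
  then obtain f' where "\<forall>x\<in>S. (f has_derivative f' x) (at x)" by auto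
  then have "continuous (at x) f" if "x \<in> S" for x
    using that has_derivative_continuous by blast
  then show ?case by (auto simp: continuous_at_imp_continuous_on)
next
  case (Suc k)
  from Suc.prems obtain f' where "\<forall>x\<in>S. (f has_derivative f' x) (at x)"
    "\<forall>b\<in>Basis. C_k (Suc k) S (\<lambda>x. f' x b)" using C_k.simps(2) by blast
  with Suc.IH show ?case by (auto intro!: exI[of _ f'])
qed

lemma C_k_const: "C_k k S (\<lambda>x. a)"
proof (induction k arbitrary: a)
  case (Suc k)
  show ?case by (auto intro!: exI[of _ "\<lambda>x h. 0"] Suc)
qed simp

lemma C_k_bounded_linear:
  assumes "bounded_linear L"
  shows "C_k k S f \<Longrightarrow> C_k k S (\<lambda>x. L (f x))"
proof (induction k arbitrary: f)
  case 0
  then show ?case using assms by (auto intro: bounded_linear.continuous_on)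
next
  case (Suc k)
  from Suc.prems obtain f' where "\<forall>x\<in>S. (f has_derivative f' x) (at x)"
    "\<forall>b\<in>Basis. C_k k S (\<lambda>x. f' x b)" by auto
  with Suc.IH show ?case
    by (auto intro!: exI[of _ "\<lambda>x h. L (f' x h)"] bounded_linear.has_derivative[OF assms])
qed

lemma C_k_linear_self: "bounded_linear L \<Longrightarrow> C_k k S L"
proof (cases k)
  case (Suc j)
  assume "bounded_linear L"
  then show ?thesis unfolding Suc
    by (auto intro!: exI[of _ "\<lambda>x. L"] C_k_const bounded_linear_imp_has_derivative)
qed (auto intro: bounded_linear.continuous_on continuous_on_id)

lemma C_k_add: "C_k k S f \<Longrightarrow> C_k k S g \<Longrightarrow> C_k k S (\<lambda>x. f x + g x)"
proof (induction k arbitrary: f g)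
  case (Suc k)
  from Suc.prems obtain f' g' where "\<forall>x\<in>S. (f has_derivative f' x) (at x)"
    "\<forall>b\<in>Basis. C_k k S (\<lambda>x. f' x b)" "\<forall>x\<in>S. (g has_derivative g' x) (at x)"
    "\<forall>b\<in>Basis. C_k k S (\<lambda>x. g' x b)" by auto
  with Suc.IH show ?case by (auto intro!: exI[of _ "\<lambda>x h. f' x h + g' x h"] derivative_intros)
qed (auto intro: continuous_on_add)

lemma C_k_sum: "(\<And>i. i \<in> I \<Longrightarrow> C_k k S (f i)) \<Longrightarrow> C_k k S (\<lambda>x. \<Sum>i\<in>I. f i x)"
  by (induction I rule: infinite_finite_induct) (auto intro: C_k_const C_k_add)

lemma C_k_scaleR:
  fixes f :: "_ \<Rightarrow> real"
  shows "C_k k S f \<Longrightarrow> C_k k S g \<Longrightarrow> C_k k S (\<lambda>x. f x *\<^sub>R g x)"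
proof (induction k arbitrary: f g)
  case (Suc k)
  from Suc.prems obtain f' g' where "\<forall>x\<in>S. (f has_derivative f' x) (at x)"
    "\<forall>b\<in>Basis. C_k k S (\<lambda>x. f' x b)" "\<forall>x\<in>S. (g has_derivative g' x) (at x)"
    "\<forall>b\<in>Basis. C_k k S (\<lambda>x. g' x b)" by auto
  with Suc.IH Suc.prems[THEN C_k_SucD] show ?case
    by (auto intro!: exI[of _ "\<lambda>x h. f x *\<^sub>R g' x h + f' x h *\<^sub>R g x"] derivative_intros C_k_add)
qed (auto intro: continuous_on_scaleR)

text \<open>
  The chain rule is written as a sum over the basis, so that only the partial derivatives of the outer
  map occur and the induction hypothesis applies to each of them.
\<close>

lemma C_k_compose:
  fixes g :: "'a::euclidean_space \<Rightarrow> 'b::euclidean_space"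
    and f :: "'b \<Rightarrow> 'c::real_normed_vector"
  assumes "g ` T \<subseteq> S"
  shows "C_k k S f \<Longrightarrow> C_k k T g \<Longrightarrow> C_k k T (\<lambda>x. f (g x))"
proof (induction k arbitrary: f)
  case 0
  then show ?case using assms by (auto intro: continuous_on_compose2)
next
  case (Suc k)
  from Suc.prems obtain f' g' where
    f': "\<forall>x\<in>S. (f has_derivative f' x) (at x)" "\<forall>b\<in>Basis. C_k k S (\<lambda>x. f' x b)"
    and g': "\<forall>x\<in>T. (g has_derivative g' x) (at x)" "\<forall>b\<in>Basis. C_k k T (\<lambda>x. g' x b)" by auto
  have chain: "((\<lambda>x. f (g x)) has_derivative
      (\<lambda>h. \<Sum>i\<in>Basis. (g' x h \<bullet> i) *\<^sub>R f' (g x) i)) (at x)" if "x \<in> T" for x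
  proof -
    have "(f has_derivative f' (g x)) (at (g x))" using f'(1) that assms by auto
    then have "((\<lambda>x. f (g x)) has_derivative (\<lambda>h. f' (g x) (g' x h))) (at x)"
      and lin: "linear (f' (g x))"
      using has_derivative_compose[of g "g' x" x UNIV f "f' (g x)"] g'(1) that
      by (auto intro: has_derivative_linear)
    moreover have "(\<lambda>h. f' (g x) (g' x h)) = (\<lambda>h. \<Sum>i\<in>Basis. (g' x h \<bullet> i) *\<^sub>R f' (g x) i)"
    proof
      fix h
      let ?u = "g' x h"
      have "f' (g x) (\<Sum>i\<in>Basis. (?u \<bullet> i) *\<^sub>R i) = (\<Sum>i\<in>Basis. (?u \<bullet> i) *\<^sub>R f' (g x) i)"
        using lin by (simp add: linear_sum linear_scale)
      then show "f' (g x) ?u = (\<Sum>i\<in>Basis. (?u \<bullet> i) *\<^sub>R f' (g x) i)" by (simp add: euclidean_representation)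
    qed
    ultimately show ?thesis by simp
  qed
  have "C_k k T (\<lambda>x. \<Sum>i\<in>Basis. (g' x b \<bullet> i) *\<^sub>R f' (g x) i)" if "b \<in> Basis" for b
    using Suc.IH[of "\<lambda>x. f' x _"] f'(2) g'(2) C_k_SucD[OF Suc.prems(2)] that
    by (intro C_k_sum C_k_scaleR C_k_bounded_linear[OF bounded_linear_inner_left]) auto
  with chain show ?case
    by (auto intro!: exI[of _ "\<lambda>x h. \<Sum>i\<in>Basis. (g' x h \<bullet> i) *\<^sub>R f' (g x) i"])
qed

text \<open>
  Sine and cosine are treated together since their combinations are closed under differentiation.
\<close>

lemma C_k_sin_cos: "C_k k S (\<lambda>t::real. a * sin (n * t) + b * cos (n * t))"
proof (induction k arbitrary: a b)
  case 0
  show ?case by (simp add: continuous_on_add continuous_on_mult continuous_on_sin continuous_on_cos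
        continuous_on_const continuous_on_id)
next
  case (Suc k)
  have "C_k k S (\<lambda>t. (- b * n) * sin (n * t) + (a * n) * cos (n * t))" by (rule Suc)
  moreover have "((\<lambda>t. a * sin (n * t) + b * cos (n * t)) has_derivative
      (\<lambda>h. h * ((- b * n) * sin (n * t) + (a * n) * cos (n * t)))) (at t)" for t
    by (rule derivative_eq_intros refl)+ (simp add: algebra_simps fun_eq_iff)
  ultimately show ?case
    by (auto intro!: exI[of _ "\<lambda>t h. h * ((- b * n) * sin (n * t) + (a * n) * cos (n * t))"])
qed

lemma smooth_on_has_derivative:
  assumes "smooth_on W f" "x \<in> W"
  shows "(f has_derivative frechet_derivative f (at x)) (at x)"
proof -
  have "C_k (Suc 0) W f" using assms(1) by (auto simp only: smooth_on_def)
  then show ?thesis using assms(2) frechet_derivative_at by (metis C_k.simps(2))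
qed

lemma smooth_on_frechet_derivative:
  assumes "open W" "smooth_on W f"
  shows "smooth_on W (\<lambda>x. frechet_derivative f (at x) w)"
  unfolding smooth_on_def
proof
  fix k
  have "C_k (Suc k) W f" using assms(2) by (auto simp only: smooth_on_def)
  then obtain f' where f': "\<forall>x\<in>W. (f has_derivative f' x) (at x)"
    "\<forall>b\<in>Basis. C_k k W (\<lambda>x. f' x b)" by auto
  have eq: "frechet_derivative f (at x) w = (\<Sum>i\<in>Basis. (w \<bullet> i) *\<^sub>R f' x i)" if "x \<in> W" for x
  proof -
    have d: "(f has_derivative f' x) (at x)" using f'(1) that by auto
    then have "frechet_derivative f (at x) = f' x" using frechet_derivative_at by metis
    moreover have "f' x (\<Sum>i\<in>Basis. (w \<bullet> i) *\<^sub>R i) = (\<Sum>i\<in>Basis. (w \<bullet> i) *\<^sub>R f' x i)"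
      using has_derivative_linear[OF d] by (simp add: linear_sum linear_scale)
    ultimately show ?thesis by (simp add: euclidean_representation)
  qed
  have C: "C_k k W (\<lambda>x. \<Sum>i\<in>Basis. (w \<bullet> i) *\<^sub>R f' x i)"
    using f'(2) by (intro C_k_sum C_k_scaleR C_k_const) auto
  show "C_k k W (\<lambda>x. frechet_derivative f (at x) w)"
    using C_k_cong[OF assms(1) C] eq by auto
qed

section \<open>Germs of smooth maps and symmetry of second derivatives\<close>

text \<open>
  The germ form of smoothness: it lets charts be composed without computing the open sets on
  which the compositions are defined.
\<close>

definition smooth_at :: "('a::euclidean_space \<Rightarrow> 'b::real_normed_vector) \<Rightarrow> 'a \<Rightarrow> bool" where
  "smooth_at f p \<longleftrightarrow> (\<exists>W. open W \<and> p \<in> W \<and> smooth_on W f)"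

lemma eventually_isCont:
  assumes "isCont f a" "\<forall>\<^sub>F y in nhds (f a). P y"
  shows "\<forall>\<^sub>F x in nhds a. P (f x)"
  using assms tendsto_at_iff_tendsto_nhds[of f a] by (simp add: isCont_def filterlim_iff)

lemma smooth_at_eventually: "smooth_at f p \<Longrightarrow> \<forall>\<^sub>F x in nhds p. smooth_at f x"
  unfolding smooth_at_def eventually_nhds by blast

lemma smooth_at_cong:
  assumes "smooth_at f p" "\<forall>\<^sub>F x in nhds p. f x = g x"
  shows "smooth_at g p"
proof -
  obtain V where V: "open V" "p \<in> V" "smooth_on V f"
    using assms(1) by (auto simp: smooth_at_def)
  obtain W where W: "open W" "p \<in> W" "\<And>x. x \<in> W \<Longrightarrow> f x = g x"
    using assms(2) by (auto simp: eventually_nhds)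
  have "smooth_on (V \<inter> W) g"
    unfolding smooth_on_def
  proof
    fix k
    have "C_k k (V \<inter> W) f" using V(3) C_k_subset[of k V f "V \<inter> W"] by (auto simp: smooth_on_def)
    then show "C_k k (V \<inter> W) g" using V W by (auto intro: C_k_cong[of "V \<inter> W" k f])
  qed
  with V W show ?thesis unfolding smooth_at_def by (intro exI[of _ "V \<inter> W"]) auto
qed

lemma smooth_at_linear: "bounded_linear L \<Longrightarrow> smooth_at L p"
  unfolding smooth_at_def smooth_on_def by (auto intro: C_k_linear_self exI[of _ UNIV])

lemma smooth_at_const: "smooth_at (\<lambda>x. a) p"
  unfolding smooth_at_def smooth_on_def by (auto intro: C_k_const exI[of _ UNIV])

lemma smooth_at_ident: "smooth_at (\<lambda>x. x) p"
  by (rule smooth_at_linear) (rule bounded_linear_ident)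

lemma smooth_at_continuous:
  assumes "smooth_at f p"
  shows "isCont f p"
proof -
  obtain W where W: "open W" "p \<in> W" "smooth_on W f"
    using assms by (auto simp: smooth_at_def)
  then have "C_k 0 W f" by (auto simp only: smooth_on_def)
  with W show ?thesis by (simp add: continuous_on_eq_continuous_at)
qed

lemma smooth_at_compose:
  fixes g :: "'a::euclidean_space \<Rightarrow> 'b::euclidean_space"
  assumes "smooth_at f (g p)" "smooth_at g p"
  shows "smooth_at (\<lambda>x. f (g x)) p"
proof -
  obtain W where W: "open W" "g p \<in> W" "smooth_on W f"
    using assms(1) by (auto simp: smooth_at_def)
  obtain V where V: "open V" "p \<in> V" "smooth_on V g"
    using assms(2) by (auto simp: smooth_at_def)
  have "C_k 0 V g" using V(3) by (auto simp only: smooth_on_def)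
  then have "open (g -` W \<inter> V)"
    using V W by (auto simp: continuous_on_open_vimage)
  moreover have "smooth_on (g -` W \<inter> V) (\<lambda>x. f (g x))"
    unfolding smooth_on_def
  proof
    fix k
    have "C_k k (g -` W \<inter> V) g"
      using V(3) C_k_subset[of k V g "g -` W \<inter> V"] by (auto simp: smooth_on_def)
    then show "C_k k (g -` W \<inter> V) (\<lambda>x. f (g x))"
      using W(3) C_k_compose[of g "g -` W \<inter> V" W k f] by (auto simp: smooth_on_def)
  qed
  ultimately show ?thesis
    unfolding smooth_at_def using V W by (intro exI[of _ "g -` W \<inter> V"]) auto
qed

lemma smooth_at_add:
  assumes "smooth_at f p" "smooth_at g p"
  shows "smooth_at (\<lambda>x. f x + g x) p"
proof -
  obtain V where V: "open V" "p \<in> V" "smooth_on V f"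
    using assms(1) by (auto simp: smooth_at_def)
  obtain W where W: "open W" "p \<in> W" "smooth_on W g"
    using assms(2) by (auto simp: smooth_at_def)
  have "C_k k (V \<inter> W) (\<lambda>x. f x + g x)" for k
    using V(3) W(3) C_k_subset[of k V f "V \<inter> W"] C_k_subset[of k W g "V \<inter> W"]
    by (auto simp: smooth_on_def intro!: C_k_add)
  with V W show ?thesis
    unfolding smooth_at_def smooth_on_def by (intro exI[of _ "V \<inter> W"]) auto
qed

lemma smooth_at_Pair:
  fixes f :: "'a::euclidean_space \<Rightarrow> 'b::euclidean_space"
    and g :: "'a \<Rightarrow> 'c::euclidean_space"
  assumes "smooth_at f p" "smooth_at g p"
  shows "smooth_at (\<lambda>x. (f x, g x)) p"
proof -
  have "smooth_at (\<lambda>x. (f x, 0::'c)) p" "smooth_at (\<lambda>x. (0::'b, g x)) p"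
    by (rule smooth_at_compose[where f = "\<lambda>u. (u, 0)", OF smooth_at_linear assms(1)]
        smooth_at_compose[where f = "\<lambda>u. (0, u)", OF smooth_at_linear assms(2)];
      intro bounded_linear_Pair bounded_linear_ident bounded_linear_zero)+
  from smooth_at_add[OF this] show ?thesis by simp
qed

lemma smooth_at_has_derivative:
  "smooth_at f p \<Longrightarrow> (f has_derivative frechet_derivative f (at p)) (at p)"
  using smooth_on_has_derivative by (auto simp: smooth_at_def)

lemma smooth_at_frechet_derivative:
  "smooth_at f p \<Longrightarrow> smooth_at (\<lambda>x. frechet_derivative f (at x) w) p"
  using smooth_on_frechet_derivative by (auto simp: smooth_at_def)

lemma frechet_derivative_cong:
  assumes "smooth_at f p" "\<forall>\<^sub>F x in nhds p. f x = g x"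
  shows "frechet_derivative f (at p) = frechet_derivative g (at p)"
proof -
  obtain W where W: "open W" "p \<in> W" "\<And>x. x \<in> W \<Longrightarrow> f x = g x"
    using assms(2) by (auto simp: eventually_nhds)
  have "(g has_derivative frechet_derivative f (at p)) (at p)"
    using has_derivative_transform_within_open[OF smooth_at_has_derivative[OF assms(1)] W(1,2)] W(3)
    by auto
  then show ?thesis by (rule frechet_derivative_at)
qed

lemma frechet_derivative_compose_smooth:
  fixes g :: "'a::euclidean_space \<Rightarrow> 'b::euclidean_space"
  assumes "smooth_at f (g p)" "smooth_at g p"
  shows "frechet_derivative (\<lambda>x. f (g x)) (at p) w
    = frechet_derivative f (at (g p)) (frechet_derivative g (at p) w)"
  using has_derivative_compose[OF smooth_at_has_derivative[OF assms(2)] smooth_at_has_derivative[OF assms(1)]]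
  by (metis frechet_derivative_at)

lemma linear_frechet_derivative_smooth:
  "smooth_at f p \<Longrightarrow> linear (frechet_derivative f (at p))"
  using smooth_at_has_derivative has_derivative_linear by blast

text \<open>
  The mean value theorem, applied once in each direction, expresses the second difference over a small
  parallelogram by a second derivative. The left-hand side is symmetric in p and q, which is what
  forces the second derivatives to agree.
\<close>

lemma second_difference_mean_value:
  fixes f :: "'a::euclidean_space \<Rightarrow> real"
  assumes "0 < h" and W: "\<And>s t. s \<in> {0..h} \<Longrightarrow> t \<in> {0..h} \<Longrightarrow> smooth_at f (z + s *\<^sub>R p + t *\<^sub>R q)"
  shows "\<exists>s\<in>{0<..<h}. \<exists>t\<in>{0<..<h}.
    f (z + h *\<^sub>R p + h *\<^sub>R q) - f (z + h *\<^sub>R p) - f (z + h *\<^sub>R q) + f z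
    = h * h * frechet_derivative (\<lambda>x. frechet_derivative f (at x) p) (at (z + s *\<^sub>R p + t *\<^sub>R q)) q"
proof -
  let ?D = "\<lambda>x. frechet_derivative f (at x) p"
  have 1: "((\<lambda>s. f (z + s *\<^sub>R p + t *\<^sub>R q)) has_real_derivative ?D (z + s *\<^sub>R p + t *\<^sub>R q)) (at s)"
    if "s \<in> {0..h}" "t \<in> {0..h}" for s t
  proof -
    have "((\<lambda>s. z + s *\<^sub>R p + t *\<^sub>R q) has_derivative (\<lambda>k. k *\<^sub>R p)) (at s)"
      by (rule derivative_eq_intros refl)+ simp
    from has_derivative_compose[OF this smooth_at_has_derivative[OF W[OF that]]]
    show ?thesis
      using linear_frechet_derivative_smooth[OF W[OF that]]
      by (simp add: has_field_derivative_def linear_scale mult.commute[of _ "?D _"])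
  qed
  have 2: "((\<lambda>t. ?D (z + s *\<^sub>R p + t *\<^sub>R q)) has_real_derivative
      frechet_derivative ?D (at (z + s *\<^sub>R p + t *\<^sub>R q)) q) (at t)"
    if "s \<in> {0..h}" "t \<in> {0..h}" for s t
  proof -
    have D: "smooth_at ?D (z + s *\<^sub>R p + t *\<^sub>R q)"
      by (rule smooth_at_frechet_derivative[OF W[OF that]])
    have "((\<lambda>t. z + s *\<^sub>R p + t *\<^sub>R q) has_derivative (\<lambda>k. k *\<^sub>R q)) (at t)"
      by (rule derivative_eq_intros refl)+ simp
    from has_derivative_compose[OF this smooth_at_has_derivative[OF D]]
    show ?thesis
      using linear_frechet_derivative_smooth[OF D]
      by (simp add: has_field_derivative_def linear_scale mult.commute[of _ "frechet_derivative ?D (at _) q"])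
  qed
  have "((\<lambda>s. f (z + s *\<^sub>R p + h *\<^sub>R q) - f (z + s *\<^sub>R p + 0 *\<^sub>R q)) has_real_derivative
      ?D (z + s *\<^sub>R p + h *\<^sub>R q) - ?D (z + s *\<^sub>R p + 0 *\<^sub>R q)) (at s)" if "0 \<le> s" "s \<le> h" for s
    using 1[of s h] 1[of s 0] that \<open>0 < h\<close> by (intro DERIV_diff) auto
  from MVT2[OF \<open>0 < h\<close> this] obtain s where s: "0 < s" "s < h"
    "f (z + h *\<^sub>R p + h *\<^sub>R q) - f (z + h *\<^sub>R p) - (f (z + h *\<^sub>R q) - f z)
     = h * (?D (z + s *\<^sub>R p + h *\<^sub>R q) - ?D (z + s *\<^sub>R p + 0 *\<^sub>R q))"
    by auto
  from MVT2[OF \<open>0 < h\<close> 2[of s]] s obtain t where "0 < t" "t < h"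
    "?D (z + s *\<^sub>R p + h *\<^sub>R q) - ?D (z + s *\<^sub>R p + 0 *\<^sub>R q)
     = h * frechet_derivative ?D (at (z + s *\<^sub>R p + t *\<^sub>R q)) q"
    by auto
  with s have "f (z + h *\<^sub>R p + h *\<^sub>R q) - f (z + h *\<^sub>R p) - f (z + h *\<^sub>R q) + f z
      = h * h * frechet_derivative ?D (at (z + s *\<^sub>R p + t *\<^sub>R q)) q"
    by (simp add: mult.assoc)
  then show ?thesis
    using s \<open>0 < t\<close> \<open>t < h\<close> by (intro bexI[of _ s] bexI[of _ t]) auto
qed

lemma second_derivative_symmetric_real:
  fixes f :: "'a::euclidean_space \<Rightarrow> real"
  assumes f: "smooth_at f z"
  shows "frechet_derivative (\<lambda>x. frechet_derivative f (at x) p) (at z) q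
    = frechet_derivative (\<lambda>x. frechet_derivative f (at x) q) (at z) p"
proof (rule ccontr)
  define A where "A p q x = frechet_derivative (\<lambda>x. frechet_derivative f (at x) p) (at x) q" for p q x
  assume "\<not> ?thesis"
  then have "\<bar>A p q z - A q p z\<bar> > 0" by (simp add: A_def)
  then obtain e where e: "e > 0" "\<bar>A p q z - A q p z\<bar> > 2 * e"
    by (metis dense linorder_not_less mult_2 field_sum_of_halves less_eq_real_def half_gt_zero mult.commute)
  have A: "isCont (A p q) z" for p q
    unfolding A_def using f by (intro smooth_at_continuous smooth_at_frechet_derivative)
  have near: "\<forall>\<^sub>F x in nhds z. \<bar>A p q x - A p q z\<bar> < e" for p q
    using eventually_isCont[OF A, where P = "\<lambda>y. dist y (A p q z) < e"] \<open>e > 0\<close>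
    by (simp add: dist_real_def eventually_nhds_metric) blast
  have "\<forall>\<^sub>F x in nhds z. smooth_at f x \<and> \<bar>A p q x - A p q z\<bar> < e \<and> \<bar>A q p x - A q p z\<bar> < e"
    by (intro eventually_conj smooth_at_eventually[OF f] near)
  then obtain d where d: "d > 0" "\<And>x. dist x z < d \<Longrightarrow>
      smooth_at f x \<and> \<bar>A p q x - A p q z\<bar> < e \<and> \<bar>A q p x - A q p z\<bar> < e"
    by (auto simp: eventually_nhds_metric)
  \<comment> \<open>small enough for the whole parallelogram to lie in the ball of radius d\<close>
  define h where "h = d / (2 * (norm p + norm q + 1))"
  have n: "norm p + norm q + 1 > 0" by (smt (verit) norm_ge_zero)
  then have h: "h > 0" using d by (simp add: h_def)
  have small: "dist (z + s *\<^sub>R p + t *\<^sub>R q) z < d" if "s \<in> {0..h}" "t \<in> {0..h}" for s t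
  proof -
    have "dist (z + s *\<^sub>R p + t *\<^sub>R q) z \<le> \<bar>s\<bar> * norm p + \<bar>t\<bar> * norm q"
      using norm_triangle_ineq[of "s *\<^sub>R p" "t *\<^sub>R q"] by (simp add: dist_norm add.assoc)
    also have "\<dots> \<le> h * norm p + h * norm q" using that by (intro add_mono mult_right_mono) auto
    also have "\<dots> < h * (norm p + norm q + 1)" using h by (simp add: algebra_simps)
    also have "\<dots> = d / 2" using n by (simp add: h_def field_simps)
    finally show ?thesis using d by simp
  qed
  from second_difference_mean_value[of h f z p q] small d h obtain s t where
    st: "s \<in> {0<..<h}" "t \<in> {0<..<h}"
    "f (z + h *\<^sub>R p + h *\<^sub>R q) - f (z + h *\<^sub>R p) - f (z + h *\<^sub>R q) + f z
    = h * h * A p q (z + s *\<^sub>R p + t *\<^sub>R q)" unfolding A_def by blast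
  have swap: "z + s *\<^sub>R q + t *\<^sub>R p = z + t *\<^sub>R p + s *\<^sub>R q" for s t by simp
  from second_difference_mean_value[of h f z q p, unfolded swap] small d h obtain s' t' where
    st': "s' \<in> {0<..<h}" "t' \<in> {0<..<h}"
    "f (z + h *\<^sub>R p + h *\<^sub>R q) - f (z + h *\<^sub>R q) - f (z + h *\<^sub>R p) + f z
    = h * h * A q p (z + t' *\<^sub>R p + s' *\<^sub>R q)" unfolding A_def by blast
  have "h * h * A p q (z + s *\<^sub>R p + t *\<^sub>R q) = h * h * A q p (z + t' *\<^sub>R p + s' *\<^sub>R q)"
    using st(3) st'(3) by linarith
  then have "A p q (z + s *\<^sub>R p + t *\<^sub>R q) = A q p (z + t' *\<^sub>R p + s' *\<^sub>R q)" using h by simp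
  moreover have "\<bar>A p q (z + s *\<^sub>R p + t *\<^sub>R q) - A p q z\<bar> < e"
    using d(2) small st(1,2) by simp
  moreover have "\<bar>A q p (z + t' *\<^sub>R p + s' *\<^sub>R q) - A q p z\<bar> < e"
    using d(2) small st'(1,2) by simp
  ultimately show False using e by linarith
qed

text \<open>
  Each component is a real function, for which the symmetry is already known.
\<close>

lemma second_derivative_symmetric:
  fixes f :: "'a::euclidean_space \<Rightarrow> 'b::euclidean_space"
  assumes f: "smooth_at f z"
  shows "frechet_derivative (\<lambda>x. frechet_derivative f (at x) p) (at z) q
    = frechet_derivative (\<lambda>x. frechet_derivative f (at x) q) (at z) p"
proof (rule euclidean_eqI)
  fix k :: 'b assume "k \<in> Basis"
  have inner: "frechet_derivative (\<lambda>x. g x \<bullet> k) (at x) u = frechet_derivative g (at x) u \<bullet> k"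
    if "smooth_at g x" for g :: "'a \<Rightarrow> 'b" and x u
    using bounded_linear.has_derivative[OF bounded_linear_inner_left smooth_at_has_derivative[OF that]]
    by (metis frechet_derivative_at)
  have "frechet_derivative (\<lambda>x. frechet_derivative f (at x) u) (at z) v \<bullet> k
    = frechet_derivative (\<lambda>x. frechet_derivative (\<lambda>x. f x \<bullet> k) (at x) u) (at z) v" for u v
  proof -
    let ?D = "\<lambda>x. frechet_derivative f (at x) u"
    have D: "smooth_at ?D z" using f by (rule smooth_at_frechet_derivative)
    have Dk: "smooth_at (\<lambda>x. ?D x \<bullet> k) z"
      by (rule smooth_at_compose[where f = "\<lambda>y. y \<bullet> k", OF smooth_at_linear D])
        (rule bounded_linear_inner_left)
    have "\<forall>\<^sub>F x in nhds z. ?D x \<bullet> k = frechet_derivative (\<lambda>x. f x \<bullet> k) (at x) u"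
      using smooth_at_eventually[OF f] by eventually_elim (simp add: inner)
    from frechet_derivative_cong[OF Dk this] inner[OF D] show ?thesis by simp
  qed
  moreover have "smooth_at (\<lambda>x. f x \<bullet> k) z"
    by (rule smooth_at_compose[where f = "\<lambda>y. y \<bullet> k", OF smooth_at_linear f])
      (rule bounded_linear_inner_left)
  ultimately show "frechet_derivative (\<lambda>x. frechet_derivative f (at x) p) (at z) q \<bullet> k
    = frechet_derivative (\<lambda>x. frechet_derivative f (at x) q) (at z) p \<bullet> k"
    using second_derivative_symmetric_real[of "\<lambda>x. f x \<bullet> k"] by simp
qed

lemma partial_derivative_snd:
  fixes f :: "'a::euclidean_space \<times> 'b::euclidean_space \<Rightarrow> 'c::euclidean_space"
  assumes "smooth_at f (a, b)"
  shows "frechet_derivative (\<lambda>y. f (a, y)) (at b) w = frechet_derivative f (at (a, b)) (0, w)"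
proof -
  have "((\<lambda>y. (a, y)) has_derivative (\<lambda>w. (0, w))) (at b)"
    by (rule derivative_eq_intros refl)+
  from has_derivative_compose[OF this smooth_at_has_derivative[OF assms]]
  show ?thesis by (metis frechet_derivative_at)
qed

lemma partial_derivative_fst:
  fixes f :: "'a::euclidean_space \<times> 'b::euclidean_space \<Rightarrow> 'c::euclidean_space"
  assumes "smooth_at f (a, b)"
  shows "frechet_derivative (\<lambda>x. f (x, b)) (at a) w = frechet_derivative f (at (a, b)) (w, 0)"
proof -
  have "((\<lambda>x. (x, b)) has_derivative (\<lambda>w. (w, 0))) (at a)"
    by (rule derivative_eq_intros refl)+
  from has_derivative_compose[OF this smooth_at_has_derivative[OF assms]]
  show ?thesis by (metis frechet_derivative_at)
qed

lemma smooth_at_slices: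
  fixes a :: "'a::euclidean_space" and b :: "'b::euclidean_space"
  shows "smooth_at (\<lambda>y. (a, y)) b" "smooth_at (\<lambda>x. (x, b)) a"
  by (intro smooth_at_Pair smooth_at_const smooth_at_ident)+

lemma eventually_slices:
  fixes a :: "'a::euclidean_space" and b :: "'b::euclidean_space"
  assumes "\<forall>\<^sub>F z in nhds (a, b). P z"
  shows "\<forall>\<^sub>F x in nhds a. P (x, b)" "\<forall>\<^sub>F y in nhds b. P (a, y)"
proof -
  show "\<forall>\<^sub>F x in nhds a. P (x, b)" "\<forall>\<^sub>F y in nhds b. P (a, y)"
    using eventually_isCont[where f = "\<lambda>x. (x, b)" and a = a and P = P] eventually_isCont[where f = "\<lambda>y. (a, y)" and a = b and P = P] assms
    by (auto intro: continuous_intros)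
qed

lemma eventually_nhds_Pair:
  fixes a :: "'a::euclidean_space" and b :: "'b::euclidean_space"
  assumes "\<forall>\<^sub>F z in nhds (a, b). P z"
  shows "\<forall>\<^sub>F x in nhds a. \<forall>\<^sub>F y in nhds b. P (x, y)"
proof -
  have "\<forall>\<^sub>F z in nhds (a, b). \<forall>\<^sub>F z' in nhds z. P z'"
    using assms by (simp add: eventually_eventually)
  from eventually_slices(1)[OF this] show ?thesis
    by eventually_elim (rule eventually_slices(2))
qed

section \<open>Group operations of a Lie group in charts\<close>

text \<open>
  The openness of the domain of the representative is the point here: it turns smoothness on the image
  of U \<inter> f -` V into smoothness near a point.
\<close>

lemma chart_representative_smooth:
  fixes \<phi> :: "'m::topological_space \<Rightarrow> 'e::euclidean_space"
    and \<psi> :: "'n::topological_space \<Rightarrow> 'f::euclidean_space"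
  assumes U: "openin (top_of_set M) U" "open (\<phi> ` U)" "inj_on \<phi> U"
    "continuous_on (\<phi> ` U) (inv_into U \<phi>)"
    and V: "openin (top_of_set N) V"
    and f: "continuous_on M f" "f ` M \<subseteq> N"
    and sm: "smooth_on (\<phi> ` (U \<inter> f -` V)) (\<psi> \<circ> f \<circ> inv_into U \<phi>)"
    and p: "p \<in> U" "f p \<in> V"
  shows "smooth_at (\<lambda>x. \<psi> (f (inv_into U \<phi> x))) (\<phi> p)"
    and "\<forall>\<^sub>F x in nhds (\<phi> p). x \<in> \<phi> ` U \<and> f (inv_into U \<phi> x) \<in> V"
proof -
  have UM: "U \<subseteq> M" using U(1) openin_imp_subset by blast
  have "continuous_on (\<phi> ` U) (\<lambda>x. f (inv_into U \<phi> x))"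
    by (rule continuous_on_compose2[OF f(1) U(4)]) (use UM in \<open>auto simp: inv_into_into\<close>)
  moreover have "(\<lambda>x. f (inv_into U \<phi> x)) \<in> \<phi> ` U \<rightarrow> N"
  proof
    fix x assume "x \<in> \<phi> ` U"
    then have "inv_into U \<phi> x \<in> M" using UM inv_into_into[of x \<phi> U] by blast
    then show "f (inv_into U \<phi> x) \<in> N" using f(2) by blast
  qed
  ultimately have "openin (top_of_set (\<phi> ` U)) (\<phi> ` U \<inter> (\<lambda>x. f (inv_into U \<phi> x)) -` V)"
    using V by (rule continuous_openin_preimage)
  moreover have eq: "\<phi> ` U \<inter> (\<lambda>x. f (inv_into U \<phi> x)) -` V = \<phi> ` (U \<inter> f -` V)"
    using U(3) by (auto simp: inv_into_f_f)
  ultimately have op: "open (\<phi> ` (U \<inter> f -` V))"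
    using U(2) openin_open_trans[of "\<phi> ` U"] by (simp add: openin_open_eq)
  have mem: "\<phi> p \<in> \<phi> ` (U \<inter> f -` V)" using p by auto
  show "smooth_at (\<lambda>x. \<psi> (f (inv_into U \<phi> x))) (\<phi> p)"
    unfolding smooth_at_def using op mem sm by (auto simp: comp_def)
  show "\<forall>\<^sub>F x in nhds (\<phi> p). x \<in> \<phi> ` U \<and> f (inv_into U \<phi> x) \<in> V"
    unfolding eventually_nhds using op mem eq by blast
qed

text \<open>
  The chart at the identity in which the Lie algebra is read.
\<close>

locale lie_group_chart =
  fixes G :: "('g::{t2_space,second_countable_topology}, 'e::euclidean_space) lie_group"  (structure)
    and U :: "'g set" and \<phi> :: "'g \<Rightarrow> 'e"
  assumes lie: "is_lie_group G"
    and chart: "(U, \<phi>) \<in> atlas G"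
    and one_U: "\<one> \<in> U"
begin

sublocale group G using lie by (simp add: is_lie_group_def)

lemma chartD:
  assumes "(V, \<xi>) \<in> atlas G"
  shows "openin (top_of_set (carrier G)) V" "open (\<xi> ` V)" "inj_on \<xi> V"
    "continuous_on V \<xi>" "continuous_on (\<xi> ` V) (inv_into V \<xi>)" "V \<subseteq> carrier G"
proof -
  have "openin (top_of_set (carrier G)) V \<and> open (\<xi> ` V) \<and> homeomorphism V (\<xi> ` V) \<xi> (inv_into V \<xi>)"
    using lie assms by (auto simp: is_lie_group_def smooth_atlas_def)
  then show "openin (top_of_set (carrier G)) V" "open (\<xi> ` V)" "inj_on \<xi> V"
    "continuous_on V \<xi>" "continuous_on (\<xi> ` V) (inv_into V \<xi>)" "V \<subseteq> carrier G"
    by (auto simp: homeomorphism_def intro: inj_on_inverseI dest: openin_imp_subset)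
qed

lemma chart_cover: "g \<in> carrier G \<Longrightarrow> \<exists>V \<xi>. (V, \<xi>) \<in> atlas G \<and> g \<in> V"
proof -
  assume g: "g \<in> carrier G"
  have "(\<Union>(V, \<xi>)\<in>atlas G. V) = carrier G"
    using lie unfolding is_lie_group_def smooth_atlas_def by meson
  with g obtain c where "c \<in> atlas G" "g \<in> (case c of (V, \<xi>) \<Rightarrow> V)" by blast
  then show ?thesis by (cases c) auto
qed

text \<open>
  The second claim accompanies the first because a composition of representatives equals the
  representative of the composition only where the intermediate values stay in the chart.
\<close>

lemma mult_smooth:
  assumes "(V1, \<xi>1) \<in> atlas G" "(V2, \<xi>2) \<in> atlas G" "(V3, \<xi>3) \<in> atlas G"
    and "g \<in> V1" "h \<in> V2" "g \<otimes> h \<in> V3"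
  shows "smooth_at (\<lambda>z. \<xi>3 (inv_into V1 \<xi>1 (fst z) \<otimes> inv_into V2 \<xi>2 (snd z))) (\<xi>1 g, \<xi>2 h)"
    and "\<forall>\<^sub>F z in nhds (\<xi>1 g, \<xi>2 h). fst z \<in> \<xi>1 ` V1 \<and> snd z \<in> \<xi>2 ` V2 \<and>
      inv_into V1 \<xi>1 (fst z) \<otimes> inv_into V2 \<xi>2 (snd z) \<in> V3"
proof -
  note c1 = chartD[OF assms(1)] and c2 = chartD[OF assms(2)] and c3 = chartD[OF assms(3)]
  let ?\<phi> = "map_prod \<xi>1 \<xi>2" and ?U = "V1 \<times> V2" and ?f = "\<lambda>(g, h). g \<otimes> h"
  have im: "?\<phi> ` ?U = \<xi>1 ` V1 \<times> \<xi>2 ` V2" by (auto simp: image_iff)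
  have inj: "inj_on ?\<phi> ?U" using c1(3) c2(3) by (rule map_prod_inj_on)
  have inv: "inv_into ?U ?\<phi> z = (inv_into V1 \<xi>1 (fst z), inv_into V2 \<xi>2 (snd z))"
    if "z \<in> ?\<phi> ` ?U" for z
  proof -
    obtain g h where gh: "g \<in> V1" "h \<in> V2" "z = ?\<phi> (g, h)" using \<open>z \<in> ?\<phi> ` ?U\<close> by auto
    then have "inv_into ?U ?\<phi> z = (g, h)" using inv_into_f_f[OF inj, of "(g, h)"] by simp
    with gh show ?thesis using c1(3) c2(3) by simp
  qed
  have "continuous_on (?\<phi> ` ?U) (\<lambda>z. (inv_into V1 \<xi>1 (fst z), inv_into V2 \<xi>2 (snd z)))"
    unfolding im
    by (intro continuous_on_Pair continuous_on_compose2[OF c1(5)] continuous_on_compose2[OF c2(5)]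
        continuous_on_fst continuous_on_snd continuous_on_id) auto
  then have cont: "continuous_on (?\<phi> ` ?U) (inv_into ?U ?\<phi>)"
    by (rule continuous_on_eq) (simp add: inv)
  have op: "openin (top_of_set (carrier G \<times> carrier G)) ?U" using c1(1) c2(1) by (rule openin_Times)
  have sm: "smooth_map (carrier G \<times> carrier G) (prod_atlas (atlas G) (atlas G)) (carrier G) (atlas G) ?f"
    using lie by (simp add: is_lie_group_def)
  have "(?U, ?\<phi>) \<in> prod_atlas (atlas G) (atlas G)"
    using assms(1,2) by (auto simp: prod_atlas_def)
  then have so: "smooth_on (?\<phi> ` (?U \<inter> ?f -` V3)) (\<xi>3 \<circ> ?f \<circ> inv_into ?U ?\<phi>)"
    using sm assms(3) by (force simp: smooth_map_def)
  have fc: "continuous_on (carrier G \<times> carrier G) ?f" "?f ` (carrier G \<times> carrier G) \<subseteq> carrier G"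
    using sm unfolding smooth_map_def by blast+
  have "open (?\<phi> ` ?U)" unfolding im using c1(2) c2(2) by (rule open_Times)
  note main = chart_representative_smooth[OF op this inj cont c3(1) fc so, of "(g, h)"]
  have ev: "\<forall>\<^sub>F z in nhds (?\<phi> (g, h)). z \<in> ?\<phi> ` ?U \<and> ?f (inv_into ?U ?\<phi> z) \<in> V3"
    using main(2) assms(4-6) by auto
  then show "\<forall>\<^sub>F z in nhds (\<xi>1 g, \<xi>2 h). fst z \<in> \<xi>1 ` V1 \<and> snd z \<in> \<xi>2 ` V2 \<and>
      inv_into V1 \<xi>1 (fst z) \<otimes> inv_into V2 \<xi>2 (snd z) \<in> V3"
    by (simp only: map_prod_simp) (erule eventually_mono, auto simp: inv im)
  have "smooth_at (\<lambda>z. \<xi>3 (?f (inv_into ?U ?\<phi> z))) (\<xi>1 g, \<xi>2 h)"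
    using main(1) assms(4-6) by auto
  moreover have "\<forall>\<^sub>F z in nhds (\<xi>1 g, \<xi>2 h). \<xi>3 (?f (inv_into ?U ?\<phi> z))
      = \<xi>3 (inv_into V1 \<xi>1 (fst z) \<otimes> inv_into V2 \<xi>2 (snd z))"
    using ev by (simp only: map_prod_simp) (erule eventually_mono, simp add: inv)
  ultimately show "smooth_at (\<lambda>z. \<xi>3 (inv_into V1 \<xi>1 (fst z) \<otimes> inv_into V2 \<xi>2 (snd z))) (\<xi>1 g, \<xi>2 h)"
    by (rule smooth_at_cong)
qed

lemma inv_smooth:
  assumes "(V1, \<xi>1) \<in> atlas G" "(V2, \<xi>2) \<in> atlas G" "g \<in> V1" "inv g \<in> V2"
  shows "smooth_at (\<lambda>x. \<xi>2 (inv (inv_into V1 \<xi>1 x))) (\<xi>1 g)"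
    and "\<forall>\<^sub>F x in nhds (\<xi>1 g). x \<in> \<xi>1 ` V1 \<and> inv (inv_into V1 \<xi>1 x) \<in> V2"
proof -
  note c1 = chartD[OF assms(1)] and c2 = chartD[OF assms(2)]
  have sm: "smooth_map (carrier G) (atlas G) (carrier G) (atlas G) (\<lambda>g. inv g)"
    using lie by (simp add: is_lie_group_def)
  then have so: "smooth_on (\<xi>1 ` (V1 \<inter> (\<lambda>g. inv g) -` V2)) (\<xi>2 \<circ> (\<lambda>g. inv g) \<circ> inv_into V1 \<xi>1)"
    using assms(1,2) by (force simp: smooth_map_def)
  have fc: "continuous_on (carrier G) (\<lambda>g. inv g)" "(\<lambda>g. inv g) ` carrier G \<subseteq> carrier G"
    using sm unfolding smooth_map_def by blast+
  note main = chart_representative_smooth[OF c1(1-3,5) c2(1) fc so assms(3,4)]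
  from main show "smooth_at (\<lambda>x. \<xi>2 (inv (inv_into V1 \<xi>1 x))) (\<xi>1 g)"
    and "\<forall>\<^sub>F x in nhds (\<xi>1 g). x \<in> \<xi>1 ` V1 \<and> inv (inv_into V1 \<xi>1 x) \<in> V2" by auto
qed

lemma left_translation_smooth:
  assumes "g \<in> carrier G" "(V1, \<xi>1) \<in> atlas G" "(V2, \<xi>2) \<in> atlas G" "h \<in> V1" "g \<otimes> h \<in> V2"
  shows "smooth_at (\<lambda>y. \<xi>2 (g \<otimes> inv_into V1 \<xi>1 y)) (\<xi>1 h)"
    and "\<forall>\<^sub>F y in nhds (\<xi>1 h). y \<in> \<xi>1 ` V1 \<and> g \<otimes> inv_into V1 \<xi>1 y \<in> V2"
proof -
  obtain V \<xi> where V: "(V, \<xi>) \<in> atlas G" "g \<in> V" using chart_cover assms(1) by blast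
  have [simp]: "inv_into V \<xi> (\<xi> g) = g" using chartD(3)[OF V(1)] V(2) by simp
  note m = mult_smooth[OF V(1) assms(2,3) V(2) assms(4,5)]
  show "smooth_at (\<lambda>y. \<xi>2 (g \<otimes> inv_into V1 \<xi>1 y)) (\<xi>1 h)"
    using smooth_at_compose[where g = "\<lambda>y. (\<xi> g, y)", OF m(1) smooth_at_slices(1)] by simp
  show "\<forall>\<^sub>F y in nhds (\<xi>1 h). y \<in> \<xi>1 ` V1 \<and> g \<otimes> inv_into V1 \<xi>1 y \<in> V2"
    using eventually_slices(2)[OF m(2)] by eventually_elim simp
qed

lemma right_translation_smooth:
  assumes "g \<in> carrier G" "(V1, \<xi>1) \<in> atlas G" "(V2, \<xi>2) \<in> atlas G" "h \<in> V1" "h \<otimes> g \<in> V2"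
  shows "smooth_at (\<lambda>y. \<xi>2 (inv_into V1 \<xi>1 y \<otimes> g)) (\<xi>1 h)"
    and "\<forall>\<^sub>F y in nhds (\<xi>1 h). y \<in> \<xi>1 ` V1 \<and> inv_into V1 \<xi>1 y \<otimes> g \<in> V2"
proof -
  obtain V \<xi> where V: "(V, \<xi>) \<in> atlas G" "g \<in> V" using chart_cover assms(1) by blast
  have [simp]: "inv_into V \<xi> (\<xi> g) = g" using chartD(3)[OF V(1)] V(2) by simp
  note m = mult_smooth[OF assms(2) V(1) assms(3) assms(4) V(2) assms(5)]
  show "smooth_at (\<lambda>y. \<xi>2 (inv_into V1 \<xi>1 y \<otimes> g)) (\<xi>1 h)"
    using smooth_at_compose[where g = "\<lambda>y. (y, \<xi> g)", OF m(1) smooth_at_slices(2)] by simp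
  show "\<forall>\<^sub>F y in nhds (\<xi>1 h). y \<in> \<xi>1 ` V1 \<and> inv_into V1 \<xi>1 y \<otimes> g \<in> V2"
    using eventually_slices(1)[OF m(2)] by eventually_elim simp
qed

abbreviation \<psi> where "\<psi> \<equiv> inv_into U \<phi>"
abbreviation e\<^sub>0 where "e\<^sub>0 \<equiv> \<phi> \<one>"

lemma U_carrier: "g \<in> U \<Longrightarrow> g \<in> carrier G" using chartD(6)[OF chart] by blast
lemma \<psi>\<phi> [simp]: "g \<in> U \<Longrightarrow> \<psi> (\<phi> g) = g" using chartD(3)[OF chart] by simp
lemma \<phi>\<psi> [simp]: "x \<in> \<phi> ` U \<Longrightarrow> \<phi> (\<psi> x) = x" by (rule f_inv_into_f)
lemma \<psi>_U: "x \<in> \<phi> ` U \<Longrightarrow> \<psi> x \<in> U" by (rule inv_into_into)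
lemma \<psi>_carrier: "x \<in> \<phi> ` U \<Longrightarrow> \<psi> x \<in> carrier G" using \<psi>_U U_carrier by blast
lemma \<psi>_one [simp]: "\<psi> e\<^sub>0 = \<one>" using one_U by simp
lemma e0_in: "e\<^sub>0 \<in> \<phi> ` U" using one_U by blast

lemma eventually_in_chart: "x \<in> \<phi> ` U \<Longrightarrow> \<forall>\<^sub>F y in nhds x. y \<in> \<phi> ` U"
  using chartD(2)[OF chart] by (simp add: eventually_nhds) blast

definition mult_coord :: "'e \<times> 'e \<Rightarrow> 'e" where "mult_coord z = \<phi> (\<psi> (fst z) \<otimes> \<psi> (snd z))"
definition conj_coord :: "'e \<times> 'e \<Rightarrow> 'e" where
  "conj_coord z = \<phi> (\<psi> (fst z) \<otimes> \<psi> (snd z) \<otimes> inv (\<psi> (fst z)))"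
text \<open>
  Left division measures the displacement from x to y as an element near the identity.
\<close>

definition ldiv_coord :: "'e \<times> 'e \<Rightarrow> 'e" where "ldiv_coord z = \<phi> (inv (\<psi> (fst z)) \<otimes> \<psi> (snd z))"

lemma mult_coord_smooth:
  "smooth_at mult_coord (e\<^sub>0, e\<^sub>0)"
  "\<forall>\<^sub>F z in nhds (e\<^sub>0, e\<^sub>0). fst z \<in> \<phi> ` U \<and> snd z \<in> \<phi> ` U \<and> \<psi> (fst z) \<otimes> \<psi> (snd z) \<in> U"
  using mult_smooth[OF chart chart chart one_U one_U] one_U by (simp_all add: mult_coord_def[abs_def])

lemma fst_snd_smooth: "smooth_at fst z" "smooth_at snd z"
  by (intro smooth_at_linear bounded_linear_fst bounded_linear_snd)+

lemma mult_coord_one [simp]: "mult_coord (e\<^sub>0, e\<^sub>0) = e\<^sub>0" by (simp add: mult_coord_def)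

lemma inv_coordinates:
  "smooth_at (\<lambda>z. \<phi> (inv (\<psi> (fst z)))) (e\<^sub>0, e\<^sub>0)"
  "\<forall>\<^sub>F z in nhds (e\<^sub>0, e\<^sub>0). fst z \<in> \<phi> ` U \<and> inv (\<psi> (fst z)) \<in> U"
proof -
  have i: "smooth_at (\<lambda>x. \<phi> (inv (\<psi> x))) e\<^sub>0" "\<forall>\<^sub>F x in nhds e\<^sub>0. x \<in> \<phi> ` U \<and> inv (\<psi> x) \<in> U"
    using inv_smooth[OF chart chart one_U] one_U by auto
  show "smooth_at (\<lambda>z. \<phi> (inv (\<psi> (fst z)))) (e\<^sub>0, e\<^sub>0)"
    by (rule smooth_at_compose[where f = "\<lambda>x. \<phi> (inv (\<psi> x))" and g = fst])
      (use i fst_snd_smooth in auto)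
  show "\<forall>\<^sub>F z in nhds (e\<^sub>0, e\<^sub>0). fst z \<in> \<phi> ` U \<and> inv (\<psi> (fst z)) \<in> U"
    by (rule eventually_isCont[where f = fst and a = "(e\<^sub>0, e\<^sub>0)"])
      (use i in \<open>auto intro: continuous_intros\<close>)
qed

text \<open>
  Conjugation is obtained from the multiplication in coordinates alone, as (x y) x^{-1}; near the
  identity no other chart is needed.
\<close>

lemma conj_coord_smooth:
  "smooth_at conj_coord (e\<^sub>0, e\<^sub>0)"
  "\<forall>\<^sub>F z in nhds (e\<^sub>0, e\<^sub>0). fst z \<in> \<phi> ` U \<and> snd z \<in> \<phi> ` U \<and> \<psi> (fst z) \<otimes> \<psi> (snd z) \<otimes> inv (\<psi> (fst z)) \<in> U"
proof -
  let ?h = "\<lambda>z. (mult_coord z, \<phi> (inv (\<psi> (fst z))))"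
  have h: "smooth_at ?h (e\<^sub>0, e\<^sub>0)" by (intro smooth_at_Pair mult_coord_smooth inv_coordinates)
  have he: "?h (e\<^sub>0, e\<^sub>0) = (e\<^sub>0, e\<^sub>0)" by simp
  have c: "smooth_at (\<lambda>z. mult_coord (?h z)) (e\<^sub>0, e\<^sub>0)"
    by (rule smooth_at_compose[where f = mult_coord and g = ?h]) (simp_all only: he h mult_coord_smooth)
  have n: "\<forall>\<^sub>F z in nhds (e\<^sub>0, e\<^sub>0). \<psi> (fst (?h z)) \<otimes> \<psi> (snd (?h z)) \<in> U"
    by (rule eventually_isCont[where f = ?h and a = "(e\<^sub>0, e\<^sub>0)"])
      (use mult_coord_smooth(2) smooth_at_continuous[OF h] in \<open>simp_all only: he, auto elim: eventually_mono\<close>)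
  have "\<forall>\<^sub>F z in nhds (e\<^sub>0, e\<^sub>0). (fst z \<in> \<phi> ` U \<and> snd z \<in> \<phi> ` U \<and>
      \<psi> (fst z) \<otimes> \<psi> (snd z) \<otimes> inv (\<psi> (fst z)) \<in> U) \<and> mult_coord (?h z) = conj_coord z"
    using n mult_coord_smooth(2) inv_coordinates(2)
    by eventually_elim (auto simp: conj_coord_def mult_coord_def)
  then show "\<forall>\<^sub>F z in nhds (e\<^sub>0, e\<^sub>0). fst z \<in> \<phi> ` U \<and> snd z \<in> \<phi> ` U \<and>
      \<psi> (fst z) \<otimes> \<psi> (snd z) \<otimes> inv (\<psi> (fst z)) \<in> U"
    and "smooth_at conj_coord (e\<^sub>0, e\<^sub>0)"
    by (auto elim: eventually_mono intro: smooth_at_cong[OF c])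
qed

lemma ldiv_coord_smooth: "smooth_at ldiv_coord (e\<^sub>0, e\<^sub>0)"
proof -
  let ?h = "\<lambda>z. (\<phi> (inv (\<psi> (fst z))), snd z)"
  have h: "smooth_at ?h (e\<^sub>0, e\<^sub>0)" by (intro smooth_at_Pair inv_coordinates fst_snd_smooth)
  have he: "?h (e\<^sub>0, e\<^sub>0) = (e\<^sub>0, e\<^sub>0)" by simp
  have c: "smooth_at (\<lambda>z. mult_coord (?h z)) (e\<^sub>0, e\<^sub>0)"
    by (rule smooth_at_compose[where f = mult_coord and g = ?h]) (simp_all only: he h mult_coord_smooth)
  have "\<forall>\<^sub>F z in nhds (e\<^sub>0, e\<^sub>0). mult_coord (?h z) = ldiv_coord z"
    using inv_coordinates(2) by eventually_elim (auto simp: ldiv_coord_def mult_coord_def)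
  with c show ?thesis by (rule smooth_at_cong)
qed

end

section \<open>The adjoint representation and its derivative\<close>

lemma linear_slice:
  assumes "linear f"
  shows "linear (\<lambda>u. f (u, 0))"
proof (rule linearI)
  show "f (x + y, 0) = f (x, 0) + f (y, 0)" for x y
    using linear_add[OF assms, of "(x, 0)" "(y, 0)"] by simp
  show "f (r *\<^sub>R x, 0) = r *\<^sub>R f (x, 0)" for r x
    using linear_scale[OF assms, of r "(x, 0)"] by simp
qed

context lie_group_chart begin

abbreviation c where "c \<equiv> (U, \<phi>)"

lemma Ad_eq: "Ad G c g = frechet_derivative (\<lambda>y. \<phi> (g \<otimes> \<psi> y \<otimes> inv g)) (at e\<^sub>0)"
  by (simp add: Ad_def)

text \<open>
  For a g far from the identity the product of g with a small element leaves the chart U, so the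
  conjugation passes through a chart around g.
\<close>

lemma conjugation_smooth:
  assumes g: "g \<in> carrier G"
  shows "smooth_at (\<lambda>y. \<phi> (g \<otimes> \<psi> y \<otimes> inv g)) e\<^sub>0"
    and "\<forall>\<^sub>F y in nhds e\<^sub>0. y \<in> \<phi> ` U \<and> g \<otimes> \<psi> y \<otimes> inv g \<in> U"
proof -
  obtain V \<xi> where V: "(V, \<xi>) \<in> atlas G" "g \<in> V" using chart_cover g by blast
  have [simp]: "\<And>h. h \<in> V \<Longrightarrow> inv_into V \<xi> (\<xi> h) = h" using chartD(3)[OF V(1)] by simp
  have left: "smooth_at (\<lambda>y. \<xi> (g \<otimes> \<psi> y)) e\<^sub>0" "\<forall>\<^sub>F y in nhds e\<^sub>0. y \<in> \<phi> ` U \<and> g \<otimes> \<psi> y \<in> V"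
    using left_translation_smooth[OF g chart V(1) one_U] V(2) g by simp_all
  have right: "smooth_at (\<lambda>z. \<phi> (inv_into V \<xi> z \<otimes> inv g)) (\<xi> g)"
    "\<forall>\<^sub>F z in nhds (\<xi> g). z \<in> \<xi> ` V \<and> inv_into V \<xi> z \<otimes> inv g \<in> U"
    using right_translation_smooth[OF _ V(1) chart V(2), of "inv g"] g one_U by simp_all
  have e: "\<xi> (g \<otimes> \<psi> e\<^sub>0) = \<xi> g" using g by simp
  have c: "smooth_at (\<lambda>y. \<phi> (inv_into V \<xi> (\<xi> (g \<otimes> \<psi> y)) \<otimes> inv g)) e\<^sub>0"
    by (rule smooth_at_compose[where f = "\<lambda>z. \<phi> (inv_into V \<xi> z \<otimes> inv g)"])
      (simp_all only: e right left)
  have n: "\<forall>\<^sub>F y in nhds e\<^sub>0. inv_into V \<xi> (\<xi> (g \<otimes> \<psi> y)) \<otimes> inv g \<in> U"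
    using eventually_isCont[OF smooth_at_continuous[OF left(1)], unfolded e, OF right(2)]
    by (auto elim: eventually_mono)
  have "\<forall>\<^sub>F y in nhds e\<^sub>0. \<phi> (inv_into V \<xi> (\<xi> (g \<otimes> \<psi> y)) \<otimes> inv g) = \<phi> (g \<otimes> \<psi> y \<otimes> inv g)"
    using left(2) by eventually_elim simp
  with c show "smooth_at (\<lambda>y. \<phi> (g \<otimes> \<psi> y \<otimes> inv g)) e\<^sub>0" by (rule smooth_at_cong)
  show "\<forall>\<^sub>F y in nhds e\<^sub>0. y \<in> \<phi> ` U \<and> g \<otimes> \<psi> y \<otimes> inv g \<in> U"
    using left(2) n by eventually_elim simp
qed

lemma Ad_linear: "g \<in> carrier G \<Longrightarrow> linear (Ad G c g)"
  unfolding Ad_eq by (rule linear_frechet_derivative_smooth[OF conjugation_smooth(1)])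

lemma Ad_one: "Ad G c \<one> w = w"
proof -
  have "\<forall>\<^sub>F y in nhds e\<^sub>0. y = \<phi> (\<one> \<otimes> \<psi> y \<otimes> inv \<one>)"
    using eventually_in_chart[OF e0_in] by eventually_elim (simp add: \<psi>_carrier)
  from fun_cong[OF frechet_derivative_cong[OF smooth_at_ident this], of w] show ?thesis
    by (simp add: Ad_eq)
qed

text \<open>
  Conjugation by a product is the composition of the conjugations; the rest is the chain rule.
\<close>

lemma Ad_mult:
  assumes g: "g \<in> carrier G" and h: "h \<in> carrier G"
  shows "Ad G c (g \<otimes> h) w = Ad G c g (Ad G c h w)"
proof -
  let ?C = "\<lambda>g y. \<phi> (g \<otimes> \<psi> y \<otimes> inv g)"
  have e: "?C h e\<^sub>0 = e\<^sub>0" using h by simp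
  have c: "smooth_at (\<lambda>y. ?C g (?C h y)) e\<^sub>0"
    by (rule smooth_at_compose[where f = "?C g"]) (simp_all only: e conjugation_smooth g h)
  have "\<forall>\<^sub>F y in nhds e\<^sub>0. ?C g (?C h y) = ?C (g \<otimes> h) y"
    using conjugation_smooth(2)[OF h]
  proof eventually_elim
    case (elim y)
    then have "\<psi> (?C h y) = h \<otimes> \<psi> y \<otimes> inv h" by simp
    moreover have "g \<otimes> (h \<otimes> \<psi> y \<otimes> inv h) \<otimes> inv g = g \<otimes> h \<otimes> \<psi> y \<otimes> inv (g \<otimes> h)"
      using elim g h by (simp add: \<psi>_carrier m_assoc inv_mult_group)
    ultimately show ?case by metis
  qed
  from frechet_derivative_cong[OF c this]
  have "Ad G c (g \<otimes> h) w = frechet_derivative (\<lambda>y. ?C g (?C h y)) (at e\<^sub>0) w" by (simp add: Ad_eq)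
  also have "\<dots> = Ad G c g (Ad G c h w)"
    using frechet_derivative_compose_smooth[of "?C g" "?C h" e\<^sub>0 w] conjugation_smooth(1)[OF g]
      conjugation_smooth(1)[OF h] e by (simp add: Ad_eq)
  finally show ?thesis .
qed

lemma Ad_partial: "Ad G c (\<psi> x) w = frechet_derivative (\<lambda>y. conj_coord (x, y)) (at e\<^sub>0) w"
  by (simp add: Ad_eq conj_coord_def)

lemma eventually_slice_smooth:
  assumes "smooth_at f (a, b)"
  shows "\<forall>\<^sub>F x in nhds a. smooth_at f (x, b)"
  using eventually_slices(1)[OF smooth_at_eventually[OF assms]] .

lemma Ad_smooth: "smooth_at (\<lambda>x. Ad G c (\<psi> x) w) e\<^sub>0"
proof -
  have "smooth_at (\<lambda>x. frechet_derivative conj_coord (at (x, e\<^sub>0)) (0, w)) e\<^sub>0"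
    by (rule smooth_at_compose[where f = "\<lambda>z. frechet_derivative conj_coord (at z) (0, w)"])
      (rule smooth_at_frechet_derivative conj_coord_smooth(1) smooth_at_slices)+
  moreover have "\<forall>\<^sub>F x in nhds e\<^sub>0. frechet_derivative conj_coord (at (x, e\<^sub>0)) (0, w) = Ad G c (\<psi> x) w"
    using eventually_slice_smooth[OF conj_coord_smooth(1)]
    by eventually_elim (simp add: Ad_partial partial_derivative_snd)
  ultimately show ?thesis by (rule smooth_at_cong)
qed

abbreviation br where "br \<equiv> lie_bracket G c"

lemma left_inv_field_eq:
  "\<forall>\<^sub>F x in nhds e\<^sub>0. left_inv_field G c w x = frechet_derivative mult_coord (at (x, e\<^sub>0)) (0, w)"
  using eventually_slice_smooth[OF mult_coord_smooth(1)]
proof eventually_elim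
  case (elim x)
  from partial_derivative_snd[OF this, of w] show ?case
    by (simp add: left_inv_field_def mult_coord_def)
qed

lemma left_inv_field_at_one: "left_inv_field G c w e\<^sub>0 = w"
proof -
  have "\<forall>\<^sub>F y in nhds e\<^sub>0. y = \<phi> (\<psi> e\<^sub>0 \<otimes> \<psi> y)"
    using eventually_in_chart[OF e0_in] by eventually_elim (simp add: \<psi>_carrier)
  from fun_cong[OF frechet_derivative_cong[OF smooth_at_ident this], of w] show ?thesis
    by (simp add: left_inv_field_def)
qed

text \<open>
  The derivative of a left-invariant field is a mixed second derivative of the multiplication, in which
  the value w enters through the second factor.
\<close>

lemma left_inv_field_derivative:
  "(left_inv_field G c w has_derivative
     (\<lambda>v. frechet_derivative (\<lambda>z. frechet_derivative mult_coord (at z) (0, w)) (at (e\<^sub>0, e\<^sub>0)) (v, 0))) (at e\<^sub>0)"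
proof -
  let ?D = "\<lambda>z. frechet_derivative mult_coord (at z) (0, w)"
  have D: "smooth_at ?D (e\<^sub>0, e\<^sub>0)" by (rule smooth_at_frechet_derivative[OF mult_coord_smooth(1)])
  have sm: "smooth_at (\<lambda>x. ?D (x, e\<^sub>0)) e\<^sub>0"
    by (rule smooth_at_compose[where f = ?D]) (rule D smooth_at_slices)+
  have ev: "\<forall>\<^sub>F x in nhds e\<^sub>0. ?D (x, e\<^sub>0) = left_inv_field G c w x"
    using left_inv_field_eq[of w] by eventually_elim (rule sym)
  have "smooth_at (left_inv_field G c w) e\<^sub>0" by (rule smooth_at_cong[OF sm ev])
  moreover have "frechet_derivative (left_inv_field G c w) (at e\<^sub>0) = (\<lambda>v. frechet_derivative ?D (at (e\<^sub>0, e\<^sub>0)) (v, 0))"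
    using frechet_derivative_cong[OF sm ev] partial_derivative_fst[OF D] by auto
  ultimately show ?thesis using smooth_at_has_derivative by metis
qed

lemma mult_coord_derivative_fst: "frechet_derivative mult_coord (at (e\<^sub>0, e\<^sub>0)) (u, 0) = u"
proof -
  have "\<forall>\<^sub>F x in nhds e\<^sub>0. x = mult_coord (x, e\<^sub>0)"
    using eventually_in_chart[OF e0_in] by eventually_elim (simp add: \<psi>_carrier mult_coord_def)
  from fun_cong[OF frechet_derivative_cong[OF smooth_at_ident this], of u]
    partial_derivative_fst[OF mult_coord_smooth(1), of u]
  show ?thesis by simp
qed

text \<open>
  This is x y = (x y x^{-1}) x, differentiated in y at the identity.
\<close>

lemma left_field_right_translated:
  "\<forall>\<^sub>F x in nhds e\<^sub>0. left_inv_field G c w x = frechet_derivative mult_coord (at (e\<^sub>0, x)) (Ad G c (\<psi> x) w, 0)"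
proof -
  have "\<forall>\<^sub>F z in nhds (e\<^sub>0, e\<^sub>0). mult_coord z = mult_coord (conj_coord z, fst z)"
    using conj_coord_smooth(2)
  proof eventually_elim
    case (elim z)
    then have "\<psi> (conj_coord z) = \<psi> (fst z) \<otimes> \<psi> (snd z) \<otimes> inv (\<psi> (fst z))" by (simp add: conj_coord_def)
    moreover have "\<psi> (fst z) \<otimes> \<psi> (snd z) \<otimes> inv (\<psi> (fst z)) \<otimes> \<psi> (fst z) = \<psi> (fst z) \<otimes> \<psi> (snd z)"
      using elim by (simp add: \<psi>_carrier m_assoc)
    ultimately show ?case by (simp add: mult_coord_def)
  qed
  from eventually_nhds_Pair[OF this]
  have *: "\<forall>\<^sub>F x in nhds e\<^sub>0. \<forall>\<^sub>F y in nhds e\<^sub>0. mult_coord (x, y) = mult_coord (conj_coord (x, y), x)" by simp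
  have s: "\<forall>\<^sub>F x in nhds e\<^sub>0. smooth_at mult_coord (e\<^sub>0, x)"
    using eventually_slices(2)[OF smooth_at_eventually[OF mult_coord_smooth(1)]] .
  show ?thesis
    using * s left_inv_field_eq[of w] eventually_slice_smooth[OF mult_coord_smooth(1)]
      eventually_slice_smooth[OF conj_coord_smooth(1)] eventually_in_chart[OF e0_in]
  proof eventually_elim
    case (elim x)
    have ce: "conj_coord (x, e\<^sub>0) = e\<^sub>0" using elim(6) by (simp add: conj_coord_def \<psi>_carrier)
    have c: "smooth_at (\<lambda>y. conj_coord (x, y)) e\<^sub>0"
      by (rule smooth_at_compose[where f = conj_coord]) (rule elim smooth_at_slices)+
    have m: "smooth_at (\<lambda>u. mult_coord (u, x)) e\<^sub>0"
      by (rule smooth_at_compose[where f = mult_coord]) (rule elim smooth_at_slices)+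
    have "smooth_at (\<lambda>y. mult_coord (x, y)) e\<^sub>0"
      by (rule smooth_at_compose[where f = mult_coord]) (rule elim smooth_at_slices)+
    from frechet_derivative_cong[OF this elim(1)]
    have "frechet_derivative (\<lambda>y. mult_coord (x, y)) (at e\<^sub>0) w
        = frechet_derivative (\<lambda>y. mult_coord (conj_coord (x, y), x)) (at e\<^sub>0) w" by simp
    also have "\<dots> = frechet_derivative (\<lambda>u. mult_coord (u, x)) (at e\<^sub>0) (Ad G c (\<psi> x) w)"
      using frechet_derivative_compose_smooth[of "\<lambda>u. mult_coord (u, x)" "\<lambda>y. conj_coord (x, y)" e\<^sub>0 w] c m ce
      by (simp add: Ad_partial)
    also have "\<dots> = frechet_derivative mult_coord (at (e\<^sub>0, x)) (Ad G c (\<psi> x) w, 0)"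
      by (rule partial_derivative_fst[OF elim(2)])
    finally show ?case using elim(3) partial_derivative_snd[OF elim(4), of w] by simp
  qed
qed

text \<open>
  In the formula left_field_right_translated both the operator and the vector Ad(x) w depend on x. The
  derivative of the operator is the mixed second derivative with w in the first factor; by symmetry
  it equals the derivative of the left-invariant field of v in direction w, and what remains is
  the commutator of the two fields.
\<close>

lemma Ad_derivative_at_one: "((\<lambda>x. Ad G c (\<psi> x) w) has_derivative (\<lambda>v. br v w)) (at e\<^sub>0)"
proof -
  let ?a = "\<lambda>x. Ad G c (\<psi> x) w"
  let ?a' = "frechet_derivative ?a (at e\<^sub>0)"
  let ?H = "\<lambda>u v. frechet_derivative (\<lambda>z. frechet_derivative mult_coord (at z) u) (at (e\<^sub>0, e\<^sub>0)) v"
  let ?r = "\<lambda>b x. frechet_derivative mult_coord (at (e\<^sub>0, x)) (b, 0)"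
  have a: "(?a has_derivative ?a') (at e\<^sub>0)" by (rule smooth_at_has_derivative[OF Ad_smooth])
  have H: "smooth_at (\<lambda>z. frechet_derivative mult_coord (at z) u) (e\<^sub>0, e\<^sub>0)" for u
    by (rule smooth_at_frechet_derivative[OF mult_coord_smooth(1)])
  have r: "(?r b has_derivative (\<lambda>v. ?H (0, v) (b, 0))) (at e\<^sub>0)" for b
  proof -
    have "smooth_at (?r b) e\<^sub>0"
      by (rule smooth_at_compose[where f = "\<lambda>z. frechet_derivative mult_coord (at z) (b, 0)"])
        (rule H smooth_at_slices)+
    moreover have "frechet_derivative (?r b) (at e\<^sub>0) v = ?H (0, v) (b, 0)" for v
      using partial_derivative_snd[OF H, of "(b, 0)" v]
        second_derivative_symmetric[OF mult_coord_smooth(1), of "(b, 0)" "(0, v)"] by simp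
    then have "frechet_derivative (?r b) (at e\<^sub>0) = (\<lambda>v. ?H (0, v) (b, 0))" by (intro ext)
    ultimately show ?thesis using smooth_at_has_derivative[of "?r b" e\<^sub>0] by (simp only:)
  qed
  have expand: "left_inv_field G c w x = (\<Sum>b\<in>Basis. (?a x \<bullet> b) *\<^sub>R ?r b x)"
    if "smooth_at mult_coord (e\<^sub>0, x)"
      "left_inv_field G c w x = frechet_derivative mult_coord (at (e\<^sub>0, x)) (?a x, 0)" for x
  proof -
    have "linear (\<lambda>u. frechet_derivative mult_coord (at (e\<^sub>0, x)) (u, 0))"
      by (rule linear_slice[OF linear_frechet_derivative_smooth[OF that(1)]])
    from linear_sum[OF this, of "\<lambda>b. (?a x \<bullet> b) *\<^sub>R b" Basis]
    have "frechet_derivative mult_coord (at (e\<^sub>0, x)) ((\<Sum>b\<in>Basis. (?a x \<bullet> b) *\<^sub>R b), 0)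
        = (\<Sum>b\<in>Basis. (?a x \<bullet> b) *\<^sub>R ?r b x)"
      by (simp only: linear_scale[OF \<open>linear (\<lambda>u. frechet_derivative mult_coord (at (e\<^sub>0, x)) (u, 0))\<close>])
    with that(2) show ?thesis by (simp only: euclidean_representation)
  qed
  have "\<forall>\<^sub>F x in nhds e\<^sub>0. left_inv_field G c w x = (\<Sum>b\<in>Basis. (?a x \<bullet> b) *\<^sub>R ?r b x)"
    using left_field_right_translated eventually_slices(2)[OF smooth_at_eventually[OF mult_coord_smooth(1)]]
    by eventually_elim (rule expand)
  then obtain W where W: "open W" "e\<^sub>0 \<in> W"
    "\<And>x. x \<in> W \<Longrightarrow> left_inv_field G c w x = (\<Sum>b\<in>Basis. (?a x \<bullet> b) *\<^sub>R ?r b x)"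
    unfolding eventually_nhds by blast
  have "((\<lambda>x. \<Sum>b\<in>Basis. (?a x \<bullet> b) *\<^sub>R ?r b x) has_derivative
      (\<lambda>v. \<Sum>b\<in>Basis. (?a e\<^sub>0 \<bullet> b) *\<^sub>R ?H (0, v) (b, 0) + (?a' v \<bullet> b) *\<^sub>R ?r b e\<^sub>0)) (at e\<^sub>0)"
    by (intro has_derivative_sum has_derivative_scaleR has_derivative_inner_left a r)
  from has_derivative_transform_within_open[OF this W(1,2)] W(3)
  have L: "(left_inv_field G c w has_derivative
      (\<lambda>v. \<Sum>b\<in>Basis. (?a e\<^sub>0 \<bullet> b) *\<^sub>R ?H (0, v) (b, 0) + (?a' v \<bullet> b) *\<^sub>R ?r b e\<^sub>0)) (at e\<^sub>0)"
    by simp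
  have "?a' v = br v w" for v
  proof -
    have "linear (\<lambda>b. ?H (0, v) (b, 0))"
      by (rule linear_slice[OF linear_frechet_derivative_smooth[OF H]])
    from linear_sum[OF this, of "\<lambda>b. (w \<bullet> b) *\<^sub>R b" Basis]
    have "?H (0, v) ((\<Sum>b\<in>Basis. (w \<bullet> b) *\<^sub>R b), 0) = (\<Sum>b\<in>Basis. (w \<bullet> b) *\<^sub>R ?H (0, v) (b, 0))"
      by (simp only: linear_scale[OF \<open>linear (\<lambda>b. ?H (0, v) (b, 0))\<close>])
    then have s: "(\<Sum>b\<in>Basis. (w \<bullet> b) *\<^sub>R ?H (0, v) (b, 0)) = ?H (0, v) (w, 0)"
      by (simp only: euclidean_representation)
    have Ldiff: "frechet_derivative (left_inv_field G c u) (at e\<^sub>0) v = ?H (0, u) (v, 0)" for u v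
      using frechet_derivative_at[OF left_inv_field_derivative[of u]] by (simp add: fun_eq_iff)
    have "?H (0, w) (v, 0) = (\<Sum>b\<in>Basis. (w \<bullet> b) *\<^sub>R ?H (0, v) (b, 0) + (?a' v \<bullet> b) *\<^sub>R b)"
      using fun_cong[OF frechet_derivative_at[OF L], of v] Ldiff[of w v]
      by (simp add: mult_coord_derivative_fst Ad_one)
    also have "\<dots> = ?H (0, v) (w, 0) + ?a' v"
      by (simp add: sum.distrib s euclidean_representation)
    finally show ?thesis
      by (simp add: lie_bracket_def field_commutator_def left_inv_field_at_one Ldiff)
  qed
  then have "?a' = (\<lambda>v. br v w)" by (intro ext)
  from back_subst[of "\<lambda>f. (?a has_derivative f) (at e\<^sub>0)", OF a this] show ?thesis .
qed

lemma bracket_linear_left: "linear (\<lambda>v. br v w)"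
  using has_derivative_linear[OF Ad_derivative_at_one] .

lemma bracket_antisym: "br v w = - br w v"
  by (simp add: lie_bracket_def field_commutator_def)

lemma bracket_linear_right: "linear (\<lambda>w. br v w)"
proof -
  have "(\<lambda>w. br v w) = (\<lambda>w. - br w v)" by (intro ext bracket_antisym)
  then show ?thesis using linear_compose_neg[OF bracket_linear_left, of v] by (simp only:)
qed

text \<open>
  The logarithmic derivative g(t)^{-1} g'(t) of a curve with position x and velocity u.
\<close>

definition log_deriv :: "'e \<Rightarrow> 'e \<Rightarrow> 'e" where
  "log_deriv x u = frechet_derivative (\<lambda>y. ldiv_coord (x, y)) (at x) u"

text \<open>
  Ad(y) = Ad(x) Ad(x^{-1} y) reduces the derivative at x to the one at the identity.
\<close>

lemma Ad_derivative:
  assumes x: "x \<in> \<phi> ` U"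
  shows "((\<lambda>y. Ad G c (\<psi> y) w) has_derivative (\<lambda>u. Ad G c (\<psi> x) (br (log_deriv x u) w))) (at x)"
proof -
  have g: "\<psi> x \<in> carrier G" "\<psi> x \<in> U" using x by (auto simp: \<psi>_carrier \<psi>_U)
  have sm: "smooth_at (\<lambda>y. ldiv_coord (x, y)) x"
    and nb: "\<forall>\<^sub>F y in nhds x. y \<in> \<phi> ` U \<and> inv (\<psi> x) \<otimes> \<psi> y \<in> U"
    using left_translation_smooth[of "inv (\<psi> x)", OF _ chart chart g(2)] g one_U x
    by (simp_all add: ldiv_coord_def)
  have e: "ldiv_coord (x, x) = e\<^sub>0" using g by (simp add: ldiv_coord_def)
  let ?F = "\<lambda>y. Ad G c (\<psi> x) (Ad G c (\<psi> (ldiv_coord (x, y))) w)"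
  have "((\<lambda>y. ldiv_coord (x, y)) has_derivative log_deriv x) (at x)"
    using smooth_at_has_derivative[OF sm] by (simp add: log_deriv_def[abs_def])
  from has_derivative_compose[OF this, of "\<lambda>x. Ad G c (\<psi> x) w" "\<lambda>v. br v w"] Ad_derivative_at_one
  have "((\<lambda>y. Ad G c (\<psi> (ldiv_coord (x, y))) w) has_derivative (\<lambda>u. br (log_deriv x u) w)) (at x)"
    by (simp add: e)
  from bounded_linear.has_derivative[OF _ this, of "Ad G c (\<psi> x)"] Ad_linear[OF g(1)]
  have F: "(?F has_derivative (\<lambda>u. Ad G c (\<psi> x) (br (log_deriv x u) w))) (at x)"
    by (simp add: linear_conv_bounded_linear)
  from nb obtain W where W: "open W" "x \<in> W" "\<And>y. y \<in> W \<Longrightarrow> y \<in> \<phi> ` U \<and> inv (\<psi> x) \<otimes> \<psi> y \<in> U"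
    unfolding eventually_nhds by blast
  have "?F y = Ad G c (\<psi> y) w" if "y \<in> W" for y
    using W(3)[OF that] g
    by (simp add: ldiv_coord_def Ad_mult[symmetric] \<psi>_carrier m_assoc[symmetric])
  from has_derivative_transform_within_open[OF F W(1,2) this] show ?thesis .
qed

text \<open>
  Needed for the continuity of the coefficients of the differential equations along the orbit.
\<close>

lemma log_deriv_smooth: "smooth_at (\<lambda>x. log_deriv x u) e\<^sub>0"
proof -
  let ?D = "\<lambda>z. frechet_derivative ldiv_coord (at z) (0, u)"
  have d: "smooth_at (\<lambda>x. (x, x)) e\<^sub>0" by (intro smooth_at_Pair smooth_at_ident)
  have "smooth_at (\<lambda>x. ?D (x, x)) e\<^sub>0"
    by (rule smooth_at_compose[where f = ?D, OF _ d])
      (rule smooth_at_frechet_derivative ldiv_coord_smooth)+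
  moreover have "\<forall>\<^sub>F x in nhds e\<^sub>0. smooth_at ldiv_coord (x, x)"
    using eventually_isCont[OF smooth_at_continuous[OF d] smooth_at_eventually[OF ldiv_coord_smooth]] .
  then have "\<forall>\<^sub>F x in nhds e\<^sub>0. ?D (x, x) = log_deriv x u"
    by eventually_elim (simp add: log_deriv_def partial_derivative_snd)
  ultimately show ?thesis by (rule smooth_at_cong)
qed

end

section \<open>Coadjoint orbits\<close>

lemma smooth_at_sum:
  "(\<And>i. i \<in> I \<Longrightarrow> smooth_at (f i) p) \<Longrightarrow> smooth_at (\<lambda>x. \<Sum>i\<in>I. f i x) p"
  by (induction I rule: infinite_finite_induct) (auto intro: smooth_at_const smooth_at_add)

context lie_group_chart begin

abbreviation orbit where "orbit \<equiv> coadjoint_orbit G c"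

lemma coadjoint_apply:
  assumes "g \<in> carrier G"
  shows "blinfun_apply (coadjoint G c g F) Z = F (Ad G c (inv g) Z)"
  using Ad_linear[of "inv g"] assms
  by (simp add: coadjoint_def bounded_linear_Blinfun_apply linear_conv_bounded_linear)

text \<open>
  The inverse in the definition of the coadjoint action disappears, since the inverse of g also runs
  through the whole group.
\<close>

lemma orbit_iff: "Q \<in> orbit F \<longleftrightarrow> (\<exists>g\<in>carrier G. \<forall>Z. blinfun_apply Q Z = F (Ad G c g Z))"
proof
  assume "Q \<in> orbit F"
  then obtain g where "g \<in> carrier G" "Q = coadjoint G c g F" by (auto simp: coadjoint_orbit_def)
  then show "\<exists>g\<in>carrier G. \<forall>Z. blinfun_apply Q Z = F (Ad G c g Z)"
    by (auto simp: coadjoint_apply intro!: bexI[of _ "inv g"])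
next
  assume "\<exists>g\<in>carrier G. \<forall>Z. blinfun_apply Q Z = F (Ad G c g Z)"
  then obtain g where g: "g \<in> carrier G" "\<And>Z. blinfun_apply Q Z = F (Ad G c g Z)" by blast
  then have "Q = coadjoint G c (inv g) F" by (intro blinfun_eqI) (simp add: coadjoint_apply)
  with g show "Q \<in> orbit F" by (auto simp: coadjoint_orbit_def)
qed

lemma orbit_trans: "Q \<in> orbit F \<Longrightarrow> R \<in> orbit Q \<Longrightarrow> R \<in> orbit F"
  unfolding orbit_iff by (metis Ad_mult m_closed)

lemma orbit_sym: "Q \<in> orbit F \<Longrightarrow> F \<in> orbit Q"
  unfolding orbit_iff by (metis Ad_mult Ad_one inv_closed r_inv)

text \<open>
  The map g \<mapsto> F o Ad(g) in the chart, written in coordinates because the smoothness of operator-valued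
  maps is most easily checked on a basis.
\<close>

definition orbit_map :: "('e \<Rightarrow>\<^sub>L real) \<Rightarrow> 'e \<Rightarrow> ('e \<Rightarrow>\<^sub>L real)" where
  "orbit_map F x = (\<Sum>b\<in>Basis. F (Ad G c (\<psi> x) b) *\<^sub>R blinfun_inner_left b)"

text \<open>
  The functional F o ad(v).
\<close>

definition ad_star :: "('e \<Rightarrow>\<^sub>L real) \<Rightarrow> 'e \<Rightarrow> ('e \<Rightarrow>\<^sub>L real)" where
  "ad_star F v = (\<Sum>b\<in>Basis. F (br v b) *\<^sub>R blinfun_inner_left b)"

lemma blinfun_coordinates:
  fixes F :: "'e \<Rightarrow>\<^sub>L real"
  assumes "linear L"
  shows "blinfun_apply (\<Sum>b\<in>Basis. F (L b) *\<^sub>R blinfun_inner_left b) Z = F (L Z)"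
proof -
  have "F (L (\<Sum>b\<in>Basis. (Z \<bullet> b) *\<^sub>R b)) = (\<Sum>b\<in>Basis. (Z \<bullet> b) * F (L b))"
    using assms by (simp add: linear_sum linear_scale blinfun.sum_right blinfun.scaleR_right)
  then have "F (L Z) = (\<Sum>b\<in>Basis. (Z \<bullet> b) * F (L b))" by (simp only: euclidean_representation)
  then show ?thesis
    by (simp add: blinfun.sum_left blinfun.scaleR_left mult.commute inner_commute)
qed

lemma orbit_map_apply: "x \<in> \<phi> ` U \<Longrightarrow> blinfun_apply (orbit_map F x) Z = F (Ad G c (\<psi> x) Z)"
  unfolding orbit_map_def by (rule blinfun_coordinates[OF Ad_linear[OF \<psi>_carrier]])

lemma ad_star_apply: "blinfun_apply (ad_star F v) Z = F (br v Z)"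
  unfolding ad_star_def by (rule blinfun_coordinates[OF bracket_linear_right])

lemma orbit_map_in_orbit: "x \<in> \<phi> ` U \<Longrightarrow> orbit_map F x \<in> orbit F"
  unfolding orbit_iff using orbit_map_apply \<psi>_carrier by blast

lemma orbit_map_at_one: "orbit_map F e\<^sub>0 = F"
  by (rule blinfun_eqI) (simp add: orbit_map_apply e0_in Ad_one)

lemma orbit_map_smooth: "smooth_at (orbit_map F) e\<^sub>0"
  unfolding orbit_map_def
proof (rule smooth_at_sum)
  fix b :: 'e
  have L: "bounded_linear (\<lambda>w. blinfun_apply F w *\<^sub>R blinfun_inner_left b)"
    by (intro bounded_linear_scaleR_const blinfun.bounded_linear_right)
  show "smooth_at (\<lambda>x. F (Ad G c (\<psi> x) b) *\<^sub>R blinfun_inner_left b) e\<^sub>0"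
    by (rule smooth_at_compose[where f = "\<lambda>w. blinfun_apply F w *\<^sub>R blinfun_inner_left b",
          OF smooth_at_linear[OF L] Ad_smooth])
qed

lemma orbit_map_has_derivative: "(orbit_map F has_derivative ad_star F) (at e\<^sub>0)"
  unfolding orbit_map_def ad_star_def
  by (intro has_derivative_sum has_derivative_scaleR_left
      bounded_linear.has_derivative[OF blinfun.bounded_linear_right] Ad_derivative_at_one)

text \<open>
  A tangent curve has to be defined for all times, whereas the chart covers only a neighbourhood of the
  identity. The curve sin(n t)/n in direction v stays in that neighbourhood and has velocity v.
\<close>

lemma ad_star_tangent: "ad_star F v \<in> tangent_vectors (orbit F) F"
proof -
  obtain W where W: "open W" "e\<^sub>0 \<in> W" "smooth_on W (orbit_map F)"
    using orbit_map_smooth by (auto simp: smooth_at_def)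
  have "open (W \<inter> \<phi> ` U)" "e\<^sub>0 \<in> W \<inter> \<phi> ` U" using W chartD(2)[OF chart] e0_in by auto
  then obtain r where r: "r > 0" "ball e\<^sub>0 r \<subseteq> W \<inter> \<phi> ` U" by (meson openE)
  \<comment> \<open>the frequency keeps the amplitude norm v / n below the radius r\<close>
  define n where "n = (norm v + 1) / r"
  have "norm v + 1 > 0" by (smt (verit) norm_ge_zero)
  then have n: "n > 0" "norm v / n < r" using r(1) by (simp_all add: n_def field_simps)
  \<comment> \<open>the cosine term is kept, with coefficient 0, to match the class of functions treated above\<close>
  define \<gamma> where "\<gamma> t = e\<^sub>0 + (1 / n * sin (n * t) + 0 * cos (n * t)) *\<^sub>R v" for t
  have \<gamma>_ball: "\<gamma> t \<in> ball e\<^sub>0 r" for t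
  proof -
    have "norm ((1 / n * sin (n * t)) *\<^sub>R v) \<le> 1 / n * norm v"
      using n(1) by (simp add: abs_mult divide_right_mono mult_left_le_one_le)
    with n(2) show ?thesis by (simp add: \<gamma>_def dist_norm)
  qed
  have \<gamma>_smooth: "C_k k UNIV \<gamma>" for k
    unfolding \<gamma>_def by (intro C_k_add C_k_const C_k_scaleR C_k_sin_cos)
  have \<gamma>_deriv: "(\<gamma> has_derivative (\<lambda>h. h *\<^sub>R v)) (at 0)"
    unfolding \<gamma>_def by (rule derivative_eq_intros refl)+ (use n(1) in simp)
  let ?c = "\<lambda>t. orbit_map F (\<gamma> t)"
  have "smooth_on UNIV ?c"
    unfolding smooth_on_def
  proof
    fix k
    have "C_k k W (orbit_map F)" using W(3) by (simp add: smooth_on_def)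
    moreover have "\<gamma> ` UNIV \<subseteq> W" using \<gamma>_ball r(2) by blast
    ultimately show "C_k k UNIV ?c" using C_k_compose[of \<gamma> UNIV W k "orbit_map F"] \<gamma>_smooth by simp
  qed
  moreover have "range ?c \<subseteq> orbit F" using \<gamma>_ball r(2) orbit_map_in_orbit by blast
  moreover have "?c 0 = F" by (simp add: \<gamma>_def orbit_map_at_one)
  moreover have "(?c has_vector_derivative ad_star F v) (at 0)"
  proof -
    have "\<gamma> 0 = e\<^sub>0" by (simp add: \<gamma>_def)
    with has_derivative_compose[OF \<gamma>_deriv, of "orbit_map F" "ad_star F"] orbit_map_has_derivative
    show ?thesis
      using linear_scale[OF has_derivative_linear[OF orbit_map_has_derivative]]
      by (simp add: has_vector_derivative_def)
  qed
  ultimately show ?thesis unfolding tangent_vectors_def by blast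
qed

text \<open>
  The relation Q(g^{-1} h) and Q(h^{-1} g) is an equivalence relation whose classes are open, so there is
  only one class.
\<close>

lemma connected_group_induct:
  assumes conn: "connected (carrier G)"
    and near: "\<forall>\<^sub>F x in nhds e\<^sub>0. Q (\<psi> x)"
    and mult: "\<And>g h. g \<in> carrier G \<Longrightarrow> h \<in> carrier G \<Longrightarrow> Q g \<Longrightarrow> Q h \<Longrightarrow> Q (g \<otimes> h)"
    and g: "g \<in> carrier G"
  shows "Q g"
proof -
  have "\<forall>\<^sub>F x in nhds e\<^sub>0. Q (\<psi> x) \<and> Q (inv (\<psi> x))"
  proof (rule eventually_conj[OF near])
    have i: "smooth_at (\<lambda>x. \<phi> (inv (\<psi> x))) e\<^sub>0" "\<forall>\<^sub>F x in nhds e\<^sub>0. x \<in> \<phi> ` U \<and> inv (\<psi> x) \<in> U"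
      using inv_smooth[OF chart chart one_U] one_U by auto
    have "\<forall>\<^sub>F x in nhds e\<^sub>0. Q (\<psi> (\<phi> (inv (\<psi> x))))"
      by (rule eventually_isCont[OF smooth_at_continuous[OF i(1)]]) (use near in simp)
    with i(2) show "\<forall>\<^sub>F x in nhds e\<^sub>0. Q (inv (\<psi> x))" by eventually_elim simp
  qed
  then obtain W where W: "open W" "e\<^sub>0 \<in> W" "\<And>x. x \<in> W \<Longrightarrow> Q (\<psi> x) \<and> Q (inv (\<psi> x))"
    unfolding eventually_nhds by blast
  define N where "N = U \<inter> \<phi> -` W"
  have N: "openin (top_of_set (carrier G)) N" "\<one> \<in> N" "\<And>n. n \<in> N \<Longrightarrow> Q n \<and> Q (inv n)"
  proof -
    have "openin (top_of_set U) N"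
      unfolding N_def using chartD(4)[OF chart] W(1) by (rule continuous_openin_preimage_gen)
    then show "openin (top_of_set (carrier G)) N" using chartD(1)[OF chart] by (rule openin_trans)
    show "\<one> \<in> N" using W(2) one_U by (simp add: N_def)
    show "Q n \<and> Q (inv n)" if "n \<in> N" for n using W(3)[of "\<phi> n"] that by (simp add: N_def)
  qed
  let ?R = "\<lambda>g h. Q (inv g \<otimes> h) \<and> Q (inv h \<otimes> g)"
  have "?R \<one> g"
  proof (rule connected_equivalence_relation[OF conn, where R = ?R])
    show "?R x z" if "?R x y" "?R y z" "x \<in> carrier G" "y \<in> carrier G" "z \<in> carrier G" for x y z
    proof -
      have "inv x \<otimes> z = inv x \<otimes> y \<otimes> (inv y \<otimes> z)" "inv z \<otimes> x = inv z \<otimes> y \<otimes> (inv y \<otimes> x)"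
        using that by (simp_all add: m_assoc inv_solve_left flip: m_assoc[of y])
      with that mult[of "inv x \<otimes> y" "inv y \<otimes> z"] mult[of "inv z \<otimes> y" "inv y \<otimes> x"] show ?thesis
        by simp
    qed
    show "\<exists>T. openin (top_of_set (carrier G)) T \<and> a \<in> T \<and> (\<forall>x\<in>T. ?R a x)" if a: "a \<in> carrier G" for a
    proof (intro exI conjI ballI)
      have "continuous_on (carrier G \<times> carrier G) (\<lambda>(g, h). g \<otimes> h)"
        using lie by (simp add: is_lie_group_def smooth_map_def)
      then have "continuous_on (carrier G) (\<lambda>h. (\<lambda>(g, h). g \<otimes> h) (inv a, h))"
        by (rule continuous_on_compose2) (use a in \<open>auto intro!: continuous_intros\<close>)
      then show "openin (top_of_set (carrier G)) (carrier G \<inter> (\<lambda>h. inv a \<otimes> h) -` N)"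
        using N(1) a by (intro continuous_openin_preimage[of _ _ "carrier G"]) auto
      show "a \<in> carrier G \<inter> (\<lambda>h. inv a \<otimes> h) -` N" using a N(2) by simp
      fix x assume "x \<in> carrier G \<inter> (\<lambda>h. inv a \<otimes> h) -` N"
      then have x: "x \<in> carrier G" "inv a \<otimes> x \<in> N" by auto
      with N(3)[OF x(2)] a show "Q (inv a \<otimes> x)" "Q (inv x \<otimes> a)" by (simp_all add: inv_mult_group)
    qed
  qed (use g in auto)
  then show ?thesis using g by simp
qed

lemma log_deriv_linear: "x \<in> \<phi> ` U \<Longrightarrow> linear (log_deriv x)"
proof -
  assume x: "x \<in> \<phi> ` U"
  then have g: "\<psi> x \<in> carrier G" "\<psi> x \<in> U" by (auto simp: \<psi>_carrier \<psi>_U)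
  have "smooth_at (\<lambda>y. ldiv_coord (x, y)) x"
    using left_translation_smooth(1)[of "inv (\<psi> x)", OF _ chart chart g(2)] g one_U x
    by (simp add: ldiv_coord_def)
  from linear_frechet_derivative_smooth[OF this] show ?thesis by (simp add: log_deriv_def[abs_def])
qed

text \<open>
  Each point near the identity is joined to it by a segment in the chart, along which F o Ad
  satisfies the differential equation of the hypothesis; so Ad of a small element preserves S, and
  small elements generate the group.
\<close>

lemma orbit_subset_flow_invariant:
  fixes F :: "'e \<Rightarrow>\<^sub>L real"
  assumes conn: "connected (carrier G)"
    and flow: "\<And>(P :: real \<Rightarrow> ('e \<Rightarrow>\<^sub>L real)) \<xi>. continuous_on {0..1} \<xi> \<Longrightarrow>
      (\<And>Z t. t \<in> {0..1} \<Longrightarrow> ((\<lambda>t. blinfun_apply (P t) Z) has_real_derivative P t (br (\<xi> t) Z)) (at t)) \<Longrightarrow>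
      P 0 \<in> S \<Longrightarrow> P 1 \<in> S"
    and F: "F \<in> S"
  shows "orbit F \<subseteq> S"
proof -
  let ?Q = "\<lambda>g. \<forall>P\<in>S. \<forall>R. (\<forall>Z. blinfun_apply R Z = blinfun_apply P (Ad G c g Z)) \<longrightarrow> R \<in> S"
  have "\<forall>\<^sub>F x in nhds e\<^sub>0. x \<in> \<phi> ` U \<and> (\<forall>b\<in>Basis. smooth_at (\<lambda>x. log_deriv x b) x)"
    by (intro eventually_conj eventually_in_chart e0_in eventually_ball_finite ballI
        smooth_at_eventually log_deriv_smooth) simp
  then obtain r where r: "r > 0" "\<And>x. x \<in> ball e\<^sub>0 r \<Longrightarrow> x \<in> \<phi> ` U"
    "\<And>x b. x \<in> ball e\<^sub>0 r \<Longrightarrow> b \<in> Basis \<Longrightarrow> isCont (\<lambda>x. log_deriv x b) x"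
    by (auto simp: eventually_nhds_metric mem_ball dist_commute intro: smooth_at_continuous)
  have "?Q (\<psi> x)" if x: "x \<in> ball e\<^sub>0 r" for x
  proof (intro ballI allI impI)
    fix P R assume P: "P \<in> S" and R: "\<forall>Z. blinfun_apply R Z = blinfun_apply P (Ad G c (\<psi> x) Z)"
    define u where "u = x - e\<^sub>0"
    define \<gamma> where "\<gamma> t = e\<^sub>0 + t *\<^sub>R u" for t :: real
    have in_ball: "\<gamma> t \<in> ball e\<^sub>0 r" if "t \<in> {0..1}" for t
    proof -
      have "norm (t *\<^sub>R u) \<le> norm u" using that by (simp add: mult_left_le_one_le)
      with x show ?thesis by (simp add: \<gamma>_def u_def dist_norm norm_minus_commute)
    qed
    define \<xi> where "\<xi> t = (\<Sum>b\<in>Basis. (u \<bullet> b) *\<^sub>R log_deriv (\<gamma> t) b)" for t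
    have \<xi>: "log_deriv (\<gamma> t) u = \<xi> t" if "t \<in> {0..1}" for t
    proof -
      have lin: "linear (log_deriv (\<gamma> t))" using log_deriv_linear r(2) in_ball[OF that] by blast
      have "log_deriv (\<gamma> t) (\<Sum>b\<in>Basis. (u \<bullet> b) *\<^sub>R b) = \<xi> t"
        unfolding \<xi>_def linear_sum[OF lin] linear_scale[OF lin] ..
      then show ?thesis by (simp only: euclidean_representation)
    qed
    have \<gamma>_cont: "continuous_on {0..1} \<gamma>" unfolding \<gamma>_def by (intro continuous_intros)
    have "continuous_on {0..1} (\<lambda>t. log_deriv (\<gamma> t) b)" if "b \<in> Basis" for b
    proof (rule continuous_on_compose2[OF _ \<gamma>_cont])
      show "continuous_on (ball e\<^sub>0 r) (\<lambda>x. log_deriv x b)"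
        using r(3) that by (intro continuous_at_imp_continuous_on) auto
    qed (use in_ball in auto)
    then have cont: "continuous_on {0..1} \<xi>"
      unfolding \<xi>_def by (intro continuous_on_sum continuous_on_scaleR continuous_on_const)
    have d: "((\<lambda>t. orbit_map P (\<gamma> t) Z) has_real_derivative orbit_map P (\<gamma> t) (br (\<xi> t) Z)) (at t)"
      if "t \<in> {0..1}" for t Z
    proof -
      have xt: "\<gamma> t \<in> \<phi> ` U" using r(2) in_ball[OF that] .
      have "(\<gamma> has_derivative (\<lambda>h. h *\<^sub>R u)) (at t)"
        unfolding \<gamma>_def by (rule derivative_eq_intros refl)+ simp
      from bounded_linear.has_derivative[OF blinfun.bounded_linear_right
          has_derivative_compose[OF this Ad_derivative[OF xt]], of P Z]
      have "((\<lambda>t. P (Ad G c (\<psi> (\<gamma> t)) Z)) has_derivative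
          (\<lambda>h. P (Ad G c (\<psi> (\<gamma> t)) (br (log_deriv (\<gamma> t) (h *\<^sub>R u)) Z)))) (at t)" .
      moreover have "P (Ad G c (\<psi> (\<gamma> t)) (br (log_deriv (\<gamma> t) (h *\<^sub>R u)) Z))
          = orbit_map P (\<gamma> t) (br (\<xi> t) Z) * h" for h
      proof -
        have "br (log_deriv (\<gamma> t) (h *\<^sub>R u)) Z = h *\<^sub>R br (\<xi> t) Z"
          using linear_scale[OF log_deriv_linear[OF xt], of h u] \<xi>[OF that]
            linear_scale[OF bracket_linear_left] by simp
        then show ?thesis
          using linear_scale[OF Ad_linear[OF \<psi>_carrier[OF xt]]] xt
          by (simp add: orbit_map_apply blinfun.scaleR_right)
      qed
      ultimately have D: "((\<lambda>t. P (Ad G c (\<psi> (\<gamma> t)) Z)) has_derivative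
          (\<lambda>h. orbit_map P (\<gamma> t) (br (\<xi> t) Z) * h)) (at t)" by simp
      have "open (\<gamma> -` \<phi> ` U)"
        using chartD(2)[OF chart] by (rule open_vimage) (auto simp: \<gamma>_def[abs_def] intro!: continuous_intros)
      from has_derivative_transform_within_open[OF D this, of "\<lambda>t. orbit_map P (\<gamma> t) Z"] xt
      show ?thesis by (simp add: has_field_derivative_def orbit_map_apply)
    qed
    have "orbit_map P (\<gamma> 1) \<in> S"
      by (rule flow[OF cont d]) (use P in \<open>auto simp: \<gamma>_def orbit_map_at_one\<close>)
    moreover have "orbit_map P (\<gamma> 1) = R"
      by (rule blinfun_eqI) (use R r(2)[OF x] in \<open>simp add: \<gamma>_def u_def orbit_map_apply\<close>)
    ultimately show "R \<in> S" by simp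
  qed
  then have near: "\<forall>\<^sub>F x in nhds e\<^sub>0. ?Q (\<psi> x)"
    unfolding eventually_nhds using r(1) by (intro exI[of _ "ball e\<^sub>0 r"]) auto
  have mult: "?Q (g \<otimes> h)" if g: "g \<in> carrier G" and h: "h \<in> carrier G" and Qg: "?Q g" and Qh: "?Q h" for g h
  proof (intro ballI allI impI)
    fix P R assume P: "P \<in> S" and R: "\<forall>Z. blinfun_apply R Z = blinfun_apply P (Ad G c (g \<otimes> h) Z)"
    let ?P = "coadjoint G c (inv g) P"
    have "?P \<in> S" using Qg P g by (simp add: coadjoint_apply)
    with Qh R g h show "R \<in> S" by (simp add: coadjoint_apply Ad_mult)
  qed
  show ?thesis
  proof
    fix R assume "R \<in> orbit F"
    then obtain g where "g \<in> carrier G" "\<forall>Z. blinfun_apply R Z = F (Ad G c g Z)"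
      unfolding orbit_iff by blast
    with connected_group_induct[of ?Q, OF conn near mult, of g] F show "R \<in> S" by blast
  qed
qed

text \<open>
  Surjectivity of the derivative of the orbit map makes every orbit a neighbourhood of each of its
  points in the image of \<pi>. Orbits are disjoint, so the connected image contains only one of them.
  Sussmann's open mapping theorem is suitable because it needs the derivative at a single point only.
\<close>

lemma orbit_eq_if_locally_transitive:
  fixes \<pi> :: "('e \<Rightarrow>\<^sub>L real) \<Rightarrow> 'v::euclidean_space"
  assumes \<pi>: "bounded_linear \<pi>" and inj: "inj_on \<pi> S" and conn: "connected (\<pi> ` S)"
    and inv: "\<And>P. P \<in> S \<Longrightarrow> orbit P \<subseteq> S"
    and surj: "\<And>P y. P \<in> S \<Longrightarrow> \<exists>v. \<pi> (ad_star P v) = y"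
    and F: "F \<in> S"
  shows "orbit F = S"
proof
  show "orbit F \<subseteq> S" by (rule inv[OF F])
  have nbhd: "\<pi> P \<in> interior (\<pi> ` orbit P)" if P: "P \<in> S" for P
  proof -
    let ?f = "\<lambda>x. \<pi> (orbit_map P x)"
    obtain W where W: "open W" "e\<^sub>0 \<in> W" "smooth_on W (orbit_map P)"
      using orbit_map_smooth by (auto simp: smooth_at_def)
    have op: "open (W \<inter> \<phi> ` U)" using W chartD(2)[OF chart] by auto
    have mem: "e\<^sub>0 \<in> W \<inter> \<phi> ` U" using W e0_in by auto
    have "C_k 0 W (orbit_map P)" using W(3) by (simp only: smooth_on_def)
    then have cont: "continuous_on (W \<inter> \<phi> ` U) ?f"
      by (intro bounded_linear.continuous_on[OF \<pi>]) (auto intro: continuous_on_subset)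
    have d: "(?f has_derivative (\<lambda>v. \<pi> (ad_star P v))) (at e\<^sub>0)"
      by (rule bounded_linear.has_derivative[OF \<pi> orbit_map_has_derivative])
    have "surj (\<lambda>v. \<pi> (ad_star P v))" using surj[OF P] by (metis surj_def)
    with linear_surjective_right_inverse[OF has_derivative_linear[OF d]] obtain g' where
      g': "linear g'" "(\<lambda>v. \<pi> (ad_star P v)) \<circ> g' = id" by blast
    have "bounded_linear g'" using g'(1) by (simp add: linear_conv_bounded_linear)
    moreover have "e\<^sub>0 \<in> interior (W \<inter> \<phi> ` U)" using mem by (simp only: interior_open[OF op])
    ultimately have "?f e\<^sub>0 \<in> interior (?f ` (W \<inter> \<phi> ` U))"
      by (intro sussmann_open_mapping[OF op cont mem d _ g'(2) subset_refl])
    moreover have "?f ` (W \<inter> \<phi> ` U) \<subseteq> \<pi> ` orbit P" by (auto intro: orbit_map_in_orbit)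
    ultimately have "?f e\<^sub>0 \<in> interior (\<pi> ` orbit P)" using interior_mono by blast
    then show ?thesis by (simp only: orbit_map_at_one)
  qed
  let ?R = "\<lambda>a b. \<exists>P\<in>S. \<exists>Q\<in>S. a = \<pi> P \<and> b = \<pi> Q \<and> Q \<in> orbit P"
  show "S \<subseteq> orbit F"
  proof
    fix Q assume Q: "Q \<in> S"
    have "?R (\<pi> F) (\<pi> Q)"
    proof (rule connected_equivalence_relation[OF conn, where R = ?R])
      show "?R y x" if "?R x y" for x y using that orbit_sym by blast
      show "?R x z" if "?R x y" "?R y z" for x y z
        using that inj orbit_trans by (smt (verit) inj_onD)
      show "\<exists>T. openin (top_of_set (\<pi> ` S)) T \<and> a \<in> T \<and> (\<forall>x\<in>T. ?R a x)" if a: "a \<in> \<pi> ` S" for a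
      proof -
        obtain P where P: "P \<in> S" "a = \<pi> P" using a by blast
        have sub: "interior (\<pi> ` orbit P) \<subseteq> \<pi> ` orbit P" by (rule interior_subset)
        also have "\<dots> \<subseteq> \<pi> ` S" using inv[OF P(1)] by blast
        finally have "openin (top_of_set (\<pi> ` S)) (interior (\<pi> ` orbit P))"
          by (rule open_subset[OF _ open_interior])
        moreover have "?R a x" if "x \<in> interior (\<pi> ` orbit P)" for x
          using that sub P inv[OF P(1)] by blast
        ultimately show ?thesis using nbhd[OF P(1)] P(2) by blast
      qed
    qed (use F Q in auto)
    then obtain P R where PR: "P \<in> S" "R \<in> S" "\<pi> F = \<pi> P" "\<pi> Q = \<pi> R" "R \<in> orbit P" by blast
    then have "F = P" "Q = R" using inj F Q by (auto dest: inj_onD)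
    with PR show "Q \<in> orbit F" by simp
  qed
qed

end

section \<open>Linear differential equations, tangent spaces and the invariant function\<close>

text \<open>
  The factor exp(-\<integral>l) makes f constant.
\<close>

lemma linear_ode_solution:
  fixes f l :: "real \<Rightarrow> real"
  assumes l: "continuous_on {0..1} l"
    and f: "\<And>t. t \<in> {0..1} \<Longrightarrow> (f has_real_derivative l t * f t) (at t)"
  shows "\<exists>E. \<forall>t\<in>{0..1}. E t > 0 \<and> f t = E t * f 0"
proof -
  define L where "L t = integral {0..t} l" for t
  have L: "(L has_real_derivative l t) (at t within {0..1})" if "t \<in> {0..1}" for t
    unfolding L_def using integral_has_real_derivative[OF l that] .
  have "\<exists>k. \<forall>t\<in>{0..1}. f t * exp (- L t) = k"
  proof (rule has_field_derivative_zero_constant[OF convex_real_interval(5)])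
    fix t :: real assume t: "t \<in> {0..1}"
    have "((\<lambda>t. exp (- L t)) has_real_derivative exp (- L t) * (- l t)) (at t within {0..1})"
      using L[OF t] by (auto intro!: derivative_eq_intros)
    then have "((\<lambda>t. f t * exp (- L t)) has_real_derivative
        (l t * f t) * exp (- L t) + (exp (- L t) * (- l t)) * f t) (at t within {0..1})"
      by (intro DERIV_mult DERIV_subset[OF f[OF t]] subset_UNIV)
    then show "((\<lambda>t. f t * exp (- L t)) has_real_derivative 0) (at t within {0..1})"
      by (simp add: algebra_simps)
  qed
  then obtain k where k: "\<And>t. t \<in> {0..1} \<Longrightarrow> f t * exp (- L t) = k" by blast
  have "f t = exp (L t) * f 0" if "t \<in> {0..1}" for t
  proof -
    have "L 0 = 0" by (simp add: L_def)
    then have "f t * exp (- L t) = f 0" using k[OF that] k[of 0] by simp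
    moreover have "f t = (f t * exp (- L t)) * exp (L t)" by (simp add: mult.assoc exp_minus)
    ultimately show ?thesis by (metis mult.commute)
  qed
  then show ?thesis by (intro exI[of _ "\<lambda>t. exp (L t)"] ballI conjI exp_gt_zero)
qed

lemma linear_system_2x2:
  fixes a b c d :: real
  assumes "a * d - b * c \<noteq> 0"
  obtains s t where "s * a + t * b = r" "s * c + t * d = r'"
proof
  let ?D = "a * d - b * c"
  show "((r * d - r' * b) / ?D) * a + ((r' * a - r * c) / ?D) * b = r"
    using assms by (simp add: divide_simps) (simp add: algebra_simps)
  show "((r * d - r' * b) / ?D) * c + ((r' * a - r * c) / ?D) * d = r'"
    using assms by (simp add: divide_simps) (simp add: algebra_simps)
qed

text \<open>
  Dimensions of sets of functionals are computed by mapping them linearly into a Euclidean space.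
\<close>

lemma dim_le_by_injection:
  fixes \<pi> :: "'v::real_vector \<Rightarrow> 'w::euclidean_space"
  assumes \<pi>: "linear \<pi>" and W: "subspace W" "T \<subseteq> W" and inj: "\<And>v. v \<in> W \<Longrightarrow> \<pi> v = 0 \<Longrightarrow> v = 0"
  shows "dim T \<le> DIM('w)" and "UNIV \<subseteq> \<pi> ` T \<Longrightarrow> dim T = DIM('w)"
proof -
  obtain B where B: "B \<subseteq> T" "independent B" "T \<subseteq> span B" "card B = dim T"
    using basis_exists[of T] by blast
  have sub: "span B \<subseteq> W" using B(1) W by (meson span_minimal subset_trans)
  have inj_B: "inj_on \<pi> (span B)"
  proof (rule inj_onI)
    fix x y assume "x \<in> span B" "y \<in> span B" "\<pi> x = \<pi> y"
    then have "x - y \<in> W" "\<pi> (x - y) = 0" using sub linear_diff[OF \<pi>] by (auto intro: span_diff)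
    from inj[OF this] show "x = y" by simp
  qed
  have ind: "independent (\<pi> ` B)"
    by (rule linear_independent_injective_image[OF \<pi> B(2) inj_B])
  have card: "card (\<pi> ` B) = dim T"
    using B(4) inj_on_subset[OF inj_B span_superset] by (simp add: card_image)
  show "dim T \<le> DIM('w)" using independent_bound[OF ind] card by simp
  show "dim T = DIM('w)" if "UNIV \<subseteq> \<pi> ` T"
  proof -
    have "UNIV \<subseteq> span (\<pi> ` B)" using that B(3) linear_span_image[OF \<pi>, of B] by blast
    then have "span (\<pi> ` B) = span UNIV" by auto
    with dim_eq_card[OF this ind] card show ?thesis by simp
  qed
qed

lemma tangent_vector_curve:
  fixes p V :: "'e::euclidean_space \<Rightarrow>\<^sub>L real"
  assumes "V \<in> tangent_vectors S p"
  obtains q :: "real \<Rightarrow> 'e \<Rightarrow>\<^sub>L real" where "range q \<subseteq> S" "q 0 = p"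
    "\<And>Z. ((\<lambda>t. blinfun_apply (q t) Z) has_real_derivative blinfun_apply V Z) (at 0)"
proof -
  obtain q where q: "range q \<subseteq> S" "q 0 = p" "(q has_vector_derivative V) (at 0)"
    using assms by (auto simp: tangent_vectors_def)
  have "((\<lambda>t. blinfun_apply (q t) Z) has_real_derivative blinfun_apply V Z) (at 0)" for Z
    using bounded_linear.has_derivative[OF blinfun.bounded_linear_left q(3)[unfolded has_vector_derivative_def], of Z]
    by (simp add: has_field_derivative_def blinfun.scaleR_left mult.commute[of _ "blinfun_apply V Z"])
  with q that show thesis by blast
qed

lemma tangent_vector_annihilates:
  fixes p V :: "'e::euclidean_space \<Rightarrow>\<^sub>L real"
  assumes "V \<in> tangent_vectors S p" "\<And>P. P \<in> S \<Longrightarrow> blinfun_apply P A = k"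
  shows "blinfun_apply V A = 0"
proof -
  obtain q where q: "range q \<subseteq> S" "((\<lambda>t. blinfun_apply (q t) A) has_real_derivative blinfun_apply V A) (at 0)"
    using tangent_vector_curve[OF assms(1)] by metis
  then have "(\<lambda>t. blinfun_apply (q t) A) = (\<lambda>t. k)" using assms(2) by auto
  with q(2) have "((\<lambda>t::real. k) has_real_derivative blinfun_apply V A) (at 0)" by simp
  then show ?thesis using DERIV_unique DERIV_const by blast
qed

text \<open>
  The invariant of the generic orbits. With k = 1 and m = n = 0 it is x2 - x3 x4 / x5, as for the second
  algebra; when X and Y commute with X1, k is 0.
\<close>

definition casimir :: "nat \<Rightarrow> real \<Rightarrow> real \<Rightarrow> real \<Rightarrow> real \<Rightarrow> real \<Rightarrow> real \<Rightarrow> real" where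
  "casimir k m n x2 x3 x4 x5 = x4 ^ k * (x2 / x4 - x3 / x5) + m * ln \<bar>x4\<bar> + n * ln \<bar>x5\<bar>"

text \<open>
  The logarithm of the absolute value is half the logarithm of the square, which needs no case
  distinction on the sign.
\<close>

lemma ln_abs_derivative:
  assumes "(f has_real_derivative d) (at t)" "f t \<noteq> 0"
  shows "((\<lambda>t. ln \<bar>f t\<bar>) has_real_derivative d / f t) (at t)"
proof -
  have "((\<lambda>t. ln ((f t)\<^sup>2) / 2) has_real_derivative d / f t) (at t)"
    by (rule DERIV_cong[OF DERIV_cdivide[OF DERIV_chain2[OF DERIV_ln DERIV_power[OF assms(1)]]]])
      (use assms(2) in \<open>simp, simp add: power2_eq_square field_simps\<close>)
  moreover have "ln (y\<^sup>2) / 2 = ln \<bar>y\<bar>" for y :: real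
    using ln_realpow[of "\<bar>y\<bar>" 2] by (cases "y = 0") simp_all
  ultimately show ?thesis by simp
qed

lemma casimir_derivative:
  assumes "(f2 has_real_derivative d2) (at t)" "(f3 has_real_derivative d3) (at t)"
    "(f4 has_real_derivative d4) (at t)" "(f5 has_real_derivative d5) (at t)"
    "f4 t \<noteq> 0" "f5 t \<noteq> 0"
  shows "((\<lambda>t. casimir k m n (f2 t) (f3 t) (f4 t) (f5 t)) has_real_derivative
     (f4 t ^ k * ((d2 * f4 t - f2 t * d4) / (f4 t * f4 t) - (d3 * f5 t - f3 t * d5) / (f5 t * f5 t))
      + k * (d4 / f4 t) * f4 t ^ k * (f2 t / f4 t - f3 t / f5 t) + m * (d4 / f4 t) + n * (d5 / f5 t))) (at t)"
proof -
  have "((\<lambda>t. f4 t ^ k) has_real_derivative k * (d4 / f4 t) * f4 t ^ k) (at t)"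
    by (rule DERIV_cong[OF DERIV_power[OF assms(3)]]) (use assms(5) in \<open>cases k; simp\<close>)
  then have "((\<lambda>t. f4 t ^ k * (f2 t / f4 t - f3 t / f5 t)) has_real_derivative
     f4 t ^ k * ((d2 * f4 t - f2 t * d4) / (f4 t * f4 t) - (d3 * f5 t - f3 t * d5) / (f5 t * f5 t))
     + (k * (d4 / f4 t) * f4 t ^ k) * (f2 t / f4 t - f3 t / f5 t)) (at t)"
    using assms by (intro DERIV_mult' DERIV_diff DERIV_divide)
  moreover have "((\<lambda>t. m * ln \<bar>f4 t\<bar>) has_real_derivative m * (d4 / f4 t)) (at t)"
    "((\<lambda>t. n * ln \<bar>f5 t\<bar>) has_real_derivative n * (d5 / f5 t)) (at t)"
    using assms by (intro DERIV_cmult ln_abs_derivative; simp)+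
  ultimately show ?thesis
    unfolding casimir_def by (intro DERIV_add)
qed

section \<open>The common form of the seven-dimensional algebras\<close>

text \<open>
  X and Y scale X1 by eX and eY, and act on X2 and X3 by the weights a and b, with nilpotent parts
  q and p; their action on X4 = [X1, X2] and X5 = [X1, X3] is then forced by the Jacobi identity.
\<close>

locale seven_dim_group = lie_group_chart G U \<phi>
  for G :: "('g::{t2_space,second_countable_topology}, 'e::euclidean_space) lie_group" (structure)
    and U \<phi> +
  fixes X1 X2 X3 X4 X5 X Y :: 'e
    and eX aX bX qX pX eY aY bY qY pY :: real
  assumes conn: "connected (carrier G)"
    and alg: "seven_dim_algebra (lie_bracket G (U, \<phi>)) X1 X2 X3 X4 X5 X Y
      [eX *\<^sub>R X1, aX *\<^sub>R X2 + qX *\<^sub>R X4, bX *\<^sub>R X3 + pX *\<^sub>R X5, (eX + aX) *\<^sub>R X4, (eX + bX) *\<^sub>R X5]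
      [eY *\<^sub>R X1, aY *\<^sub>R X2 + qY *\<^sub>R X4, bY *\<^sub>R X3 + pY *\<^sub>R X5, (eY + aY) *\<^sub>R X4, (eY + bY) *\<^sub>R X5]"
begin

text \<open>
  The family is closed under the exchange of X2, X4 with X3, X5, which halves the number of cases.
\<close>

lemma swapped:
  "seven_dim_group G U \<phi> X1 X3 X2 X5 X4 X Y eX bX aX pX qX eY bY aY pY qY"
proof unfold_locales
  have "br X3 X2 = 0" "br X5 X4 = 0"
    using alg bracket_antisym[of X3 X2] bracket_antisym[of X5 X4] by (simp_all add: seven_dim_algebra_def)
  then show "seven_dim_algebra br X1 X3 X2 X5 X4 X Y
      [eX *\<^sub>R X1, bX *\<^sub>R X3 + pX *\<^sub>R X5, aX *\<^sub>R X2 + qX *\<^sub>R X4, (eX + bX) *\<^sub>R X5, (eX + aX) *\<^sub>R X4]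
      [eY *\<^sub>R X1, bY *\<^sub>R X3 + pY *\<^sub>R X5, aY *\<^sub>R X2 + qY *\<^sub>R X4, (eY + bY) *\<^sub>R X5, (eY + aY) *\<^sub>R X4]"
    using alg by (auto simp: seven_dim_algebra_def insert_commute)
qed (rule conn)

lemma basis: "independent {X1, X2, X3, X4, X5, X, Y}" "span {X1, X2, X3, X4, X5, X, Y} = UNIV"
  "distinct [X1, X2, X3, X4, X5, X, Y]"
  using alg by (simp_all add: seven_dim_algebra_def)

lemma functional_exists:
  "\<exists>P :: 'e \<Rightarrow>\<^sub>L real. P X1 = t1 \<and> P X2 = t2 \<and> P X3 = t3 \<and> P X4 = t4 \<and> P X5 = t5 \<and> P X = t6 \<and> P Y = t7"
proof -
  define f where "f Z = (if Z = X1 then t1 else if Z = X2 then t2 else if Z = X3 then t3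
    else if Z = X4 then t4 else if Z = X5 then t5 else if Z = X then t6 else t7)" for Z
  obtain g :: "'e \<Rightarrow> real" where g: "linear g" "\<And>Z. Z \<in> {X1, X2, X3, X4, X5, X, Y} \<Longrightarrow> g Z = f Z"
    using linear_independent_extend[OF basis(1), of f] by blast
  have "bounded_linear g" using g(1) by (simp add: linear_conv_bounded_linear)
  then have "blinfun_apply (Blinfun g) = g" by (rule bounded_linear_Blinfun_apply)
  moreover have "f X1 = t1" "f X2 = t2" "f X3 = t3" "f X4 = t4" "f X5 = t5" "f X = t6" "f Y = t7"
    using basis(3) by (auto simp: f_def)
  moreover have "g X1 = f X1" "g X2 = f X2" "g X3 = f X3" "g X4 = f X4" "g X5 = f X5" "g X = f X" "g Y = f Y"
    by (rule g(2), blast)+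
  ultimately show ?thesis by (intro exI[of _ "Blinfun g"]) simp
qed

definition comb :: "real \<Rightarrow> real \<Rightarrow> real \<Rightarrow> real \<Rightarrow> real \<Rightarrow> real \<Rightarrow> real \<Rightarrow> 'e" where
  "comb v1 v2 v3 v4 v5 v6 v7 = v1 *\<^sub>R X1 + v2 *\<^sub>R X2 + v3 *\<^sub>R X3 + v4 *\<^sub>R X4 + v5 *\<^sub>R X5 + v6 *\<^sub>R X + v7 *\<^sub>R Y"

lemma blinfun_determined:
  fixes P Q :: "'e \<Rightarrow>\<^sub>L real"
  assumes "P X1 = Q X1" "P X2 = Q X2" "P X3 = Q X3" "P X4 = Q X4" "P X5 = Q X5" "P X = Q X" "P Y = Q Y"
  shows "P = Q"
proof (rule blinfun_eqI)
  fix Z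
  have lin: "linear (blinfun_apply K)" for K :: "'e \<Rightarrow>\<^sub>L real"
    by (rule bounded_linear.linear[OF blinfun.bounded_linear_right])
  show "P Z = Q Z"
    by (rule linear_eq_on_span[OF lin lin, where B = "{X1, X2, X3, X4, X5, X, Y}"])
      (use assms basis(2) in auto)
qed

lemma brackets:
  "br X1 X2 = X4" "br X1 X3 = X5" "br X1 X4 = 0" "br X1 X5 = 0"
  "br X2 X3 = 0" "br X2 X4 = 0" "br X2 X5 = 0" "br X3 X4 = 0" "br X3 X5 = 0" "br X4 X5 = 0" "br X Y = 0"
  "br X X1 = eX *\<^sub>R X1" "br X X2 = aX *\<^sub>R X2 + qX *\<^sub>R X4" "br X X3 = bX *\<^sub>R X3 + pX *\<^sub>R X5"
  "br X X4 = (eX + aX) *\<^sub>R X4" "br X X5 = (eX + bX) *\<^sub>R X5"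
  "br Y X1 = eY *\<^sub>R X1" "br Y X2 = aY *\<^sub>R X2 + qY *\<^sub>R X4" "br Y X3 = bY *\<^sub>R X3 + pY *\<^sub>R X5"
  "br Y X4 = (eY + aY) *\<^sub>R X4" "br Y X5 = (eY + bY) *\<^sub>R X5"
  using alg by (simp_all add: seven_dim_algebra_def)

lemma brackets_reversed:
  "br X2 X1 = - X4" "br X3 X1 = - X5" "br X4 X1 = 0" "br X5 X1 = 0"
  "br X3 X2 = 0" "br X4 X2 = 0" "br X5 X2 = 0" "br X4 X3 = 0" "br X5 X3 = 0" "br X5 X4 = 0" "br Y X = 0"
  "br X1 X = - (eX *\<^sub>R X1)" "br X2 X = - (aX *\<^sub>R X2 + qX *\<^sub>R X4)" "br X3 X = - (bX *\<^sub>R X3 + pX *\<^sub>R X5)"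
  "br X4 X = - ((eX + aX) *\<^sub>R X4)" "br X5 X = - ((eX + bX) *\<^sub>R X5)"
  "br X1 Y = - (eY *\<^sub>R X1)" "br X2 Y = - (aY *\<^sub>R X2 + qY *\<^sub>R X4)" "br X3 Y = - (bY *\<^sub>R X3 + pY *\<^sub>R X5)"
  "br X4 Y = - ((eY + aY) *\<^sub>R X4)" "br X5 Y = - ((eY + bY) *\<^sub>R X5)"
  by (subst bracket_antisym, simp add: brackets)+

lemma bracket_self: "br v v = 0"
  by (simp add: lie_bracket_def field_commutator_def)

text \<open>
  The coordinates of P o ad(v), that is the right-hand sides of the differential equations.
\<close>

lemma coadjoint_field:
  fixes P :: "'e \<Rightarrow>\<^sub>L real"
  shows
    "P (br (comb v1 v2 v3 v4 v5 v6 v7) X1) = - v2 * P X4 - v3 * P X5 + (v6 * eX + v7 * eY) * P X1"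
    "P (br (comb v1 v2 v3 v4 v5 v6 v7) X2) = v1 * P X4 + (v6 * aX + v7 * aY) * P X2 + (v6 * qX + v7 * qY) * P X4"
    "P (br (comb v1 v2 v3 v4 v5 v6 v7) X3) = v1 * P X5 + (v6 * bX + v7 * bY) * P X3 + (v6 * pX + v7 * pY) * P X5"
    "P (br (comb v1 v2 v3 v4 v5 v6 v7) X4) = (v6 * (eX + aX) + v7 * (eY + aY)) * P X4"
    "P (br (comb v1 v2 v3 v4 v5 v6 v7) X5) = (v6 * (eX + bX) + v7 * (eY + bY)) * P X5"
    "P (br (comb v1 v2 v3 v4 v5 v6 v7) X) = - (v1 * eX * P X1 + v2 * (aX * P X2 + qX * P X4)
       + v3 * (bX * P X3 + pX * P X5) + v4 * (eX + aX) * P X4 + v5 * (eX + bX) * P X5)"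
    "P (br (comb v1 v2 v3 v4 v5 v6 v7) Y) = - (v1 * eY * P X1 + v2 * (aY * P X2 + qY * P X4)
       + v3 * (bY * P X3 + pY * P X5) + v4 * (eY + aY) * P X4 + v5 * (eY + bY) * P X5)"
proof -
  have lin: "br (comb v1 v2 v3 v4 v5 v6 v7) W = v1 *\<^sub>R br X1 W + v2 *\<^sub>R br X2 W + v3 *\<^sub>R br X3 W
      + v4 *\<^sub>R br X4 W + v5 *\<^sub>R br X5 W + v6 *\<^sub>R br X W + v7 *\<^sub>R br Y W" for W
    unfolding comb_def
    by (simp only: linear_add[OF bracket_linear_left] linear_scale[OF bracket_linear_left])
  note [simp] = brackets brackets_reversed bracket_self blinfun.add_right blinfun.scaleR_right
    blinfun.minus_right blinfun.diff_right
  show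
    "P (br (comb v1 v2 v3 v4 v5 v6 v7) X1) = - v2 * P X4 - v3 * P X5 + (v6 * eX + v7 * eY) * P X1"
    "P (br (comb v1 v2 v3 v4 v5 v6 v7) X2) = v1 * P X4 + (v6 * aX + v7 * aY) * P X2 + (v6 * qX + v7 * qY) * P X4"
    "P (br (comb v1 v2 v3 v4 v5 v6 v7) X3) = v1 * P X5 + (v6 * bX + v7 * bY) * P X3 + (v6 * pX + v7 * pY) * P X5"
    "P (br (comb v1 v2 v3 v4 v5 v6 v7) X4) = (v6 * (eX + aX) + v7 * (eY + aY)) * P X4"
    "P (br (comb v1 v2 v3 v4 v5 v6 v7) X5) = (v6 * (eX + bX) + v7 * (eY + bY)) * P X5"
    "P (br (comb v1 v2 v3 v4 v5 v6 v7) X) = - (v1 * eX * P X1 + v2 * (aX * P X2 + qX * P X4)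
       + v3 * (bX * P X3 + pX * P X5) + v4 * (eX + aX) * P X4 + v5 * (eX + bX) * P X5)"
    "P (br (comb v1 v2 v3 v4 v5 v6 v7) Y) = - (v1 * eY * P X1 + v2 * (aY * P X2 + qY * P X4)
       + v3 * (bY * P X3 + pY * P X5) + v4 * (eY + aY) * P X4 + v5 * (eY + bY) * P X5)"
    unfolding lin by (simp_all add: algebra_simps)
qed

text \<open>
  Only the coordinates along X1, X and Y enter the equations for x2, ..., x5.
\<close>

lemma continuous_coordinates:
  assumes "continuous_on S \<xi>"
  obtains v1 v2 v3 v4 v5 v6 v7 :: "real \<Rightarrow> real" where
    "continuous_on S v1" "continuous_on S v6" "continuous_on S v7"
    "\<And>t. \<xi> t = comb (v1 t) (v2 t) (v3 t) (v4 t) (v5 t) (v6 t) (v7 t)"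
proof -
  obtain K1 K2 K3 K4 K5 K6 K7 :: "'e \<Rightarrow>\<^sub>L real" where
    K1: "K1 X1 = 1" "K1 X2 = 0" "K1 X3 = 0" "K1 X4 = 0" "K1 X5 = 0" "K1 X = 0" "K1 Y = 0" and
    K2: "K2 X1 = 0" "K2 X2 = 1" "K2 X3 = 0" "K2 X4 = 0" "K2 X5 = 0" "K2 X = 0" "K2 Y = 0" and
    K3: "K3 X1 = 0" "K3 X2 = 0" "K3 X3 = 1" "K3 X4 = 0" "K3 X5 = 0" "K3 X = 0" "K3 Y = 0" and
    K4: "K4 X1 = 0" "K4 X2 = 0" "K4 X3 = 0" "K4 X4 = 1" "K4 X5 = 0" "K4 X = 0" "K4 Y = 0" and
    K5: "K5 X1 = 0" "K5 X2 = 0" "K5 X3 = 0" "K5 X4 = 0" "K5 X5 = 1" "K5 X = 0" "K5 Y = 0" and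
    K6: "K6 X1 = 0" "K6 X2 = 0" "K6 X3 = 0" "K6 X4 = 0" "K6 X5 = 0" "K6 X = 1" "K6 Y = 0" and
    K7: "K7 X1 = 0" "K7 X2 = 0" "K7 X3 = 0" "K7 X4 = 0" "K7 X5 = 0" "K7 X = 0" "K7 Y = 1"
    using functional_exists by metis
  have "Z = comb (K1 Z) (K2 Z) (K3 Z) (K4 Z) (K5 Z) (K6 Z) (K7 Z)" for Z
  proof -
    have lin: "linear (\<lambda>Z. comb (K1 Z) (K2 Z) (K3 Z) (K4 Z) (K5 Z) (K6 Z) (K7 Z))"
      by (rule linearI)
        (simp_all add: comb_def blinfun.add_right blinfun.scaleR_right algebra_simps)
    show ?thesis
      by (rule linear_eq_on_span[OF linear_ident lin, where B = "{X1, X2, X3, X4, X5, X, Y}"])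
        (use basis(2) in \<open>auto simp: comb_def K1 K2 K3 K4 K5 K6 K7\<close>)
  qed
  moreover have "continuous_on S (\<lambda>t. blinfun_apply K (\<xi> t))" for K
    by (rule bounded_linear.continuous_on[OF blinfun.bounded_linear_right assms])
  ultimately show thesis using that[of "\<lambda>t. K1 (\<xi> t)" "\<lambda>t. K6 (\<xi> t)" "\<lambda>t. K7 (\<xi> t)"
      "\<lambda>t. K2 (\<xi> t)" "\<lambda>t. K3 (\<xi> t)" "\<lambda>t. K4 (\<xi> t)" "\<lambda>t. K5 (\<xi> t)"] by blast
qed

text \<open>
  The coordinates x2, ..., x5 satisfy a closed system of equations; conditions on them alone are
  preserved by the orbit as soon as this system preserves them.
\<close>

lemma orbit_subset_invariant:
  fixes F :: "'e \<Rightarrow>\<^sub>L real"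
  assumes flow: "\<And>x2 x3 x4 x5 v1 v6 v7 :: real \<Rightarrow> real.
      continuous_on {0..1} v1 \<Longrightarrow> continuous_on {0..1} v6 \<Longrightarrow> continuous_on {0..1} v7 \<Longrightarrow>
      (\<And>t. t \<in> {0..1} \<Longrightarrow> (x2 has_real_derivative
        v1 t * x4 t + (v6 t * aX + v7 t * aY) * x2 t + (v6 t * qX + v7 t * qY) * x4 t) (at t)) \<Longrightarrow>
      (\<And>t. t \<in> {0..1} \<Longrightarrow> (x3 has_real_derivative
        v1 t * x5 t + (v6 t * bX + v7 t * bY) * x3 t + (v6 t * pX + v7 t * pY) * x5 t) (at t)) \<Longrightarrow>
      (\<And>t. t \<in> {0..1} \<Longrightarrow> (x4 has_real_derivative (v6 t * (eX + aX) + v7 t * (eY + aY)) * x4 t) (at t)) \<Longrightarrow>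
      (\<And>t. t \<in> {0..1} \<Longrightarrow> (x5 has_real_derivative (v6 t * (eX + bX) + v7 t * (eY + bY)) * x5 t) (at t)) \<Longrightarrow>
      R (x2 0) (x3 0) (x4 0) (x5 0) \<Longrightarrow> R (x2 1) (x3 1) (x4 1) (x5 1)"
    and F: "R (F X2) (F X3) (F X4) (F X5)" and P: "P \<in> orbit F"
  shows "R (P X2) (P X3) (P X4) (P X5)"
proof -
  let ?S = "{P :: 'e \<Rightarrow>\<^sub>L real. R (P X2) (P X3) (P X4) (P X5)}"
  have "orbit F \<subseteq> ?S"
  proof (rule orbit_subset_flow_invariant[OF conn])
    fix P :: "real \<Rightarrow> 'e \<Rightarrow>\<^sub>L real" and \<xi> :: "real \<Rightarrow> 'e"
    assume \<xi>: "continuous_on {0..1} \<xi>"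
      and d: "\<And>Z t. t \<in> {0..1} \<Longrightarrow> ((\<lambda>t. blinfun_apply (P t) Z) has_real_derivative P t (br (\<xi> t) Z)) (at t)"
      and P0: "P 0 \<in> ?S"
    obtain v1 v2 v3 v4 v5 v6 v7 :: "real \<Rightarrow> real" where v:
      "continuous_on {0..1} v1" "continuous_on {0..1} v6" "continuous_on {0..1} v7"
      "\<And>t. \<xi> t = comb (v1 t) (v2 t) (v3 t) (v4 t) (v5 t) (v6 t) (v7 t)"
      using continuous_coordinates[OF \<xi>] by metis
    show "P 1 \<in> ?S"
      using flow[of v1 v6 v7 "\<lambda>t. P t X2" "\<lambda>t. P t X4" "\<lambda>t. P t X3" "\<lambda>t. P t X5"] v(1-3) P0
        d[of _ X2, unfolded v(4) coadjoint_field] d[of _ X3, unfolded v(4) coadjoint_field]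
        d[of _ X4, unfolded v(4) coadjoint_field] d[of _ X5, unfolded v(4) coadjoint_field]
      by simp
  qed (use F in simp)
  with P show ?thesis by blast
qed

end

section \<open>Orbits of the family\<close>

context lie_group_chart begin

text \<open>
  The equations \<Lambda> of the tangent space bound the dimension from above; the velocities of the action,
  which are tangent, from below.
\<close>

lemma orbit_dim_bounds:
  fixes \<pi> :: "('e \<Rightarrow>\<^sub>L real) \<Rightarrow> 'v::euclidean_space" and \<Lambda> :: "('e \<Rightarrow>\<^sub>L real) \<Rightarrow> 'w::real_normed_vector"
  assumes \<pi>: "bounded_linear \<pi>" and \<Lambda>: "bounded_linear \<Lambda>"
    and ker: "\<And>V. V \<in> tangent_vectors (orbit F) F \<Longrightarrow> \<Lambda> V = 0"
    and inj: "\<And>V. \<Lambda> V = 0 \<Longrightarrow> \<pi> V = 0 \<Longrightarrow> V = 0"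
  shows "orbit_dim G c F \<le> DIM('v)"
    and "(\<And>y. \<exists>v. \<pi> (ad_star F v) = y) \<Longrightarrow> orbit_dim G c F = DIM('v)"
proof -
  have lin: "linear \<pi>" "linear \<Lambda>" using \<pi> \<Lambda> by (simp_all add: bounded_linear.linear)
  have W: "subspace {V. \<Lambda> V = 0}"
    by (rule linear_subspace_kernel[OF lin(2)])
  have T: "tangent_vectors (orbit F) F \<subseteq> {V. \<Lambda> V = 0}" using ker by auto
  note d = dim_le_by_injection[OF lin(1) W T]
  show "orbit_dim G c F \<le> DIM('v)" unfolding orbit_dim_def by (rule d(1)) (use inj in auto)
  assume surj: "\<And>y. \<exists>v. \<pi> (ad_star F v) = y"
  have "UNIV \<subseteq> \<pi> ` tangent_vectors (orbit F) F"
  proof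
    fix y
    obtain v where "\<pi> (ad_star F v) = y" using surj by blast
    then show "y \<in> \<pi> ` tangent_vectors (orbit F) F" using ad_star_tangent by blast
  qed
  then show "orbit_dim G c F = DIM('v)" unfolding orbit_dim_def by (intro d(2)) (use inj in auto)
qed

end

lemma zero_derivative_endpoints:
  assumes "\<And>t. t \<in> {0..1} \<Longrightarrow> (f has_real_derivative 0) (at t)"
  shows "f 1 = f (0 :: real)"
proof -
  obtain k where "\<And>t. t \<in> {0..1} \<Longrightarrow> f t = k"
    using has_field_derivative_zero_constant[of "{0..1}" f] DERIV_subset[OF assms subset_UNIV]
    by (metis convex_real_interval(5))
  then show ?thesis by simp
qed

lemma sign_scale: "E > 0 \<Longrightarrow> s * (E * x) > 0 \<longleftrightarrow> s * x > (0 :: real)"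
  by (simp add: mult.left_commute[of s] zero_less_mult_iff[of E])

lemma linear_ode_scales:
  fixes f v w :: "real \<Rightarrow> real"
  assumes "continuous_on {0..1} v" "continuous_on {0..1} w"
    and "\<And>t. t \<in> {0..1} \<Longrightarrow> (f has_real_derivative (v t * A + w t * B) * f t) (at t)"
  obtains E where "\<And>t. t \<in> {0..1} \<Longrightarrow> E t > 0 \<and> f t = E t * f 0"
proof -
  have "continuous_on {0..1} (\<lambda>t. v t * A + w t * B)"
    using assms(1,2) by (intro continuous_intros)
  from linear_ode_solution[OF this assms(3)] that show thesis by blast
qed

context seven_dim_group begin

definition generic_set :: "nat \<Rightarrow> real \<Rightarrow> real \<Rightarrow> real \<Rightarrow> real \<Rightarrow> real \<Rightarrow> ('e \<Rightarrow>\<^sub>L real) set" where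
  "generic_set k m n s4 s5 C = {P :: 'e \<Rightarrow>\<^sub>L real. casimir k m n (P X2) (P X3) (P X4) (P X5) = C \<and> s4 * P X4 > 0 \<and> s5 * P X5 > 0}"

definition hyperplane_set :: "real \<Rightarrow> real \<Rightarrow> ('e \<Rightarrow>\<^sub>L real) set" where
  "hyperplane_set s3 s4 = {P :: 'e \<Rightarrow>\<^sub>L real. P X5 = 0 \<and> s3 * P X3 > 0 \<and> s4 * P X4 > 0}"

text \<open>
  These equations say that the derivative of casimir along the coadjoint action of X and of Y
  vanishes: the exponent k compensates the scaling of W by the weights of X1, the other terms its shift by p and q.
\<close>

definition casimir_exponents :: "nat \<Rightarrow> real \<Rightarrow> real \<Rightarrow> bool" where
  "casimir_exponents k m n \<longleftrightarrow> k * (eX + aX) = eX \<and> k * (eY + aY) = eY \<and>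
    (\<forall>z::real. z ^ k * (qX - pX) + m * (eX + aX) + n * (eX + bX) = 0 \<and>
       z ^ k * (qY - pY) + m * (eY + aY) + n * (eY + bY) = 0)"

text \<open>
  The signs of x4 and x5 are preserved since they solve scalar linear equations. The derivative of
  W = x2/x4 - x3/x5 is (q - p) - e W, which is compensated by the derivatives of the other
  terms of casimir.
\<close>

lemma generic_set_invariant:
  fixes F :: "'e \<Rightarrow>\<^sub>L real"
  assumes inv: "casimir_exponents k m n" and F: "F \<in> generic_set k m n s4 s5 C"
  shows "orbit F \<subseteq> generic_set k m n s4 s5 C"
proof
  fix P assume P: "P \<in> orbit F"
  let ?R = "\<lambda>x2 x3 x4 x5. casimir k m n x2 x3 x4 x5 = C \<and> s4 * x4 > 0 \<and> s5 * x5 > 0"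
  have "?R (P X2) (P X3) (P X4) (P X5)"
  proof (rule orbit_subset_invariant[where R = ?R, OF _ _ P])
    show "?R (F X2) (F X3) (F X4) (F X5)" using F by (simp add: generic_set_def)
    fix x2 x3 x4 x5 v1 v6 v7 :: "real \<Rightarrow> real"
    assume v: "continuous_on {0..1} v1" "continuous_on {0..1} v6" "continuous_on {0..1} v7"
    let ?r4 = "\<lambda>t. v6 t * (eX + aX) + v7 t * (eY + aY)" and ?r5 = "\<lambda>t. v6 t * (eX + bX) + v7 t * (eY + bY)"
    assume d2: "\<And>t. t \<in> {0..1} \<Longrightarrow> (x2 has_real_derivative
        v1 t * x4 t + (v6 t * aX + v7 t * aY) * x2 t + (v6 t * qX + v7 t * qY) * x4 t) (at t)"
      and d3: "\<And>t. t \<in> {0..1} \<Longrightarrow> (x3 has_real_derivative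
        v1 t * x5 t + (v6 t * bX + v7 t * bY) * x3 t + (v6 t * pX + v7 t * pY) * x5 t) (at t)"
      and d4: "\<And>t. t \<in> {0..1} \<Longrightarrow> (x4 has_real_derivative ?r4 t * x4 t) (at t)"
      and d5: "\<And>t. t \<in> {0..1} \<Longrightarrow> (x5 has_real_derivative ?r5 t * x5 t) (at t)"
      and R0: "?R (x2 0) (x3 0) (x4 0) (x5 0)"
    obtain E4 where E4: "\<And>t. t \<in> {0..1} \<Longrightarrow> E4 t > 0 \<and> x4 t = E4 t * x4 0"
      using linear_ode_scales[OF v(2,3) d4] by blast
    obtain E5 where E5: "\<And>t. t \<in> {0..1} \<Longrightarrow> E5 t > 0 \<and> x5 t = E5 t * x5 0"
      using linear_ode_scales[OF v(2,3) d5] by blast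
    have "casimir k m n (x2 1) (x3 1) (x4 1) (x5 1) = casimir k m n (x2 0) (x3 0) (x4 0) (x5 0)"
    proof (rule zero_derivative_endpoints[where f = "\<lambda>t. casimir k m n (x2 t) (x3 t) (x4 t) (x5 t)"])
      fix t :: real assume t: "t \<in> {0..1}"
      have ne: "x4 t \<noteq> 0" "x5 t \<noteq> 0" using E4[OF t] E5[OF t] R0 by auto
      let ?e = "v6 t * eX + v7 t * eY"
      let ?W = "x2 t / x4 t - x3 t / x5 t"
      \<comment> \<open>the derivatives of x2/x4 and x3/x5, with z the denominator and E + A its rate\<close>
      have quot: "((w * z + A * x + Q * z) * z - x * ((E + A) * z)) / (z * z) = w + Q - E * (x / z)"
        if "z \<noteq> 0" for w z A x Q E :: real
        using that by (simp add: field_simps)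
      have r: "?r4 t = ?e + (v6 t * aX + v7 t * aY)" "?r5 t = ?e + (v6 t * bX + v7 t * bY)"
        by (simp_all add: algebra_simps)
      have k: "k * ?r4 t = ?e"
      proof -
        have "k * ?r4 t = v6 t * (k * (eX + aX)) + v7 t * (k * (eY + aY))" by (simp add: algebra_simps)
        then show ?thesis using inv by (simp only: casimir_exponents_def)
      qed
      have "x4 t ^ k * (((v1 t * x4 t + (v6 t * aX + v7 t * aY) * x2 t + (v6 t * qX + v7 t * qY) * x4 t) * x4 t
          - x2 t * (?r4 t * x4 t)) / (x4 t * x4 t)
          - ((v1 t * x5 t + (v6 t * bX + v7 t * bY) * x3 t + (v6 t * pX + v7 t * pY) * x5 t) * x5 t
          - x3 t * (?r5 t * x5 t)) / (x5 t * x5 t))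
        + k * (?r4 t * x4 t / x4 t) * x4 t ^ k * ?W + m * (?r4 t * x4 t / x4 t) + n * (?r5 t * x5 t / x5 t)
        = x4 t ^ k * ((v6 t * qX + v7 t * qY) - (v6 t * pX + v7 t * pY) - ?e * ?W)
          + (k * ?r4 t) * x4 t ^ k * ?W + m * ?r4 t + n * ?r5 t"
      proof -
        have c: "r * z / z = r" if "z \<noteq> 0" for r z :: real using that by simp
        have d: "w + Q - E * x - (w + P - E * y) = Q - P - E * (x - y)" for w Q E P x y :: real
          by (simp add: algebra_simps)
        show ?thesis unfolding r quot[OF ne(1)] quot[OF ne(2)] c[OF ne(1)] c[OF ne(2)] d ..
      qed
      also have "\<dots> = v6 t * (x4 t ^ k * (qX - pX) + m * (eX + aX) + n * (eX + bX))
          + v7 t * (x4 t ^ k * (qY - pY) + m * (eY + aY) + n * (eY + bY))"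
        unfolding k by (simp add: algebra_simps)
      also have "\<dots> = 0" using inv by (simp add: casimir_exponents_def)
      finally show "((\<lambda>t. casimir k m n (x2 t) (x3 t) (x4 t) (x5 t)) has_real_derivative 0) (at t)"
        using casimir_derivative[OF d2[OF t] d3[OF t] d4[OF t] d5[OF t] ne, of k m n] by simp
    qed
    with E4[of 1] E5[of 1] R0 show "?R (x2 1) (x3 1) (x4 1) (x5 1)"
      by (simp add: sign_scale)
  qed
  then show "P \<in> generic_set k m n s4 s5 C" by (simp add: generic_set_def)
qed

lemma connected_halfline: "connected {x::real. s * x > 0}"
proof -
  have "convex {x::real. s * x > 0}"
    using convex_halfspace_gt[of 0 s] by (simp add: inner_real_def)
  then show ?thesis by (rule convex_connected)
qed

text \<open>
  On the level set x2 is a function of the other coordinates, so these embed it in R^6, onto a product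
  of lines and half-lines. Under the velocities X and Y move x4 and x5 independently (this is the
  determinant condition), X1 moves x3, X2 moves x1, and X4, X5 move x and y.
\<close>

lemma generic_orbit:
  fixes F :: "'e \<Rightarrow>\<^sub>L real"
  assumes inv: "casimir_exponents k m n" and F: "F X4 \<noteq> 0" "F X5 \<noteq> 0"
    and det: "(eX + aX) * (eY + bY) - (eX + bX) * (eY + aY) \<noteq> 0"
  shows "orbit F = generic_set k m n (F X4) (F X5) (casimir k m n (F X2) (F X3) (F X4) (F X5))"
    and "orbit_dim G c F = 6"
proof -
  let ?C = "casimir k m n (F X2) (F X3) (F X4) (F X5)"
  let ?S = "generic_set k m n (F X4) (F X5) ?C"
  let ?\<pi> = "\<lambda>P :: 'e \<Rightarrow>\<^sub>L real. (P X1, P X3, P X4, P X5, P X, P Y)"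
  have \<pi>: "bounded_linear ?\<pi>" by (intro bounded_linear_Pair blinfun.bounded_linear_left)
  have FS: "F \<in> ?S" using F by (auto simp: generic_set_def zero_less_mult_iff)
  have surj: "\<exists>v. ?\<pi> (ad_star P v) = y" if P: "P X4 \<noteq> 0" "P X5 \<noteq> 0" for P :: "'e \<Rightarrow>\<^sub>L real" and y
  proof -
    obtain y1 y3 y4 y5 y6 y7 where y: "y = (y1, y3, y4, y5, y6, y7)" by (metis prod_cases6)
    obtain v6 v7 where 67: "v6 * (eX + aX) + v7 * (eY + aY) = y4 / P X4"
      "v6 * (eX + bX) + v7 * (eY + bY) = y5 / P X5"
      using linear_system_2x2[of "eX + aX" "eY + bY" "eY + aY" "eX + bX"] det
      by (metis mult.commute)
    \<comment> \<open>the coefficients of X and Y being fixed, X1 corrects x3 and X2 corrects x1\<close>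
    define v1 where "v1 = (y3 - (v6 * bX + v7 * bY) * P X3 - (v6 * pX + v7 * pY) * P X5) / P X5"
    define v2 where "v2 = ((v6 * eX + v7 * eY) * P X1 - y1) / P X4"
    obtain s t where st: "s * (eX + aX) + t * (eX + bX) = - y6 - v1 * eX * P X1 - v2 * (aX * P X2 + qX * P X4)"
      "s * (eY + aY) + t * (eY + bY) = - y7 - v1 * eY * P X1 - v2 * (aY * P X2 + qY * P X4)"
      using linear_system_2x2[OF det] by metis
    have "?\<pi> (ad_star P (comb v1 v2 0 (s / P X4) (t / P X5) v6 v7)) = y"
      unfolding ad_star_apply coadjoint_field y using 67 st P
      by (simp add: v1_def v2_def mult.commute[of s] mult.commute[of t])
    then show ?thesis by blast
  qed
  have x2: "x2 = x2'" if "casimir k m n x2 x3 x4 x5 = casimir k m n x2' x3 x4 x5" "x4 \<noteq> 0"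
    for x2 x2' x3 x4 x5 using that by (simp add: casimir_def)
  have inj: "inj_on ?\<pi> ?S"
  proof (rule inj_onI)
    fix P Q assume PQ: "P \<in> ?S" "Q \<in> ?S" "?\<pi> P = ?\<pi> Q"
    from PQ(1) have "P X4 \<noteq> 0" by (auto simp: generic_set_def)
    with PQ have "P X2 = Q X2" by (intro x2[of "P X2" "P X3" "P X4" "P X5" "Q X2"]) (auto simp: generic_set_def)
    with PQ show "P = Q" by (intro blinfun_determined) auto
  qed
  have "?\<pi> ` ?S = UNIV \<times> UNIV \<times> {x. F X4 * x > 0} \<times> {x. F X5 * x > 0} \<times> UNIV \<times> UNIV"
  proof (intro equalityI subsetI)
    fix y :: "real \<times> real \<times> real \<times> real \<times> real \<times> real"
    assume "y \<in> UNIV \<times> UNIV \<times> {x. F X4 * x > 0} \<times> {x. F X5 * x > 0} \<times> UNIV \<times> UNIV"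
    then obtain y1 y3 y4 y5 y6 y7 where y: "y = (y1, y3, y4, y5, y6, y7)" "F X4 * y4 > 0" "F X5 * y5 > 0"
      by auto
    \<comment> \<open>the equation of the level set, solved for x2\<close>
    define y2 where "y2 = y4 * ((?C - m * ln \<bar>y4\<bar> - n * ln \<bar>y5\<bar>) / y4 ^ k + y3 / y5)"
    obtain P :: "'e \<Rightarrow>\<^sub>L real" where P: "P X1 = y1" "P X2 = y2" "P X3 = y3" "P X4 = y4" "P X5 = y5" "P X = y6" "P Y = y7"
      using functional_exists by metis
    have "y4 \<noteq> 0" using y(2) by auto
    then have "casimir k m n y2 y3 y4 y5 = ?C" by (simp add: casimir_def y2_def)
    with P y have "P \<in> ?S" "?\<pi> P = y" by (simp_all add: generic_set_def)
    then show "y \<in> ?\<pi> ` ?S" by blast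
  qed (auto simp: generic_set_def)
  then have conn': "connected (?\<pi> ` ?S)"
    by (simp add: connected_Times connected_halfline connected_UNIV)
  show "orbit F = ?S"
    by (rule orbit_eq_if_locally_transitive[OF \<pi> inj conn' generic_set_invariant[OF inv] surj FS])
      (auto simp: generic_set_def)
  \<comment> \<open>the partial derivatives of casimir at F; c2 does not vanish, so the tangent space is a graph\<close>
  define c2 where "c2 = F X4 ^ k / F X4"
  define c3 where "c3 = - (F X4 ^ k / F X5)"
  define c4 where "c4 = - (F X4 ^ k * F X2 / (F X4 * F X4)) + real k * (1 / F X4) * F X4 ^ k * (F X2 / F X4 - F X3 / F X5) + m / F X4"
  define c5 where "c5 = F X4 ^ k * F X3 / (F X5 * F X5) + n / F X5"
  let ?\<Lambda> = "\<lambda>V :: 'e \<Rightarrow>\<^sub>L real. V X2 * c2 + V X3 * c3 + V X4 * c4 + V X5 * c5"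
  have "orbit_dim G c F = DIM(real \<times> real \<times> real \<times> real \<times> real \<times> real)"
  proof (rule orbit_dim_bounds(2)[OF \<pi>, where \<Lambda> = ?\<Lambda>])
    show "bounded_linear ?\<Lambda>"
      by (intro bounded_linear_add bounded_linear_mult_const blinfun.bounded_linear_left)
    show "\<exists>v. ?\<pi> (ad_star F v) = y" for y using F by (rule surj)
    show "V = 0" if "?\<Lambda> V = 0" "?\<pi> V = 0" for V :: "'e \<Rightarrow>\<^sub>L real"
      using that F by (intro blinfun_determined) (auto simp: c2_def zero_prod_def)
    fix V :: "'e \<Rightarrow>\<^sub>L real" assume "V \<in> tangent_vectors (orbit F) F"
    then obtain q :: "real \<Rightarrow> ('e \<Rightarrow>\<^sub>L real)" where q: "range q \<subseteq> orbit F" "q 0 = F"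
      "\<And>Z. ((\<lambda>t. blinfun_apply (q t) Z) has_real_derivative blinfun_apply V Z) (at 0)"
      using tangent_vector_curve by metis
    have "(\<lambda>t. casimir k m n (q t X2) (q t X3) (q t X4) (q t X5)) = (\<lambda>t. ?C)"
      using q(1) generic_set_invariant[OF inv FS] by (auto simp: generic_set_def)
    with casimir_derivative[OF q(3) q(3) q(3) q(3), of X4 X5 k m n X2 X3] q(2) F
    have "((\<lambda>t::real. ?C) has_real_derivative
       (F X4 ^ k * ((V X2 * F X4 - F X2 * V X4) / (F X4 * F X4) - (V X3 * F X5 - F X3 * V X5) / (F X5 * F X5))
      + real k * (V X4 / F X4) * F X4 ^ k * (F X2 / F X4 - F X3 / F X5) + m * (V X4 / F X4) + n * (V X5 / F X5))) (at 0)"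
      by simp
    then have "F X4 ^ k * ((V X2 * F X4 - F X2 * V X4) / (F X4 * F X4) - (V X3 * F X5 - F X3 * V X5) / (F X5 * F X5))
      + real k * (V X4 / F X4) * F X4 ^ k * (F X2 / F X4 - F X3 / F X5) + m * (V X4 / F X4) + n * (V X5 / F X5) = 0"
      by (rule DERIV_unique) (rule DERIV_const)
    moreover have "K * ((v2 * x4 - x2 * v4) / (x4 * x4) - (v3 * x5 - x3 * v5) / (x5 * x5))
        + r * (v4 / x4) * K * W + m * (v4 / x4) + n * (v5 / x5)
      = v2 * (K / x4) + v3 * (- (K / x5)) + v4 * (- (K * x2 / (x4 * x4)) + r * (1 / x4) * K * W + m / x4)
        + v5 * (K * x3 / (x5 * x5) + n / x5)"
      if "x4 \<noteq> 0" "x5 \<noteq> 0" for K r W x2 x3 x4 x5 v2 v3 v4 v5 :: real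
      using that by (simp add: field_simps)
    ultimately show "?\<Lambda> V = 0"
      unfolding c2_def c3_def c4_def c5_def using F by simp
  qed
  then show "orbit_dim G c F = 6" by simp
qed

text \<open>
  On x5 = 0 the equation of x3 loses its inhomogeneous terms.
\<close>

lemma hyperplane_set_invariant:
  fixes F :: "'e \<Rightarrow>\<^sub>L real"
  assumes F: "F \<in> hyperplane_set s3 s4"
  shows "orbit F \<subseteq> hyperplane_set s3 s4"
proof
  fix P assume P: "P \<in> orbit F"
  let ?R = "\<lambda>x2 x3 x4 x5 :: real. x5 = 0 \<and> s3 * x3 > 0 \<and> s4 * x4 > 0"
  have "?R (P X2) (P X3) (P X4) (P X5)"
  proof (rule orbit_subset_invariant[where R = ?R, OF _ _ P])
    show "?R (F X2) (F X3) (F X4) (F X5)" using F by (simp add: hyperplane_set_def)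
    fix x2 x3 x4 x5 v1 v6 v7 :: "real \<Rightarrow> real"
    assume v: "continuous_on {0..1} v1" "continuous_on {0..1} v6" "continuous_on {0..1} v7"
    let ?r4 = "\<lambda>t. v6 t * (eX + aX) + v7 t * (eY + aY)" and ?r5 = "\<lambda>t. v6 t * (eX + bX) + v7 t * (eY + bY)"
    assume d3: "\<And>t. t \<in> {0..1} \<Longrightarrow> (x3 has_real_derivative
        v1 t * x5 t + (v6 t * bX + v7 t * bY) * x3 t + (v6 t * pX + v7 t * pY) * x5 t) (at t)"
      and d4: "\<And>t. t \<in> {0..1} \<Longrightarrow> (x4 has_real_derivative ?r4 t * x4 t) (at t)"
      and d5: "\<And>t. t \<in> {0..1} \<Longrightarrow> (x5 has_real_derivative ?r5 t * x5 t) (at t)"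
      and R0: "?R (x2 0) (x3 0) (x4 0) (x5 0)"
    obtain E4 where E4: "\<And>t. t \<in> {0..1} \<Longrightarrow> E4 t > 0 \<and> x4 t = E4 t * x4 0"
      using linear_ode_scales[OF v(2,3) d4] by blast
    obtain E5 where E5: "\<And>t. t \<in> {0..1} \<Longrightarrow> E5 t > 0 \<and> x5 t = E5 t * x5 0"
      using linear_ode_scales[OF v(2,3) d5] by blast
    have x5: "x5 t = 0" if "t \<in> {0..1}" for t using E5[OF that] R0 by simp
    have "\<And>t. t \<in> {0..1} \<Longrightarrow> (x3 has_real_derivative (v6 t * bX + v7 t * bY) * x3 t) (at t)"
      using d3 x5 by simp
    from linear_ode_scales[OF v(2,3) this]
    obtain E3 where E3: "\<And>t. t \<in> {0..1} \<Longrightarrow> E3 t > 0 \<and> x3 t = E3 t * x3 0"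
      by blast
    from E3[of 1] E4[of 1] x5[of 1] R0 show "?R (x2 1) (x3 1) (x4 1) (x5 1)"
      by (simp add: sign_scale)
  qed
  then show "P \<in> hyperplane_set s3 s4" by (simp add: hyperplane_set_def)
qed

text \<open>
  The argument of the generic case with x3 in the place of x5. Here X and Y move x3 and x4
  independently, X1 moves x2, X2 moves x1, and X3, X4 move x and y.
\<close>

lemma hyperplane_orbit:
  fixes F :: "'e \<Rightarrow>\<^sub>L real"
  assumes F: "F X3 \<noteq> 0" "F X4 \<noteq> 0" "F X5 = 0"
    and det: "bX * (eY + aY) - bY * (eX + aX) \<noteq> 0"
  shows "orbit F = hyperplane_set (F X3) (F X4)" and "orbit_dim G c F = 6"
proof -
  let ?S = "hyperplane_set (F X3) (F X4)"
  let ?\<pi> = "\<lambda>P :: 'e \<Rightarrow>\<^sub>L real. (P X1, P X2, P X3, P X4, P X, P Y)"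
  have \<pi>: "bounded_linear ?\<pi>" by (intro bounded_linear_Pair blinfun.bounded_linear_left)
  have FS: "F \<in> ?S" using F by (auto simp: hyperplane_set_def zero_less_mult_iff)
  have surj: "\<exists>v. ?\<pi> (ad_star P v) = y" if P: "P X3 \<noteq> 0" "P X4 \<noteq> 0" "P X5 = 0" for P :: "'e \<Rightarrow>\<^sub>L real" and y
  proof -
    obtain y1 y2 y3 y4 y6 y7 where y: "y = (y1, y2, y3, y4, y6, y7)" by (metis prod_cases6)
    obtain v6 v7 where 67: "v6 * bX + v7 * bY = y3 / P X3"
      "v6 * (eX + aX) + v7 * (eY + aY) = y4 / P X4"
      using linear_system_2x2[OF det] by metis
    \<comment> \<open>the coefficients of X and Y being fixed, X1 corrects x2 and X2 corrects x1\<close>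
    define v1 where "v1 = (y2 - (v6 * aX + v7 * aY) * P X2 - (v6 * qX + v7 * qY) * P X4) / P X4"
    define v2 where "v2 = ((v6 * eX + v7 * eY) * P X1 - y1) / P X4"
    obtain s t where st: "s * bX + t * (eX + aX) = - y6 - v1 * eX * P X1 - v2 * (aX * P X2 + qX * P X4)"
      "s * bY + t * (eY + aY) = - y7 - v1 * eY * P X1 - v2 * (aY * P X2 + qY * P X4)"
      using linear_system_2x2[of bX "eY + aY" "eX + aX" bY] det by (metis mult.commute)
    have "?\<pi> (ad_star P (comb v1 v2 (s / P X3) (t / P X4) 0 v6 v7)) = y"
      unfolding ad_star_apply coadjoint_field y using 67 st P
      by (simp add: v1_def v2_def mult.commute[of s] mult.commute[of t])
    then show ?thesis by blast
  qed
  have inj: "inj_on ?\<pi> ?S"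
    by (rule inj_onI, rule blinfun_determined) (auto simp: hyperplane_set_def)
  have "?\<pi> ` ?S = UNIV \<times> UNIV \<times> {x. F X3 * x > 0} \<times> {x. F X4 * x > 0} \<times> UNIV \<times> UNIV"
  proof (intro equalityI subsetI)
    fix y :: "real \<times> real \<times> real \<times> real \<times> real \<times> real"
    assume "y \<in> UNIV \<times> UNIV \<times> {x. F X3 * x > 0} \<times> {x. F X4 * x > 0} \<times> UNIV \<times> UNIV"
    then obtain y1 y2 y3 y4 y6 y7 where y: "y = (y1, y2, y3, y4, y6, y7)" "F X3 * y3 > 0" "F X4 * y4 > 0"
      by auto
    obtain P :: "'e \<Rightarrow>\<^sub>L real" where P: "P X1 = y1" "P X2 = y2" "P X3 = y3" "P X4 = y4" "P X5 = 0" "P X = y6" "P Y = y7"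
      using functional_exists by metis
    with y have "P \<in> ?S" "?\<pi> P = y" by (simp_all add: hyperplane_set_def)
    then show "y \<in> ?\<pi> ` ?S" by blast
  qed (auto simp: hyperplane_set_def)
  then have conn': "connected (?\<pi> ` ?S)"
    by (simp add: connected_Times connected_halfline connected_UNIV)
  show "orbit F = ?S"
    by (rule orbit_eq_if_locally_transitive[OF \<pi> inj conn' hyperplane_set_invariant surj FS])
      (auto simp: hyperplane_set_def)
  have "orbit_dim G c F = DIM(real \<times> real \<times> real \<times> real \<times> real \<times> real)"
  proof (rule orbit_dim_bounds(2)[OF \<pi>, where \<Lambda> = "\<lambda>V. blinfun_apply V X5"])
    show "\<exists>v. ?\<pi> (ad_star F v) = y" for y using F by (rule surj)
    show "V = 0" if "V X5 = 0" "?\<pi> V = 0" for V :: "'e \<Rightarrow>\<^sub>L real"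
      using that by (intro blinfun_determined) (auto simp: zero_prod_def)
    show "V X5 = 0" if "V \<in> tangent_vectors (orbit F) F" for V :: "'e \<Rightarrow>\<^sub>L real"
      by (rule tangent_vector_annihilates[OF that, of _ 0])
        (use hyperplane_set_invariant[OF FS] in \<open>auto simp: hyperplane_set_def\<close>)
  qed (rule blinfun.bounded_linear_left)
  then show "orbit_dim G c F = 6" by simp
qed

text \<open>
  The remaining five coordinates embed the tangent space.
\<close>

lemma orbit_dim_le_5:
  fixes F :: "'e \<Rightarrow>\<^sub>L real"
  assumes A: "\<And>P :: 'e \<Rightarrow>\<^sub>L real. P \<in> orbit F \<Longrightarrow> P A = a" and B: "\<And>P :: 'e \<Rightarrow>\<^sub>L real. P \<in> orbit F \<Longrightarrow> P B = b"
    and AB: "(A, B) \<in> {(X2, X4), (X3, X5), (X4, X5)}"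
  shows "orbit_dim G c F \<le> 5"
proof -
  have ann: "(V A, V B) = 0" if "V \<in> tangent_vectors (orbit F) F" for V :: "'e \<Rightarrow>\<^sub>L real"
    using tangent_vector_annihilates[OF that A] tangent_vector_annihilates[OF that B]
    by (simp add: zero_prod_def)
  have \<Lambda>: "bounded_linear (\<lambda>V :: 'e \<Rightarrow>\<^sub>L real. (V A, V B))"
    by (intro bounded_linear_Pair blinfun.bounded_linear_left)
  have "orbit_dim G c F \<le> DIM(real \<times> real \<times> real \<times> real \<times> real)"
    if R: "\<And>V. (blinfun_apply V A, blinfun_apply V B) = 0 \<Longrightarrow>
      (blinfun_apply V X1, blinfun_apply V C, blinfun_apply V D, blinfun_apply V X, blinfun_apply V Y) = 0 \<Longrightarrow>
      V = (0 :: 'e \<Rightarrow>\<^sub>L real)" for C D :: 'e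
  proof (rule orbit_dim_bounds(1)[OF _ \<Lambda> ann])
    show "bounded_linear (\<lambda>V :: 'e \<Rightarrow>\<^sub>L real. (V X1, V C, V D, V X, V Y))"
      by (intro bounded_linear_Pair blinfun.bounded_linear_left)
    show "V = 0" if "(V A, V B) = 0" "(V X1, V C, V D, V X, V Y) = 0" for V :: "'e \<Rightarrow>\<^sub>L real"
      using that by (rule R)
  qed
  from this[of X3 X5] this[of X2 X4] this[of X2 X3] AB show ?thesis
    using blinfun_determined[of _ 0] by (auto simp: zero_prod_def)
qed

lemma orbit_dim_le_5_if_X3_X5_zero:
  fixes F :: "'e \<Rightarrow>\<^sub>L real"
  assumes F: "F X3 = 0" "F X5 = 0"
  shows "orbit_dim G c F \<le> 5"
proof -
  let ?R = "\<lambda>x2 x3 x4 x5 :: real. x3 = 0 \<and> x5 = 0"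
  have "?R (P X2) (P X3) (P X4) (P X5)" if P: "P \<in> orbit F" for P
  proof (rule orbit_subset_invariant[where R = ?R, OF _ _ P])
    show "?R (F X2) (F X3) (F X4) (F X5)" using F by simp
    fix x2 x3 x4 x5 v1 v6 v7 :: "real \<Rightarrow> real"
    assume v: "continuous_on {0..1} v1" "continuous_on {0..1} v6" "continuous_on {0..1} v7"
      and d3: "\<And>t. t \<in> {0..1} \<Longrightarrow> (x3 has_real_derivative
        v1 t * x5 t + (v6 t * bX + v7 t * bY) * x3 t + (v6 t * pX + v7 t * pY) * x5 t) (at t)"
      and d5: "\<And>t. t \<in> {0..1} \<Longrightarrow> (x5 has_real_derivative (v6 t * (eX + bX) + v7 t * (eY + bY)) * x5 t) (at t)"
      and R0: "?R (x2 0) (x3 0) (x4 0) (x5 0)"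
    obtain E5 where E5: "\<And>t. t \<in> {0..1} \<Longrightarrow> E5 t > 0 \<and> x5 t = E5 t * x5 0"
      using linear_ode_scales[OF v(2,3) d5] by blast
    have x5: "x5 t = 0" if "t \<in> {0..1}" for t using E5[OF that] R0 by simp
    have "\<And>t. t \<in> {0..1} \<Longrightarrow> (x3 has_real_derivative (v6 t * bX + v7 t * bY) * x3 t) (at t)"
      using d3 x5 by simp
    from linear_ode_scales[OF v(2,3) this]
    obtain E3 where E3: "\<And>t. t \<in> {0..1} \<Longrightarrow> E3 t > 0 \<and> x3 t = E3 t * x3 0"
      by blast
    from E3[of 1] x5[of 1] R0 show "?R (x2 1) (x3 1) (x4 1) (x5 1)" by simp
  qed
  then show ?thesis by (intro orbit_dim_le_5[of F X3 0 X5 0]) auto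
qed

lemma orbit_dim_le_5_if_X4_X5_zero:
  fixes F :: "'e \<Rightarrow>\<^sub>L real"
  assumes F: "F X4 = 0" "F X5 = 0"
  shows "orbit_dim G c F \<le> 5"
proof -
  let ?R = "\<lambda>x2 x3 x4 x5 :: real. x4 = 0 \<and> x5 = 0"
  have "?R (P X2) (P X3) (P X4) (P X5)" if P: "P \<in> orbit F" for P
  proof (rule orbit_subset_invariant[where R = ?R, OF _ _ P])
    show "?R (F X2) (F X3) (F X4) (F X5)" using F by simp
    fix x2 x3 x4 x5 v1 v6 v7 :: "real \<Rightarrow> real"
    assume v: "continuous_on {0..1} v1" "continuous_on {0..1} v6" "continuous_on {0..1} v7"
      and d4: "\<And>t. t \<in> {0..1} \<Longrightarrow> (x4 has_real_derivative (v6 t * (eX + aX) + v7 t * (eY + aY)) * x4 t) (at t)"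
      and d5: "\<And>t. t \<in> {0..1} \<Longrightarrow> (x5 has_real_derivative (v6 t * (eX + bX) + v7 t * (eY + bY)) * x5 t) (at t)"
      and R0: "?R (x2 0) (x3 0) (x4 0) (x5 0)"
    obtain E4 where E4: "\<And>t. t \<in> {0..1} \<Longrightarrow> E4 t > 0 \<and> x4 t = E4 t * x4 0"
      using linear_ode_scales[OF v(2,3) d4] by blast
    obtain E5 where E5: "\<And>t. t \<in> {0..1} \<Longrightarrow> E5 t > 0 \<and> x5 t = E5 t * x5 0"
      using linear_ode_scales[OF v(2,3) d5] by blast
    from E4[of 1] E5[of 1] R0 show "?R (x2 1) (x3 1) (x4 1) (x5 1)" by simp
  qed
  then show ?thesis by (intro orbit_dim_le_5[of F X4 0 X5 0]) auto
qed

text \<open>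
  On x4 = 0 the coordinate x2 only feels the weights aX and aY.
\<close>

lemma orbit_dim_le_5_if_X4_zero_X2_constant:
  fixes F :: "'e \<Rightarrow>\<^sub>L real"
  assumes F: "F X4 = 0" and a: "aX = 0" "aY = 0"
  shows "orbit_dim G c F \<le> 5"
proof -
  let ?R = "\<lambda>x2 x3 x4 x5 :: real. x2 = F X2 \<and> x4 = 0"
  have "?R (P X2) (P X3) (P X4) (P X5)" if P: "P \<in> orbit F" for P
  proof (rule orbit_subset_invariant[where R = ?R, OF _ _ P])
    show "?R (F X2) (F X3) (F X4) (F X5)" using F by simp
    fix x2 x3 x4 x5 v1 v6 v7 :: "real \<Rightarrow> real"
    assume v: "continuous_on {0..1} v1" "continuous_on {0..1} v6" "continuous_on {0..1} v7"
      and d2: "\<And>t. t \<in> {0..1} \<Longrightarrow> (x2 has_real_derivative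
        v1 t * x4 t + (v6 t * aX + v7 t * aY) * x2 t + (v6 t * qX + v7 t * qY) * x4 t) (at t)"
      and d4: "\<And>t. t \<in> {0..1} \<Longrightarrow> (x4 has_real_derivative (v6 t * (eX + aX) + v7 t * (eY + aY)) * x4 t) (at t)"
      and R0: "?R (x2 0) (x3 0) (x4 0) (x5 0)"
    obtain E4 where E4: "\<And>t. t \<in> {0..1} \<Longrightarrow> E4 t > 0 \<and> x4 t = E4 t * x4 0"
      using linear_ode_scales[OF v(2,3) d4] by blast
    have x4: "x4 t = 0" if "t \<in> {0..1}" for t using E4[OF that] R0 by simp
    have "x2 1 = x2 0" by (rule zero_derivative_endpoints) (use d2 x4 a in simp)
    with x4[of 1] R0 show "?R (x2 1) (x3 1) (x4 1) (x5 1)" by simp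
  qed
  then show ?thesis by (intro orbit_dim_le_5[of F X2 "F X2" X4 0]) auto
qed

end

section \<open>The five groups\<close>

context seven_dim_group begin

lemma generic_functional_exists: "\<exists>F :: 'e \<Rightarrow>\<^sub>L real. F X4 * F X5 \<noteq> 0"
proof -
  obtain F :: "'e \<Rightarrow>\<^sub>L real" where "F X4 = 1" "F X5 = 1"
    using functional_exists[of 0 0 0 1 1 0 0] by blast
  then have "F X4 * F X5 \<noteq> 0" by simp
  then show ?thesis by blast
qed

text \<open>
  The weights of the second algebra, where the orbits with x4 = 0 are all degenerate since x2 is
  constant on them.
\<close>

lemma orbits_X1_scaled:
  fixes F :: "'e \<Rightarrow>\<^sub>L real"
  assumes X: "eX = 1" "aX = 0" "bX = 0" "qX = 0" "pX = 0"
    and Y: "eY = 0" "aY = 0" "bY = 1" "qY = 0" "pY = 0"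
  shows "orbit_dim G c F \<le> 6"
    and "orbit_dim G c F = 6 \<longleftrightarrow> F X4 \<noteq> 0 \<and> (F X3)\<^sup>2 + (F X5)\<^sup>2 \<noteq> 0"
    and "F X3 * F X4 \<noteq> 0 \<Longrightarrow> F X5 = 0 \<Longrightarrow>
      orbit F = {P :: 'e \<Rightarrow>\<^sub>L real. P X5 = 0 \<and> F X3 * P X3 > 0 \<and> F X4 * P X4 > 0}"
    and "F X4 * F X5 \<noteq> 0 \<Longrightarrow>
      orbit F = {P :: 'e \<Rightarrow>\<^sub>L real. P X2 - P X3 * P X4 / P X5 = (F X2 * F X5 - F X3 * F X4) / F X5
        \<and> F X4 * P X4 > 0 \<and> F X5 * P X5 > 0}"
proof -
  have inv: "casimir_exponents 1 0 0" unfolding casimir_exponents_def using X Y by simp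
  have generic: "orbit_dim G c F = 6 \<and>
      orbit F = generic_set 1 0 0 (F X4) (F X5) (casimir 1 0 0 (F X2) (F X3) (F X4) (F X5))"
    if "F X4 \<noteq> 0" "F X5 \<noteq> 0"
    using generic_orbit[OF inv that] X Y by simp
  have hyper: "orbit_dim G c F = 6 \<and> orbit F = hyperplane_set (F X3) (F X4)"
    if "F X3 \<noteq> 0" "F X4 \<noteq> 0" "F X5 = 0"
    using hyperplane_orbit[OF that] X Y by simp
  have deg: "orbit_dim G c F \<le> 5" if "F X4 = 0 \<or> F X3 = 0 \<and> F X5 = 0"
    using that orbit_dim_le_5_if_X3_X5_zero[of F] orbit_dim_le_5_if_X4_zero_X2_constant[of F] X Y by blast
  show "orbit_dim G c F \<le> 6" using generic hyper deg by fastforce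
  show "orbit_dim G c F = 6 \<longleftrightarrow> F X4 \<noteq> 0 \<and> (F X3)\<^sup>2 + (F X5)\<^sup>2 \<noteq> 0"
    using generic hyper deg by (fastforce simp: sum_power2_eq_zero_iff)
  show "orbit F = {P :: 'e \<Rightarrow>\<^sub>L real. P X5 = 0 \<and> F X3 * P X3 > 0 \<and> F X4 * P X4 > 0}"
    if "F X3 * F X4 \<noteq> 0" "F X5 = 0"
    using hyper that by (simp add: hyperplane_set_def)
  show "orbit F = {P :: 'e \<Rightarrow>\<^sub>L real. P X2 - P X3 * P X4 / P X5 = (F X2 * F X5 - F X3 * F X4) / F X5
        \<and> F X4 * P X4 > 0 \<and> F X5 * P X5 > 0}" if "F X4 * F X5 \<noteq> 0"
  proof -
    have I: "casimir 1 0 0 x2 x3 x4 x5 = x2 - x3 * x4 / x5" if "x4 \<noteq> 0" for x2 x3 x4 x5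
      using that by (simp add: casimir_def right_diff_distrib)
    have F: "F X4 \<noteq> 0" "F X5 \<noteq> 0" using that by simp_all
    then have "casimir 1 0 0 (F X2) (F X3) (F X4) (F X5) = (F X2 * F X5 - F X3 * F X4) / F X5"
      unfolding I[OF F(1)] by (simp add: diff_divide_distrib)
    then have "orbit F = {P. casimir 1 0 0 (blinfun_apply P X2) (P X3) (P X4) (P X5)
          = (F X2 * F X5 - F X3 * F X4) / F X5 \<and> F X4 * P X4 > 0 \<and> F X5 * P X5 > 0}"
      using generic[OF F] by (simp only: generic_set_def)
    also have "\<dots> = {P. blinfun_apply P X2 - P X3 * P X4 / P X5
          = (F X2 * F X5 - F X3 * F X4) / F X5 \<and> F X4 * P X4 > 0 \<and> F X5 * P X5 > 0}"
    proof (rule Collect_cong)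
      fix P :: "'e \<Rightarrow>\<^sub>L real"
      show "casimir 1 0 0 (P X2) (P X3) (P X4) (P X5) = (F X2 * F X5 - F X3 * F X4) / F X5
            \<and> F X4 * P X4 > 0 \<and> F X5 * P X5 > 0
        \<longleftrightarrow> P X2 - P X3 * P X4 / P X5 = (F X2 * F X5 - F X3 * F X4) / F X5
            \<and> F X4 * P X4 > 0 \<and> F X5 * P X5 > 0"
        by (cases "P X4 = 0") (simp_all only: I mult_zero_right less_irrefl simp_thms)
    qed
    finally show ?thesis .
  qed
qed

text \<open>
  If X and Y commute with X1, both hyperplanes x4 = 0 and x5 = 0 carry orbits of dimension 6.
\<close>

lemma orbits_X1_fixed:
  fixes F :: "'e \<Rightarrow>\<^sub>L real"
  assumes e: "eX = 0" "eY = 0" and det: "aX * bY - bX * aY \<noteq> 0" and inv: "casimir_exponents 0 m n"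
  shows "orbit_dim G c F \<le> 6"
    and "orbit_dim G c F = 6 \<longleftrightarrow>
      (F X4 = 0 \<and> F X2 * F X5 \<noteq> 0) \<or> (F X4 \<noteq> 0 \<and> (F X3)\<^sup>2 + (F X5)\<^sup>2 \<noteq> 0)"
    and "F X4 = 0 \<Longrightarrow> F X2 * F X5 \<noteq> 0 \<Longrightarrow>
      orbit F = {P :: 'e \<Rightarrow>\<^sub>L real. P X4 = 0 \<and> F X2 * P X2 > 0 \<and> F X5 * P X5 > 0}"
    and "F X5 = 0 \<Longrightarrow> F X3 * F X4 \<noteq> 0 \<Longrightarrow>
      orbit F = {P :: 'e \<Rightarrow>\<^sub>L real. P X5 = 0 \<and> F X3 * P X3 > 0 \<and> F X4 * P X4 > 0}"
    and "F X4 * F X5 \<noteq> 0 \<Longrightarrow>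
      orbit F = {P :: 'e \<Rightarrow>\<^sub>L real. P X2 / P X4 - P X3 / P X5 + m * ln \<bar>P X4\<bar> + n * ln \<bar>P X5\<bar>
          = F X2 / F X4 - F X3 / F X5 + m * ln \<bar>F X4\<bar> + n * ln \<bar>F X5\<bar>
        \<and> F X4 * P X4 > 0 \<and> F X5 * P X5 > 0}"
proof -
  interpret sw: seven_dim_group G U \<phi> X1 X3 X2 X5 X4 X Y eX bX aX pX qX eY bY aY pY qY
    by (rule swapped)
  have generic: "orbit_dim G c F = 6 \<and>
      orbit F = generic_set 0 m n (F X4) (F X5) (casimir 0 m n (F X2) (F X3) (F X4) (F X5))"
    if "F X4 \<noteq> 0" "F X5 \<noteq> 0"
    using generic_orbit[OF inv that] e det by simp
  have hyper5: "orbit_dim G c F = 6 \<and> orbit F = hyperplane_set (F X3) (F X4)"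
    if "F X3 \<noteq> 0" "F X4 \<noteq> 0" "F X5 = 0"
    using hyperplane_orbit[OF that] e det by (simp add: mult.commute)
  have hyper4: "orbit_dim G c F = 6 \<and> orbit F = sw.hyperplane_set (F X2) (F X5)"
    if "F X2 \<noteq> 0" "F X5 \<noteq> 0" "F X4 = 0"
    using sw.hyperplane_orbit[OF that] e det by (simp add: mult.commute)
  have deg: "orbit_dim G c F \<le> 5" if "F X3 = 0 \<and> F X5 = 0 \<or> F X4 = 0 \<and> F X5 = 0 \<or> F X2 = 0 \<and> F X4 = 0"
    using that orbit_dim_le_5_if_X3_X5_zero[of F] orbit_dim_le_5_if_X4_X5_zero[of F] sw.orbit_dim_le_5_if_X3_X5_zero[of F] by blast
  show "orbit_dim G c F \<le> 6" using generic hyper5 hyper4 deg by fastforce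
  show "orbit_dim G c F = 6 \<longleftrightarrow>
      (F X4 = 0 \<and> F X2 * F X5 \<noteq> 0) \<or> (F X4 \<noteq> 0 \<and> (F X3)\<^sup>2 + (F X5)\<^sup>2 \<noteq> 0)"
    using generic hyper5 hyper4 deg by (fastforce simp: sum_power2_eq_zero_iff)
  show "orbit F = {P :: 'e \<Rightarrow>\<^sub>L real. P X4 = 0 \<and> F X2 * P X2 > 0 \<and> F X5 * P X5 > 0}"
    if "F X4 = 0" "F X2 * F X5 \<noteq> 0"
    using hyper4 that by (simp add: sw.hyperplane_set_def)
  show "orbit F = {P :: 'e \<Rightarrow>\<^sub>L real. P X5 = 0 \<and> F X3 * P X3 > 0 \<and> F X4 * P X4 > 0}"
    if "F X5 = 0" "F X3 * F X4 \<noteq> 0"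
    using hyper5 that by (simp add: hyperplane_set_def)
  show "orbit F = {P :: 'e \<Rightarrow>\<^sub>L real. P X2 / P X4 - P X3 / P X5 + m * ln \<bar>P X4\<bar> + n * ln \<bar>P X5\<bar>
          = F X2 / F X4 - F X3 / F X5 + m * ln \<bar>F X4\<bar> + n * ln \<bar>F X5\<bar>
        \<and> F X4 * P X4 > 0 \<and> F X5 * P X5 > 0}" if "F X4 * F X5 \<noteq> 0"
    using generic that by (simp add: generic_set_def casimir_def)
qed

end

lemma ln_abs_div_powr:
  "x \<noteq> 0 \<Longrightarrow> y \<noteq> 0 \<Longrightarrow> ln (\<bar>x\<bar> / \<bar>y\<bar> powr l) = ln \<bar>x\<bar> - l * ln \<bar>y :: real\<bar>"
  by (simp add: ln_div ln_powr)

context lie_group_chart begin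

lemma G2_group:
  assumes "connected (carrier G)" "is_G2 br X1 X2 X3 X4 X5 X Y"
  shows "seven_dim_group G U \<phi> X1 X2 X3 X4 X5 X Y 1 0 0 0 0 0 0 1 0 0"
  by unfold_locales (use assms in \<open>simp_all add: is_G2_def\<close>)

lemma G3_group:
  assumes "connected (carrier G)" "is_G3 br X1 X2 X3 X4 X5 X Y"
  shows "seven_dim_group G U \<phi> X1 X2 X3 X4 X5 X Y 0 1 0 0 0 0 0 1 0 0"
  by unfold_locales (use assms in \<open>simp_all add: is_G3_def\<close>)

lemma G4_00_group:
  assumes "connected (carrier G)" "is_G4_00 br X1 X2 X3 X4 X5 X Y"
  shows "seven_dim_group G U \<phi> X1 X2 X3 X4 X5 X Y 1 0 0 0 0 0 1 0 0 0"
  by unfold_locales (use assms in \<open>simp_all add: is_G4_00_def\<close>)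

lemma G9_group:
  assumes "connected (carrier G)" "is_G9 br X1 X2 X3 X4 X5 X Y"
  shows "seven_dim_group G U \<phi> X1 X2 X3 X4 X5 X Y 0 0 1 0 0 0 1 0 0 1"
  by unfold_locales (use assms in \<open>simp_all add: is_G9_def\<close>)

lemma G10_group:
  assumes "connected (carrier G)" "is_G10 l br X1 X2 X3 X4 X5 X Y"
  shows "seven_dim_group G U \<phi> X1 X2 X3 X4 X5 X Y 0 1 l 0 0 0 0 1 0 1"
  by unfold_locales (use assms in \<open>simp_all add: is_G10_def\<close>)

end

theorem theorem3p3:
  fixes G :: "('g::{t2_space,second_countable_topology}, 'e::euclidean_space) lie_group"
    and c :: "('g, 'e) chart"
    and X1 X2 X3 X4 X5 X Y :: 'e
    and l :: real
  defines "br \<equiv> lie_bracket G c"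
    and "\<Omega> \<equiv> coadjoint_orbit G c"
    and "dim\<Omega> \<equiv> orbit_dim G c"
  defines "G2 \<equiv> is_G2 br X1 X2 X3 X4 X5 X Y"
    and "G3 \<equiv> is_G3 br X1 X2 X3 X4 X5 X Y"
    and "G4 \<equiv> is_G4_00 br X1 X2 X3 X4 X5 X Y"
    and "G9 \<equiv> is_G9 br X1 X2 X3 X4 X5 X Y"
    and "G10 \<equiv> is_G10 l br X1 X2 X3 X4 X5 X Y"
  assumes "is_lie_group G"
    and "connected (carrier G)"
    and "simply_connected (carrier G)"
    and "chart_at_one G c"
  shows "(G2 \<or> G3 \<or> G4 \<or> G9 \<or> G10 \<longrightarrow> (\<forall>F :: 'e \<Rightarrow>\<^sub>L real. dim\<Omega> F \<le> 6) \<and> (\<exists>F :: 'e \<Rightarrow>\<^sub>L real. dim\<Omega> F = 6))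
    \<and> (G2 \<longrightarrow> (\<forall>F :: 'e \<Rightarrow>\<^sub>L real.
        (dim\<Omega> F = 6 \<longleftrightarrow> F X4 \<noteq> 0 \<and> (F X3)\<^sup>2 + (F X5)\<^sup>2 \<noteq> 0)
        \<and> (F X3 * F X4 \<noteq> 0 \<and> F X5 = 0 \<longrightarrow>
            \<Omega> F = {P :: 'e \<Rightarrow>\<^sub>L real. P X5 = 0 \<and> F X3 * P X3 > 0 \<and> F X4 * P X4 > 0})
        \<and> (F X4 * F X5 \<noteq> 0 \<longrightarrow>
            \<Omega> F = {P :: 'e \<Rightarrow>\<^sub>L real. P X2 - P X3 * P X4 / P X5 = (F X2 * F X5 - F X3 * F X4) / F X5
                      \<and> F X4 * P X4 > 0 \<and> F X5 * P X5 > 0})))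
    \<and> (G4 \<longrightarrow> (\<forall>F :: 'e \<Rightarrow>\<^sub>L real.
        (dim\<Omega> F = 6 \<longleftrightarrow> F X5 \<noteq> 0 \<and> (F X2)\<^sup>2 + (F X4)\<^sup>2 \<noteq> 0)
        \<and> (F X2 * F X5 \<noteq> 0 \<and> F X4 = 0 \<longrightarrow>
            \<Omega> F = {P :: 'e \<Rightarrow>\<^sub>L real. P X4 = 0 \<and> F X2 * P X2 > 0 \<and> F X5 * P X5 > 0})
        \<and> (F X4 * F X5 \<noteq> 0 \<longrightarrow>
            \<Omega> F = {P :: 'e \<Rightarrow>\<^sub>L real. P X3 - P X2 * P X5 / P X4 = (F X3 * F X4 - F X2 * F X5) / F X4
                      \<and> F X4 * P X4 > 0 \<and> F X5 * P X5 > 0})))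
    \<and> (G3 \<or> G9 \<or> G10 \<longrightarrow> (\<forall>F :: 'e \<Rightarrow>\<^sub>L real.
        (dim\<Omega> F = 6 \<longleftrightarrow>
            (F X4 = 0 \<and> F X2 * F X5 \<noteq> 0) \<or> (F X4 \<noteq> 0 \<and> (F X3)\<^sup>2 + (F X5)\<^sup>2 \<noteq> 0))
        \<and> (F X4 = 0 \<and> F X2 * F X5 \<noteq> 0 \<longrightarrow>
            \<Omega> F = {P :: 'e \<Rightarrow>\<^sub>L real. P X4 = 0 \<and> F X2 * P X2 > 0 \<and> F X5 * P X5 > 0})
        \<and> (F X5 = 0 \<and> F X3 * F X4 \<noteq> 0 \<longrightarrow>
            \<Omega> F = {P :: 'e \<Rightarrow>\<^sub>L real. P X5 = 0 \<and> F X3 * P X3 > 0 \<and> F X4 * P X4 > 0})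
        \<and> (F X4 * F X5 \<noteq> 0 \<longrightarrow>
            (G3 \<longrightarrow> \<Omega> F = {P :: 'e \<Rightarrow>\<^sub>L real. P X2 / P X4 - P X3 / P X5 = F X2 / F X4 - F X3 / F X5
                      \<and> F X4 * P X4 > 0 \<and> F X5 * P X5 > 0})
            \<and> (G9 \<longrightarrow> \<Omega> F = {P :: 'e \<Rightarrow>\<^sub>L real. P X2 / P X4 - P X3 / P X5 + ln \<bar>P X4\<bar>
                          = F X2 / F X4 - F X3 / F X5 + ln \<bar>F X4\<bar>
                      \<and> F X4 * P X4 > 0 \<and> F X5 * P X5 > 0})
            \<and> (G10 \<longrightarrow> \<Omega> F = {P :: 'e \<Rightarrow>\<^sub>L real. P X2 / P X4 - P X3 / P X5 + ln (\<bar>P X5\<bar> / \<bar>P X4\<bar> powr l)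
                          = F X2 / F X4 - F X3 / F X5 + ln (\<bar>F X5\<bar> / \<bar>F X4\<bar> powr l)
                      \<and> F X4 * P X4 > 0 \<and> F X5 * P X5 > 0}))))"
proof -
  obtain U \<phi> where c: "c = (U, \<phi>)" by (cases c)
  interpret lie_group_chart G U \<phi>
    using assms by (unfold_locales) (auto simp: chart_at_one_def c)
  have conn: "connected (carrier G)" by fact
  note defs = br_def \<Omega>_def dim\<Omega>_def c
  have G2: "(dim\<Omega> F \<le> 6 \<and> (\<exists>F. dim\<Omega> F = 6)) \<and>
      (dim\<Omega> F = 6 \<longleftrightarrow> F X4 \<noteq> 0 \<and> (F X3)\<^sup>2 + (F X5)\<^sup>2 \<noteq> 0)
        \<and> (F X3 * F X4 \<noteq> 0 \<and> F X5 = 0 \<longrightarrow>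
            \<Omega> F = {P :: 'e \<Rightarrow>\<^sub>L real. P X5 = 0 \<and> F X3 * P X3 > 0 \<and> F X4 * P X4 > 0})
        \<and> (F X4 * F X5 \<noteq> 0 \<longrightarrow>
            \<Omega> F = {P :: 'e \<Rightarrow>\<^sub>L real. P X2 - P X3 * P X4 / P X5 = (F X2 * F X5 - F X3 * F X4) / F X5
                      \<and> F X4 * P X4 > 0 \<and> F X5 * P X5 > 0})"
    if "G2" for F :: "'e \<Rightarrow>\<^sub>L real"
  proof -
    interpret seven_dim_group G U \<phi> X1 X2 X3 X4 X5 X Y 1 0 0 0 0 0 0 1 0 0
      by (rule G2_group[OF conn]) (use that in \<open>simp add: G2_def defs\<close>)
    note o = orbits_X1_scaled[OF refl refl refl refl refl refl refl refl refl refl]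
    obtain F' :: "'e \<Rightarrow>\<^sub>L real" where "F' X4 * F' X5 \<noteq> 0" using generic_functional_exists by blast
    then have "orbit_dim G (U, \<phi>) F' = 6" using o(2)[of F'] by (simp add: sum_power2_eq_zero_iff)
    with o[of F] show ?thesis unfolding defs by blast
  qed
  have G4: "(dim\<Omega> F \<le> 6 \<and> (\<exists>F. dim\<Omega> F = 6)) \<and>
      (dim\<Omega> F = 6 \<longleftrightarrow> F X5 \<noteq> 0 \<and> (F X2)\<^sup>2 + (F X4)\<^sup>2 \<noteq> 0)
        \<and> (F X2 * F X5 \<noteq> 0 \<and> F X4 = 0 \<longrightarrow>
            \<Omega> F = {P :: 'e \<Rightarrow>\<^sub>L real. P X4 = 0 \<and> F X2 * P X2 > 0 \<and> F X5 * P X5 > 0})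
        \<and> (F X4 * F X5 \<noteq> 0 \<longrightarrow>
            \<Omega> F = {P :: 'e \<Rightarrow>\<^sub>L real. P X3 - P X2 * P X5 / P X4 = (F X3 * F X4 - F X2 * F X5) / F X4
                      \<and> F X4 * P X4 > 0 \<and> F X5 * P X5 > 0})"
    if "G4" for F :: "'e \<Rightarrow>\<^sub>L real"
  proof -
    \<comment> \<open>after the exchange of X2, X4 with X3, X5 these are the weights of the second algebra\<close>
    have "seven_dim_group G U \<phi> X1 X2 X3 X4 X5 X Y 1 0 0 0 0 0 1 0 0 0"
      by (rule G4_00_group[OF conn]) (use that in \<open>simp add: G4_def defs\<close>)
    then interpret seven_dim_group G U \<phi> X1 X3 X2 X5 X4 X Y 1 0 0 0 0 0 0 1 0 0
      by (rule seven_dim_group.swapped)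
    note o = orbits_X1_scaled[OF refl refl refl refl refl refl refl refl refl refl]
    obtain F' :: "'e \<Rightarrow>\<^sub>L real" where "F' X5 * F' X4 \<noteq> 0" using generic_functional_exists by blast
    then have ex: "orbit_dim G (U, \<phi>) F' = 6" using o(2)[of F'] by (simp add: sum_power2_eq_zero_iff)
    have comm: "F X5 * P X5 > 0 \<and> F X4 * P X4 > 0 \<longleftrightarrow> F X4 * P X4 > 0 \<and> F X5 * P X5 > 0"
      for P :: "'e \<Rightarrow>\<^sub>L real" by blast
    from ex o[of F] show ?thesis unfolding defs comm mult.commute[of "F X4" "F X5"] by blast
  qed
  \<comment> \<open>everything that the third, ninth and tenth groups have in common; only their generic orbits differ\<close>
  define boundary_orbits where "boundary_orbits F \<longleftrightarrow> dim\<Omega> F \<le> 6 \<and> (\<exists>F. dim\<Omega> F = 6)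
        \<and> (dim\<Omega> F = 6 \<longleftrightarrow>
            (F X4 = 0 \<and> F X2 * F X5 \<noteq> 0) \<or> (F X4 \<noteq> 0 \<and> (F X3)\<^sup>2 + (F X5)\<^sup>2 \<noteq> 0))
        \<and> (F X4 = 0 \<and> F X2 * F X5 \<noteq> 0 \<longrightarrow>
            \<Omega> F = {P :: 'e \<Rightarrow>\<^sub>L real. P X4 = 0 \<and> F X2 * P X2 > 0 \<and> F X5 * P X5 > 0})
        \<and> (F X5 = 0 \<and> F X3 * F X4 \<noteq> 0 \<longrightarrow>
            \<Omega> F = {P :: 'e \<Rightarrow>\<^sub>L real. P X5 = 0 \<and> F X3 * P X3 > 0 \<and> F X4 * P X4 > 0})"
    for F :: "'e \<Rightarrow>\<^sub>L real"
  have X1_fixed: "boundary_orbits F \<and> (F X4 * F X5 \<noteq> 0 \<longrightarrow>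
            \<Omega> F = {P :: 'e \<Rightarrow>\<^sub>L real. P X2 / P X4 - P X3 / P X5 + m * ln \<bar>P X4\<bar> + n * ln \<bar>P X5\<bar>
                = F X2 / F X4 - F X3 / F X5 + m * ln \<bar>F X4\<bar> + n * ln \<bar>F X5\<bar>
              \<and> F X4 * P X4 > 0 \<and> F X5 * P X5 > 0})"
    if grp: "seven_dim_group G U \<phi> X1 X2 X3 X4 X5 X Y 0 aX bX qX pX 0 aY bY qY pY"
      and det: "aX * bY - bX * aY \<noteq> 0"
      and exponents: "qX - pX + m * aX + n * bX = 0" "qY - pY + m * aY + n * bY = 0"
    for F :: "'e \<Rightarrow>\<^sub>L real" and aX bX qX pX aY bY qY pY m n
  proof -
    interpret seven_dim_group G U \<phi> X1 X2 X3 X4 X5 X Y 0 aX bX qX pX 0 aY bY qY pY by (rule grp)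
    have "casimir_exponents 0 m n" unfolding casimir_exponents_def using exponents by simp
    note o = orbits_X1_fixed[OF refl refl det this]
    obtain F' :: "'e \<Rightarrow>\<^sub>L real" where "F' X4 * F' X5 \<noteq> 0" using generic_functional_exists by blast
    then have "orbit_dim G (U, \<phi>) F' = 6" using o(2)[of F'] by (simp add: sum_power2_eq_zero_iff)
    with o[of F] show ?thesis unfolding boundary_orbits_def defs by blast
  qed
  have G3: "boundary_orbits F \<and> (F X4 * F X5 \<noteq> 0 \<longrightarrow>
      \<Omega> F = {P :: 'e \<Rightarrow>\<^sub>L real. P X2 / P X4 - P X3 / P X5 = F X2 / F X4 - F X3 / F X5
        \<and> F X4 * P X4 > 0 \<and> F X5 * P X5 > 0})" if "G3" for F :: "'e \<Rightarrow>\<^sub>L real"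
  proof -
    have "seven_dim_group G U \<phi> X1 X2 X3 X4 X5 X Y 0 1 0 0 0 0 0 1 0 0"
      by (rule G3_group[OF conn]) (use that in \<open>simp add: G3_def defs\<close>)
    from X1_fixed[OF this, of 0 0 F] show ?thesis by simp
  qed
  have G9: "boundary_orbits F \<and> (F X4 * F X5 \<noteq> 0 \<longrightarrow>
      \<Omega> F = {P :: 'e \<Rightarrow>\<^sub>L real. P X2 / P X4 - P X3 / P X5 + ln \<bar>P X4\<bar> = F X2 / F X4 - F X3 / F X5 + ln \<bar>F X4\<bar>
        \<and> F X4 * P X4 > 0 \<and> F X5 * P X5 > 0})" if "G9" for F :: "'e \<Rightarrow>\<^sub>L real"
  proof -
    have "seven_dim_group G U \<phi> X1 X2 X3 X4 X5 X Y 0 0 1 0 0 0 1 0 0 1"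
      by (rule G9_group[OF conn]) (use that in \<open>simp add: G9_def defs\<close>)
    from X1_fixed[OF this, of 1 0 F] show ?thesis by simp
  qed
  have G10: "boundary_orbits F \<and> (F X4 * F X5 \<noteq> 0 \<longrightarrow>
      \<Omega> F = {P :: 'e \<Rightarrow>\<^sub>L real. P X2 / P X4 - P X3 / P X5 + ln (\<bar>P X5\<bar> / \<bar>P X4\<bar> powr l)
          = F X2 / F X4 - F X3 / F X5 + ln (\<bar>F X5\<bar> / \<bar>F X4\<bar> powr l)
        \<and> F X4 * P X4 > 0 \<and> F X5 * P X5 > 0})" if "G10" for F :: "'e \<Rightarrow>\<^sub>L real"
  proof -
    have "seven_dim_group G U \<phi> X1 X2 X3 X4 X5 X Y 0 1 l 0 0 0 0 1 0 1"
      by (rule G10_group[OF conn]) (use that in \<open>simp add: G10_def defs\<close>)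
    note * = X1_fixed[OF this, of "- l" 1 F]
    have eq: "P X2 / P X4 - P X3 / P X5 + - l * ln \<bar>P X4\<bar> + 1 * ln \<bar>P X5\<bar>
        = P X2 / P X4 - P X3 / P X5 + ln (\<bar>P X5\<bar> / \<bar>P X4\<bar> powr l)"
      if "P X4 \<noteq> 0 \<and> P X5 \<noteq> 0" for P :: "'e \<Rightarrow>\<^sub>L real"
      using that by (simp add: ln_abs_div_powr)
    have "{P :: 'e \<Rightarrow>\<^sub>L real. P X2 / P X4 - P X3 / P X5 + - l * ln \<bar>P X4\<bar> + 1 * ln \<bar>P X5\<bar>
          = F X2 / F X4 - F X3 / F X5 + - l * ln \<bar>F X4\<bar> + 1 * ln \<bar>F X5\<bar>
        \<and> F X4 * P X4 > 0 \<and> F X5 * P X5 > 0}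
      = {P :: 'e \<Rightarrow>\<^sub>L real. P X2 / P X4 - P X3 / P X5 + ln (\<bar>P X5\<bar> / \<bar>P X4\<bar> powr l)
          = F X2 / F X4 - F X3 / F X5 + ln (\<bar>F X5\<bar> / \<bar>F X4\<bar> powr l)
        \<and> F X4 * P X4 > 0 \<and> F X5 * P X5 > 0}" if "F X4 * F X5 \<noteq> 0"
    proof (rule Collect_cong)
      fix P :: "'e \<Rightarrow>\<^sub>L real"
      have F: "F X4 \<noteq> 0 \<and> F X5 \<noteq> 0" using that by simp
      show "P X2 / P X4 - P X3 / P X5 + - l * ln \<bar>P X4\<bar> + 1 * ln \<bar>P X5\<bar>
          = F X2 / F X4 - F X3 / F X5 + - l * ln \<bar>F X4\<bar> + 1 * ln \<bar>F X5\<bar>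
        \<and> F X4 * P X4 > 0 \<and> F X5 * P X5 > 0 \<longleftrightarrow>
        P X2 / P X4 - P X3 / P X5 + ln (\<bar>P X5\<bar> / \<bar>P X4\<bar> powr l)
          = F X2 / F X4 - F X3 / F X5 + ln (\<bar>F X5\<bar> / \<bar>F X4\<bar> powr l)
        \<and> F X4 * P X4 > 0 \<and> F X5 * P X5 > 0"
      proof (cases "P X4 \<noteq> 0 \<and> P X5 \<noteq> 0")
        case True
        show ?thesis unfolding eq[OF True] eq[OF F] ..
      next
        case False
        then show ?thesis by auto
      qed
    qed
    with * show ?thesis by simp
  qed
  have boundary_orbits: "boundary_orbits F" if "G3 \<or> G9 \<or> G10" for F :: "'e \<Rightarrow>\<^sub>L real"
    using that G3[THEN conjunct1] G9[THEN conjunct1] G10[THEN conjunct1] by (elim disjE)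
  have six: "dim\<Omega> F \<le> 6 \<and> (\<exists>F. dim\<Omega> F = 6)" if "G2 \<or> G3 \<or> G4 \<or> G9 \<or> G10" for F :: "'e \<Rightarrow>\<^sub>L real"
  proof -
    have "dim\<Omega> F \<le> 6 \<and> (\<exists>F. dim\<Omega> F = 6)" if "boundary_orbits F"
      using that unfolding boundary_orbits_def by (intro conjI; elim conjE)
    with that G2[of F, THEN conjunct1] G4[of F, THEN conjunct1] boundary_orbits[of F] show ?thesis by argo
  qed
  let "?six \<and> ?G2 \<and> ?G4 \<and> (?G3_G9_G10 \<longrightarrow> (\<forall>F. ?G3_case F))" = ?thesis
  have ?six
  proof (intro impI conjI allI)
    assume any: "G2 \<or> G3 \<or> G4 \<or> G9 \<or> G10"
    show "dim\<Omega> F \<le> 6" for F using six[OF any, of F] by (rule conjunct1)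
    show "\<exists>F. dim\<Omega> F = 6" using six[OF any, of 0] by (rule conjunct2)
  qed
  moreover have ?G2 using G2[THEN conjunct2] by (intro impI allI)
  moreover have ?G4 using G4[THEN conjunct2] by (intro impI allI)
  moreover have "?G3_G9_G10 \<longrightarrow> (\<forall>F. ?G3_case F)"
  proof (intro impI allI)
    fix F :: "'e \<Rightarrow>\<^sub>L real"
    assume "G3 \<or> G9 \<or> G10"
    from boundary_orbits[OF this, of F, unfolded boundary_orbits_def]
      G3[of F, THEN conjunct2] G9[of F, THEN conjunct2] G10[of F, THEN conjunct2]
    show "?G3_case F" by (intro conjI impI; elim conjE; simp only: simp_thms)
  qed
  ultimately show ?thesis by (intro conjI)
qed

end
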